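(* Let $a,b,c\in\mathbb{R}$ with $a,b\ne 0$, let $h(z)=ae^z+bz+c$, and put $\alpha=c/a$, $\beta=b/a$. If $h$ has a real zero, then its Newton's method $N_h(z)=z-h(z)/h'(z)$ has no wandering domains. Moreover, $h$ has a real zero if and only if either $ab>0$, or $ab<0$ and $c/b\ge 1-\ln(-b/a)$ (equivalently, if and only if either $\beta>0$, or $\beta<0$ and $\alpha\le\beta(1-\ln(-\beta))$).
   Context: $N_h$ is regarded as a meromorphic map $\mathbb{C}\to\widehat{\mathbb{C}}$. For a meromorphic map $f:\mathbb{C}\to\widehat{\mathbb{C}}$, the Fatou set $F(f)$ is the set of points having a neighborhood on which all iterates $f^n$, $n>0$, are well defined and form a normal family. A Fatou component is a connected component of $F(f)$. For a Fatou component $U$, let $U_n$ be the Fatou component containing $f^n(U)$; $U$ is a wandering domain if it is neither periodic nor preperiodic, i.e. $U_n\ne U_m$ for all $n\ne m$. *)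

theory Defs
  imports "HOL-Complex_Analysis.Complex_Analysis"
begin

datatype riemann_sphere = Cpx complex | Infty

text \<open>Stereographic projection onto the unit sphere of \<open>\<complex> \<times> \<real>\<close>; the distance it
  induces is the chordal metric.\<close>

fun stereographic :: "riemann_sphere \<Rightarrow> complex \<times> real" where
  "stereographic (Cpx z) =
     ((2 / ((norm z)\<^sup>2 + 1)) *\<^sub>R z, ((norm z)\<^sup>2 - 1) / ((norm z)\<^sup>2 + 1))"
| "stereographic Infty = (0, 1)"

lemma stereographic_height: "snd (stereographic (Cpx z)) = 1 - 2 / ((norm z)\<^sup>2 + 1)"
proof -
  have "(norm z)\<^sup>2 + 1 > 0" by (simp add: add_nonneg_pos)
  then show ?thesis by (simp add: field_simps)
qed

lemma inj_stereographic: "inj stereographic"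
proof (rule injI)
  have pos: "(norm z)\<^sup>2 + 1 > 0" for z :: complex by (simp add: add_nonneg_pos)
  have ne: "snd (stereographic (Cpx z)) \<noteq> 1" for z
    using pos[of z] unfolding stereographic_height by simp
  have fin: "z = w" if eq: "stereographic (Cpx z) = stereographic (Cpx w)" for z w
  proof -
    have h: "2 / ((norm z)\<^sup>2 + 1) = 2 / ((norm w)\<^sup>2 + 1)"
      using arg_cong[OF eq, of snd] unfolding stereographic_height by simp
    have "(2 / ((norm z)\<^sup>2 + 1)) *\<^sub>R z = (2 / ((norm z)\<^sup>2 + 1)) *\<^sub>R w"
      using arg_cong[OF eq, of fst] h by simp
    moreover have "2 / ((norm z)\<^sup>2 + 1) \<noteq> 0" using pos[of z] by simp
    ultimately show "z = w" by (metis scaleR_left_imp_eq)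
  qed
  fix x y assume eq: "stereographic x = stereographic y"
  show "x = y"
  proof (cases x)
    case (Cpx z)
    then show ?thesis using eq ne[of z] fin by (cases y) (auto simp del: stereographic.simps(1))
  next
    case Infty
    then show ?thesis
      using eq ne by (cases y) (auto simp del: stereographic.simps(1), metis snd_conv)
  qed
qed

instantiation riemann_sphere :: metric_space
begin

definition "dist x y = dist (stereographic x) (stereographic y)"

definition "(uniformity :: (riemann_sphere \<times> riemann_sphere) filter) =
  (INF e\<in>{0<..}. principal {(x, y). dist x y < e})"

definition "open (U :: riemann_sphere set) \<longleftrightarrow>
  (\<forall>x\<in>U. eventually (\<lambda>(x', y). x' = x \<longrightarrow> y \<in> U) uniformity)"

instance
proof
  fix x y z :: riemann_sphere
  show "dist x y = 0 \<longleftrightarrow> x = y"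
    unfolding dist_riemann_sphere_def by (simp add: inj_eq[OF inj_stereographic])
  show "dist x y \<le> dist x z + dist y z"
    unfolding dist_riemann_sphere_def by (rule dist_triangle2)
qed (simp_all only: uniformity_riemann_sphere_def open_riemann_sphere_def)

end

text \<open>The map into the sphere given by a meromorphic function: poles go to infinity and
  removable singularities are filled in. A bare expression such as \<open>\<lambda>z. g z / k z\<close> takes the
  value 0 wherever \<open>k\<close> vanishes, also where the quotient has a pole or a nonzero limit.\<close>

definition meromorphic_map :: "(complex \<Rightarrow> complex) \<Rightarrow> complex \<Rightarrow> riemann_sphere" where
  "meromorphic_map f z = (if is_pole f z then Infty else Cpx (remove_sings f z))"

definition newton_map :: "(complex \<Rightarrow> complex) \<Rightarrow> complex \<Rightarrow> riemann_sphere" where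
  "newton_map h = meromorphic_map (\<lambda>z. z - h z / deriv h z)"

text \<open>A map \<open>f : \<complex> \<rightarrow> \<complex> \<union> {\<infinity>}\<close> is not defined at infinity, so \<open>f\<^sup>n(z)\<close> exists only if none of
  \<open>z, f(z), \<dots>, f\<^sup>n\<^sup>-\<^sup>1(z)\<close> is infinity (while \<open>f\<^sup>n(z)\<close> itself may be). The total function
  \<open>iterate f n\<close> has the junk value infinity elsewhere.\<close>

fun iterate :: "(complex \<Rightarrow> riemann_sphere) \<Rightarrow> nat \<Rightarrow> complex \<Rightarrow> riemann_sphere" where
  "iterate f 0 z = Cpx z"
| "iterate f (Suc n) z = (case iterate f n z of Cpx w \<Rightarrow> f w | Infty \<Rightarrow> Infty)"

definition iterate_defined :: "(complex \<Rightarrow> riemann_sphere) \<Rightarrow> nat \<Rightarrow> complex \<Rightarrow> bool" where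
  "iterate_defined f n z \<longleftrightarrow> (\<forall>k<n. iterate f k z \<noteq> Infty)"

text \<open>Limits are taken in the sphere, so locally uniform convergence to infinity is allowed.\<close>

definition normal_family :: "complex set \<Rightarrow> (complex \<Rightarrow> riemann_sphere) set \<Rightarrow> bool" where
  "normal_family V \<F> \<longleftrightarrow>
     (\<forall>\<phi> :: nat \<Rightarrow> complex \<Rightarrow> riemann_sphere. range \<phi> \<subseteq> \<F> \<longrightarrow>
       (\<exists>r g. strict_mono r \<and>
          (\<forall>K. compact K \<and> K \<subseteq> V \<longrightarrow> uniform_limit K (\<lambda>n. \<phi> (r n)) g sequentially)))"

definition fatou_set :: "(complex \<Rightarrow> riemann_sphere) \<Rightarrow> complex set" where
  "fatou_set f = {z. \<exists>V. open V \<and> z \<in> V \<and>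
     (\<forall>n>0. \<forall>w\<in>V. iterate_defined f n w) \<and> normal_family V {iterate f n |n. n > 0}}"

definition fatou_component :: "(complex \<Rightarrow> riemann_sphere) \<Rightarrow> complex set \<Rightarrow> bool" where
  "fatou_component f U \<longleftrightarrow> U \<in> components (fatou_set f)"

definition component_image ::
    "(complex \<Rightarrow> riemann_sphere) \<Rightarrow> complex set \<Rightarrow> nat \<Rightarrow> complex set \<Rightarrow> bool" where
  "component_image f U n W \<longleftrightarrow> fatou_component f W \<and> iterate f n ` U \<subseteq> Cpx ` W"

text \<open>\<open>component_image f U n W\<close> says that \<open>W\<close> is \<open>U\<^sub>n\<close>; there is at most one such \<open>W\<close>, since
  components are disjoint and nonempty. As the quantifiers over \<open>V\<close> and \<open>W\<close> are universal,
  a component that is not wandering really has \<open>U\<^sub>n\<close> and \<open>U\<^sub>m\<close> that exist and coincide for some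
  \<open>n \<noteq> m\<close>.\<close>

definition wandering_domain :: "(complex \<Rightarrow> riemann_sphere) \<Rightarrow> complex set \<Rightarrow> bool" where
  "wandering_domain f U \<longleftrightarrow> fatou_component f U \<and>
     (\<forall>n m V W. n \<noteq> m \<and> component_image f U n V \<and> component_image f U m W \<longrightarrow> V \<noteq> W)"

end

(* Let v be the finite asymptotic value of the Newton map f. All critical points of f are zeros of
   h, hence fixed, and a real zero of h makes the real orbit of v converge to a zero of h. So the
   postsingular set P has a neighbourhood of uniform width inside the basin of the zeros of h. The
   basin is dense, and this excludes wandering domains, since a Fatou component that meets the
   basin is eventually mapped into the invariant component around a zero.

   For the density, let z be a point outside the closure of the basin, and w_n its orbit. If the
   distance of w_n to the basin stays bounded along a subsequence, inverse branches of f^n exist on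
   discs about w_n reaching into the basin, because f is a covering away from P. By Montel they
   have a limit, which leads to a contradiction whether it is constant or not. If the distances
   tend to infinity, there are arbitrarily large discs without poles, zeros, or preimages of zeros
   of h. By the geometry of the zeros and poles, all of them lie far to the right, where f is close
   to the translation by -1, and this cannot go on forever. *)

theory Submission
  imports Defs
begin

section \<open>Complex analysis\<close>

text \<open>Two equations govern the geometry: zeros of \<open>h\<close> solve exp z = -\<beta> (z -
  v), and solutions of f z = q solve exp z = \<beta> (q - v) / (z - 1 - q). In both, the right-hand
  side has a small logarithmic derivative far from its zero or pole, so a solution lies within a
  fixed distance of every point where the two sides have comparable modulus.

  The obstacle is that \<open>P\<close> is unbounded and \<open>f\<close> is not proper: compactness
  alone gives neither the uniform width nor the covering. For the width, zeros p of \<open>h\<close>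
  far from \<open>v\<close> are simple with |exp p| and |h'(p)| comparable, so they attract on discs
  of a common radius. For the covering, preimages of a disc can escape to infinity only where
  \<open>exp\<close> is tiny, and there f' is close to f z - v, hence bounded below away from
  \<open>v\<close>.

  The discs about w_n must reach into the basin and yet keep a definite distance from
  \<open>P\<close>. The uniform width provides the room between these two radii, and the margin kept
  from \<open>P\<close> is what finally excludes a nonconstant limit.\<close>

lemma exp_eq_solution_near:
  fixes g :: "complex \<Rightarrow> complex"
  assumes hol: "g holomorphic_on ball w 15"
    and nz: "\<And>z. z \<in> ball w 15 \<Longrightarrow> g z \<noteq> 0"
    and dg: "\<And>z. z \<in> ball w 15 \<Longrightarrow> norm (deriv g z) \<le> norm (g z) / 2"
    and near: "\<bar>ln (norm (g w)) - Re w\<bar> \<le> 3"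
  obtains z where "z \<in> cball w 14" "exp z = g z"
proof -
  obtain L where L: "L holomorphic_on ball w 15" and eL: "\<And>x. x \<in> ball w 15 \<Longrightarrow> exp (L x) = g x"
    using holomorphic_logarithm_exists[of "ball w 15" g w] hol nz by auto
  have ReL: "Re (L w) = ln (norm (g w))"
    by (metis centre_in_ball eL exp_gt_zero ln_exp norm_exp_eq_Re zero_less_numeral)
  \<comment> \<open>A solution of exp z = g z is a fixed point of a branch of the logarithm of
    \<open>g\<close>, and \<open>dg\<close> makes every branch 1/2-Lipschitz. The multiple of 2 pi i
    is chosen so that the value of the branch at \<open>w\<close> is within pi of \<open>w\<close>
    in imaginary part.\<close>
  define k where "k = round ((Im w - Im (L w)) / (2 * pi))"
  define F where "F = (\<lambda>z. L z + 2 * pi * of_int k * \<i>)"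
  have "\<bar>of_int k - (Im w - Im (L w)) / (2 * pi)\<bar> \<le> 1 / 2"
    unfolding k_def by (rule of_int_round_abs_le)
  then have "\<bar>2 * pi\<bar> * \<bar>of_int k - (Im w - Im (L w)) / (2 * pi)\<bar> \<le> 2 * pi * (1 / 2)"
    by (intro mult_mono) auto
  moreover have "Im (F w) - Im w = 2 * pi * (of_int k - (Im w - Im (L w)) / (2 * pi))"
    by (simp add: F_def field_simps)
  ultimately have ImF: "\<bar>Im (F w) - Im w\<bar> \<le> pi"
    by (simp add: abs_mult)
  have Fw: "norm (F w - w) \<le> 7"
    using cmod_le[of "F w - w"] ImF near ReL pi_less_4 unfolding F_def by simp
  have L': "(L has_field_derivative deriv L z) (at z)" if "z \<in> ball w 15" for z
    using holomorphic_derivI[OF L _ that] by simp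
  have dL: "norm (deriv L z) \<le> 1 / 2" if z: "z \<in> ball w 15" for z
  proof -
    have "((\<lambda>x. exp (L x)) has_field_derivative exp (L z) * deriv L z) (at z)"
      by (rule DERIV_fun_exp[OF L'[OF z]])
    then have "(g has_field_derivative exp (L z) * deriv L z) (at z)"
      by (rule has_field_derivative_transform_within_open[of _ _ _ "ball w 15"]) (use z eL in auto)
    then have "deriv g z = g z * deriv L z"
      using DERIV_imp_deriv eL z by metis
    then have "norm (g z) * norm (deriv L z) \<le> norm (g z) * (1 / 2)"
      using dg[OF z] by (simp add: norm_mult)
    then show ?thesis using nz[OF z] by simp
  qed
  have lip: "norm (F x - F y) \<le> 1 / 2 * norm (x - y)" if "x \<in> cball w 14" "y \<in> cball w 14" for x y
  proof -
    have "norm (L x - L y) \<le> 1 / 2 * norm (x - y)"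
      by (rule field_differentiable_bound[of "ball w 15" L "deriv L"])
        (use that dL L' in \<open>auto intro: has_field_derivative_at_within\<close>)
    then show ?thesis by (simp add: F_def)
  qed
  \<comment> \<open>The centre moves by at most 3 + pi < 7 and distances shrink by the factor 1/2,
    so the disc of radius 2 * 7 is mapped into itself.\<close>
  have "\<exists>!z\<in>cball w 14. F z = z"
  proof (rule Banach_fix[of _ "1/2"])
    show "F ` cball w 14 \<subseteq> cball w 14"
    proof clarify
      fix z assume z: "z \<in> cball w 14"
      have "norm (F z - w) \<le> norm (F z - F w) + norm (F w - w)"
        by (metis diff_add_cancel add_diff_eq norm_triangle_ineq)
      also have "\<dots> \<le> 1/2 * norm (z - w) + 7"
        using lip[OF z, of w] Fw by auto
      also have "\<dots> \<le> 14" using z by (simp add: dist_norm norm_minus_commute)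
      finally show "F z \<in> cball w 14" by (simp add: dist_norm norm_minus_commute)
    qed
  qed (use lip in \<open>auto simp: dist_norm complete_eq_closed\<close>)
  then obtain z where z: "z \<in> cball w 14" "F z = z" by auto
  have "exp (F z) = exp (L z)"
    by (auto simp: F_def exp_eq intro!: exI[of _ k])
  with z eL[of z] have "exp z = g z" by simp
  with z show ?thesis using that by blast
qed

text \<open>A quantitative inverse function theorem: \<open>\<eta>\<close> depends on
  \<open>\<kappa>\<close>, \<open>C\<close> and \<open>m\<close> only, not on \<open>F\<close> or
  \<open>z\<close>. This uniformity lets a single disc serve all preimages of a point, of which
  there may be infinitely many.\<close>

lemma holomorphic_uniform_local_inverse:
  fixes \<kappa> C m :: real
  assumes "\<kappa> > 0" "C > 0" "m > 0"
  shows "\<exists>\<eta>>0. \<forall>F z. F holomorphic_on ball z \<kappa> \<longrightarrow> (\<forall>x\<in>ball z \<kappa>. norm (F x) \<le> C) \<longrightarrow>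
      m \<le> norm (deriv F z) \<longrightarrow>
      (\<exists>q. continuous_on (ball (F z) \<eta>) q \<and> q ` ball (F z) \<eta> \<subseteq> ball z \<kappa> \<and> q (F z) = z \<and>
           (\<forall>y\<in>ball (F z) \<eta>. F (q y) = y))"
proof -
  \<comment> \<open>Cauchy's estimate for the second derivative on discs of radius \<kappa>/4. The
    bound is taken as 2 C since the values have to lie in an open disc. Then \<open>\<sigma>\<close>
    is so small that F' varies by at most m/2 near \<open>z\<close>.\<close>
  define B where "B = 2 * (2 * C) / (\<kappa>/4)\<^sup>2"
  have "B > 0" using assms by (simp add: B_def)
  define \<sigma> where "\<sigma> = min (\<kappa>/2) (m / (2 * B))"
  have \<sigma>: "\<sigma> > 0" "\<sigma> \<le> \<kappa>/2" "B * \<sigma> \<le> m / 2"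
    using assms \<open>B > 0\<close> by (auto simp: \<sigma>_def min_def field_simps)
  define \<eta> where "\<eta> = m * \<sigma> / 4"
  have "\<eta> > 0" using \<sigma> assms by (simp add: \<eta>_def)
  moreover have "\<exists>q. continuous_on (ball (F z) \<eta>) q \<and> q ` ball (F z) \<eta> \<subseteq> ball z \<kappa> \<and> q (F z) = z \<and>
           (\<forall>y\<in>ball (F z) \<eta>. F (q y) = y)"
    if hol: "F holomorphic_on ball z \<kappa>" and bd: "\<And>x. x \<in> ball z \<kappa> \<Longrightarrow> norm (F x) \<le> C"
      and der: "m \<le> norm (deriv F z)" for F z
  proof -
    let ?D = "deriv F z"
    have D0: "?D \<noteq> 0" using der assms by auto
    have F': "(F has_field_derivative deriv F x) (at x)" if "x \<in> ball z \<kappa>" for x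
      using holomorphic_derivI[OF hol _ that] by simp
    have F'': "(deriv F has_field_derivative deriv (deriv F) x) (at x)" if "x \<in> ball z \<kappa>" for x
      using holomorphic_derivI[OF holomorphic_deriv[OF hol] _ that] by simp
    have sub: "ball z (\<kappa>/2) \<subseteq> ball z \<kappa>" using assms by auto
    have bd2: "norm (deriv (deriv F) x) \<le> B" if x: "x \<in> ball z (\<kappa>/2)" for x
    proof -
      have c: "cball x (\<kappa>/4) \<subseteq> ball z \<kappa>"
      proof
        fix y assume "y \<in> cball x (\<kappa>/4)"
        then show "y \<in> ball z \<kappa>" using dist_triangle[of z y x] x assms by auto
      qed
      then have b: "ball x (\<kappa>/4) \<subseteq> ball z \<kappa>" by auto
      have "cmod ((deriv ^^ 2) F x) \<le> fact 2 * (2 * C) / (\<kappa>/4) ^ 2"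
      proof (rule Cauchy_higher_deriv_bound)
        show "F holomorphic_on ball x (\<kappa>/4)" using hol b holomorphic_on_subset by blast
        show "continuous_on (cball x (\<kappa>/4)) F"
          using holomorphic_on_imp_continuous_on[OF hol] c continuous_on_subset by blast
        show "F w \<in> ball 0 (2 * C)" if "w \<in> ball x (\<kappa>/4)" for w
          using bd[of w] b that assms by auto
      qed (use assms in auto)
      then show ?thesis by (simp add: B_def numeral_2_eq_2)
    qed
    have dd: "norm (deriv F x - ?D) \<le> m / 2" if x: "x \<in> cball z (\<sigma>/2)" for x
    proof -
      have xs: "x \<in> ball z (\<kappa>/2)" using x \<sigma> by auto
      have "norm (deriv F x - deriv F z) \<le> B * norm (x - z)"
        by (rule field_differentiable_bound[of "ball z (\<kappa>/2)" _ "deriv (deriv F)"])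
          (use xs bd2 F'' sub assms in \<open>auto intro: has_field_derivative_at_within\<close>)
      also have "\<dots> \<le> B * \<sigma>" using x \<sigma> \<open>B > 0\<close> by (intro mult_left_mono) (auto simp: dist_norm norm_minus_commute)
      finally show ?thesis using \<sigma> by linarith
    qed
    have cs: "cball z (\<sigma>/2) \<subseteq> ball z \<kappa>" using \<sigma> assms by auto
    have quasi: "norm ((F x - ?D * x) - (F y - ?D * y)) \<le> m / 2 * norm (x - y)"
      if "x \<in> cball z (\<sigma>/2)" "y \<in> cball z (\<sigma>/2)" for x y
    proof (rule field_differentiable_bound[of "cball z (\<sigma>/2)" _ "\<lambda>x. deriv F x - ?D"])
      fix u assume u: "u \<in> cball z (\<sigma>/2)"
      show "((\<lambda>x. F x - ?D * x) has_field_derivative deriv F u - ?D) (at u within cball z (\<sigma>/2))"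
        by (rule has_field_derivative_at_within) (use F' u cs in \<open>auto intro!: derivative_eq_intros\<close>)
    qed (use that dd in auto)
    have ex: "\<exists>x\<in>cball z (\<sigma>/2). F x = y" if y: "y \<in> ball (F z) \<eta>" for y
    proof -
      \<comment> \<open>Newton's iteration with the derivative frozen at \<open>z\<close>: its fixed
        points solve F x = y, and \<open>quasi\<close> makes it contract by 1/2. The choice of
        \<open>\<eta>\<close> limits the displacement of the centre to \<sigma>/4.\<close>
      define T where "T = (\<lambda>x. x - (F x - y) / ?D)"
      have Tq: "norm (T a - T b) \<le> 1 / 2 * norm (a - b)"
        if "a \<in> cball z (\<sigma>/2)" "b \<in> cball z (\<sigma>/2)" for a b
      proof -
        have "T a - T b = - ((F a - ?D * a) - (F b - ?D * b)) / ?D"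
          using D0 by (simp add: T_def field_simps)
        then have "norm (T a - T b) = norm ((F a - ?D * a) - (F b - ?D * b)) / norm ?D"
          by (simp only: norm_divide norm_minus_cancel)
        also have "\<dots> \<le> (m / 2 * norm (a - b)) / m"
          using quasi[OF that] der assms by (intro frac_le) auto
        finally show ?thesis using assms by simp
      qed
      have Tz: "norm (T z - z) \<le> \<sigma> / 4"
      proof -
        have "norm (T z - z) = norm (F z - y) / norm ?D" by (simp add: T_def norm_divide)
        also have "\<dots> \<le> \<eta> / m" using y der assms \<open>\<eta> > 0\<close> by (intro frac_le) (auto simp: dist_norm)
        finally show ?thesis using assms by (simp add: \<eta>_def)
      qed
      have "\<exists>!x\<in>cball z (\<sigma>/2). T x = x"
      proof (rule Banach_fix[of _ "1/2"])
        show "T ` cball z (\<sigma>/2) \<subseteq> cball z (\<sigma>/2)"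
        proof clarify
          fix x assume x: "x \<in> cball z (\<sigma>/2)"
          have "norm (T x - z) \<le> norm (T x - T z) + norm (T z - z)"
            by (metis diff_add_cancel add_diff_eq norm_triangle_ineq)
          also have "\<dots> \<le> 1/2 * norm (x - z) + \<sigma>/4" using Tq[OF x, of z] Tz \<sigma> by auto
          also have "\<dots> \<le> \<sigma>/2" using x by (simp add: dist_norm norm_minus_commute)
          finally show "T x \<in> cball z (\<sigma>/2)" by (simp add: dist_norm norm_minus_commute)
        qed
      qed (use Tq \<sigma> in \<open>auto simp: dist_norm complete_eq_closed\<close>)
      then obtain x where "x \<in> cball z (\<sigma>/2)" "T x = x" by blast
      then show ?thesis using D0 by (intro bexI[of _ x]) (simp_all add: T_def)
    qed
    have expand: "m / 2 * norm (a - b) \<le> norm (F a - F b)"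
      if "a \<in> cball z (\<sigma>/2)" "b \<in> cball z (\<sigma>/2)" for a b
    proof -
      have "norm ?D * norm (a - b) = norm ((F a - F b) - ((F a - ?D * a) - (F b - ?D * b)))"
        unfolding norm_mult[symmetric] by (rule arg_cong[of _ _ norm]) (simp add: algebra_simps)
      also have "\<dots> \<le> norm (F a - F b) + m / 2 * norm (a - b)"
        using quasi[OF that] norm_triangle_ineq4 by (meson add_left_mono order_trans)
      finally have "norm ?D * norm (a - b) \<le> norm (F a - F b) + m / 2 * norm (a - b)" .
      moreover have "m * norm (a - b) \<le> norm ?D * norm (a - b)" using der by (intro mult_right_mono) auto
      ultimately show ?thesis by simp
    qed
    obtain q where q: "\<And>y. y \<in> ball (F z) \<eta> \<Longrightarrow> q y \<in> cball z (\<sigma>/2) \<and> F (q y) = y"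
      using ex by metis
    have lip: "norm (q a - q b) \<le> 2 / m * norm (a - b)" if "a \<in> ball (F z) \<eta>" "b \<in> ball (F z) \<eta>" for a b
      using expand[of "q a" "q b"] q[OF that(1)] q[OF that(2)] assms by (simp add: field_simps)
    have "(2 / m)-lipschitz_on (ball (F z) \<eta>) q"
      by (rule lipschitz_onI) (use lip assms in \<open>auto simp: dist_norm\<close>)
    then have "continuous_on (ball (F z) \<eta>) q" by (rule lipschitz_on_continuous_on)
    moreover have "q (F z) = z"
      using expand[of "q (F z)" z] q[of "F z"] \<open>\<eta> > 0\<close> \<sigma> assms by (auto simp: mult_le_0_iff)
    ultimately show ?thesis using q cs by (intro exI[of _ q]) auto
  qed
  ultimately show ?thesis by blast
qed

text \<open>The images of the sections over a small ball are the sheets. Two of them coincide or are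
  disjoint: the set where two sections agree is closed by continuity and open because images of
  sections are open by invariance of domain, and the ball is connected.\<close>

lemma covering_space_if_local_sections:
  fixes p :: "'a::euclidean_space \<Rightarrow> 'a"
  assumes cont: "continuous_on A p" and im: "p ` A = S"
    and sec: "\<And>w. w \<in> S \<Longrightarrow> \<exists>r>0. ball w r \<subseteq> S \<and> (\<forall>z\<in>A. p z \<in> ball w r \<longrightarrow>
        (\<exists>q. continuous_on (ball w r) q \<and> q ` ball w r \<subseteq> A \<and> (\<forall>y\<in>ball w r. p (q y) = y) \<and> q (p z) = z))"
  shows "covering_space A p S"
proof
  fix w assume "w \<in> S"
  then obtain r where r: "r > 0" "ball w r \<subseteq> S"
    and rq: "\<And>z. z \<in> A \<Longrightarrow> p z \<in> ball w r \<Longrightarrow> \<exists>q. continuous_on (ball w r) q \<and> q ` ball w r \<subseteq> A \<and>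
          (\<forall>y\<in>ball w r. p (q y) = y) \<and> q (p z) = z" using sec by meson
  let ?B = "ball w r"
  define Q where "Q = {q. continuous_on ?B q \<and> q ` ?B \<subseteq> A \<and> (\<forall>y\<in>?B. p (q y) = y)}"
  define v where "v = (\<lambda>q. q ` ?B) ` Q"
  have inj: "inj_on q ?B" if "q \<in> Q" for q
    using that by (auto simp: Q_def intro!: inj_on_inverseI[of _ p])
  have op: "open (q ` ?B)" if "q \<in> Q" for q
    using that inj[OF that] by (intro invariance_of_domain) (auto simp: Q_def)
  have agree: "q1 ` ?B = q2 ` ?B" if q: "q1 \<in> Q" "q2 \<in> Q" and ne: "q1 ` ?B \<inter> q2 ` ?B \<noteq> {}" for q1 q2
  proof -
    let ?E = "{y \<in> ?B. q1 y = q2 y}"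
    obtain y1 y2 where y: "y1 \<in> ?B" "y2 \<in> ?B" "q1 y1 = q2 y2" using ne by auto
    then have "y1 = y2" using q by (metis (mono_tags, lifting) Q_def mem_Collect_eq)
    then have "?E \<noteq> {}" using y by blast
    moreover have "openin (top_of_set ?B) ?E"
    proof -
      have "?E = ?B \<inter> q2 -` (q1 ` ?B)"
      proof (intro equalityI subsetI)
        fix y assume "y \<in> ?B \<inter> q2 -` (q1 ` ?B)"
        then obtain x where x: "x \<in> ?B" "q2 y = q1 x" "y \<in> ?B" by auto
        then have "x = y" using q by (metis (mono_tags, lifting) Q_def mem_Collect_eq)
        with x show "y \<in> ?E" by simp
      next
        fix y assume "y \<in> ?E"
        then have "y \<in> ?B" "q2 y = q1 y" by auto
        then show "y \<in> ?B \<inter> q2 -` (q1 ` ?B)" by auto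
      qed
      then show ?thesis
        using q op[OF q(1)] by (auto simp: Q_def intro!: continuous_openin_preimage_gen)
    qed
    moreover have "closedin (top_of_set ?B) ?E"
    proof -
      have "closedin (top_of_set ?B) (?B \<inter> (\<lambda>y. q1 y - q2 y) -` {0})"
        using q by (intro continuous_closedin_preimage continuous_intros) (auto simp: Q_def)
      moreover have "?B \<inter> (\<lambda>y. q1 y - q2 y) -` {0} = ?E" by auto
      ultimately show ?thesis by simp
    qed
    ultimately have "?E = ?B" using connected_clopen[of ?B] by auto
    then have "\<And>y. y \<in> ?B \<Longrightarrow> q1 y = q2 y" by blast
    then show ?thesis by (rule image_cong[OF refl])
  qed
  show "\<exists>T. w \<in> T \<and> openin (top_of_set S) T \<and>
          (\<exists>v. \<Union>v = A \<inter> p -` T \<and> (\<forall>u\<in>v. openin (top_of_set A) u) \<and> pairwise disjnt v \<and>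
               (\<forall>u\<in>v. \<exists>q. homeomorphism u T p q))"
  proof (intro exI[of _ ?B] conjI exI[of _ v])
    show "w \<in> ?B" using r by simp
    show "openin (top_of_set S) ?B" using r by (intro open_subset) auto
    show "\<Union>v = A \<inter> p -` ?B"
    proof (intro equalityI subsetI)
      fix z assume "z \<in> A \<inter> p -` ?B"
      then obtain q where "q \<in> Q" "q (p z) = z" "p z \<in> ?B" using rq[of z] by (auto simp: Q_def)
      then show "z \<in> \<Union>v" unfolding v_def by (metis UN_I imageI)
    qed (auto simp: v_def Q_def)
    show "\<forall>u\<in>v. openin (top_of_set A) u"
      using op by (auto simp: v_def Q_def intro!: open_subset)
    show "pairwise disjnt v"
      unfolding pairwise_def v_def disjnt_def using agree by blast
    show "\<forall>u\<in>v. \<exists>q. homeomorphism u ?B p q"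
    proof
      fix u assume "u \<in> v"
      then obtain q where q: "q \<in> Q" "u = q ` ?B" by (auto simp: v_def)
      have "homeomorphism u ?B p q"
      proof (rule homeomorphismI)
        show "continuous_on u p" using cont q by (auto simp: Q_def intro: continuous_on_subset)
      qed (use q in \<open>auto simp: Q_def\<close>)
      then show "\<exists>q. homeomorphism u ?B p q" by blast
    qed
  qed
qed (use cont im in auto)

text \<open>Lifting through a covering yields only a continuous map; locally it is a holomorphic
  inverse of \<open>F\<close> composed with \<open>G\<close>.\<close>

lemma holomorphic_on_if_lift:
  assumes F: "F holomorphic_on A" "open A" and dF: "\<And>z. z \<in> A \<Longrightarrow> deriv F z \<noteq> 0"
    and G: "G holomorphic_on D" "open D"
    and g: "continuous_on D g" "g ` D \<subseteq> A" and eq: "\<And>y. y \<in> D \<Longrightarrow> F (g y) = G y"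
  shows "g holomorphic_on D"
proof -
  have "g field_differentiable at y" if y: "y \<in> D" for y
  proof -
    have gy: "g y \<in> A" using y g by auto
    obtain r where r: "r > 0" "ball (g y) r \<subseteq> A" "inj_on F (ball (g y) r)"
      using has_complex_derivative_locally_injective[OF F(1) gy F(2) dF[OF gy]] by blast
    have holF: "F holomorphic_on ball (g y) r" using F(1) r(2) holomorphic_on_subset by blast
    obtain q where q: "q holomorphic_on F ` ball (g y) r"
        "\<And>z. z \<in> ball (g y) r \<Longrightarrow> deriv F z * deriv q (F z) = 1"
        "\<And>z. z \<in> ball (g y) r \<Longrightarrow> q (F z) = z"
      apply (rule holomorphic_has_inverse[OF holF open_ball r(3)])
      subgoal premises p for q by (rule p(1)[of q]) (fact p(2-4))+
      done
    let ?N = "D \<inter> g -` ball (g y) r"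
    have opN: "open ?N" by (rule continuous_open_preimage[OF g(1) G(2) open_ball])
    have "(q \<circ> G) holomorphic_on ?N"
    proof (rule holomorphic_on_compose_gen[OF _ q(1)])
      show "G holomorphic_on ?N" using G holomorphic_on_subset by blast
      show "G ` ?N \<subseteq> F ` ball (g y) r" using eq by force
    qed
    moreover have "g z = (q \<circ> G) z" if "z \<in> ?N" for z
      using that eq[of z] q(3)[of "g z"] by auto
    ultimately have "g holomorphic_on ?N"
      using holomorphic_cong[OF refl, of ?N g "q \<circ> G"] by blast
    then show ?thesis using opN y r(1) holomorphic_on_imp_differentiable_at[of g ?N y] by auto
  qed
  then show ?thesis using G(2) by (simp add: holomorphic_on_open field_differentiable_def)
qed

section \<open>Estimates for the exponential function and the logarithm\<close>

lemma norm_exp_minus_one_le: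
  fixes t :: complex
  assumes "norm t \<le> 1 / 2"
  shows "norm (exp t - 1) \<le> 2 * norm t"
proof -
  have "norm (exp t - exp 0) \<le> 2 * norm (t - 0)"
  proof (rule field_differentiable_bound[of "cball 0 (1/2)" exp exp])
    fix z :: complex assume z: "z \<in> cball 0 (1/2)"
    have "norm (exp z) \<le> 1 + 2 * norm z" using z by (intro exp_bound_lemma) auto
    then show "norm (exp z) \<le> 2" using z by simp
  qed (use assms in \<open>auto intro!: derivative_eq_intros\<close>)
  then show ?thesis by simp
qed

text \<open>Up to a constant factor, t exp t - exp t + 1 is the numerator of the error after a
  Newton step from distance t of a zero; t^2/2 is its leading term. The derivative of the difference
  is t (exp t - 1).\<close>

lemma norm_exp_second_difference_le:
  fixes t :: complex
  assumes "norm t \<le> 1 / 2"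
  shows "norm (t * exp t - exp t + 1 - t\<^sup>2 / 2) \<le> 2 * norm t ^ 3"
proof -
  have "norm ((t * exp t - exp t + 1 - t\<^sup>2 / 2) - (0 * exp 0 - exp 0 + 1 - 0\<^sup>2 / 2)) \<le>
          2 * norm t ^ 2 * norm (t - 0)"
  proof (rule field_differentiable_bound[of "cball 0 (norm t)" _ "\<lambda>s. s * (exp s - 1)"])
    fix z :: complex assume z: "z \<in> cball 0 (norm t)"
    show "((\<lambda>t. t * exp t - exp t + 1 - t\<^sup>2 / 2) has_field_derivative z * (exp z - 1))
        (at z within cball 0 (norm t))"
      by (auto intro!: derivative_eq_intros simp: algebra_simps)
    have "norm (exp z - 1) \<le> 2 * norm z"
      using z assms by (intro norm_exp_minus_one_le) auto
    then have "norm (z * (exp z - 1)) \<le> norm t * (2 * norm t)"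
      using z unfolding norm_mult by (intro mult_mono) auto
    then show "norm (z * (exp z - 1)) \<le> 2 * norm t ^ 2" by (simp add: power2_eq_square)
  qed auto
  then show ?thesis by (simp add: power2_eq_square power3_eq_cube)
qed

lemma abs_ln_minus_le_3:
  fixes x y :: real
  assumes "x > 0" "exp y \<le> 12 * x" "x \<le> 12 * exp y"
  shows "\<bar>ln x - y\<bar> \<le> 3"
proof -
  \<comment> \<open>At 3 the quadratic Taylor bound gives only 8.5, so it is used at 3/2 and
    squared.\<close>
  have "1 + 3/2 + (3/2)\<^sup>2 / 2 \<le> exp (3/2 :: real)" by (rule exp_lower_Taylor_quadratic) simp
  then have "(29/8) * (29/8) \<le> exp (3/2 :: real) * exp (3/2)"
    by (intro mult_mono) (auto simp: power2_eq_square)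
  then have e3: "12 \<le> exp (3 :: real)" by (simp add: exp_add[symmetric])
  have "exp y \<le> exp 3 * x" using assms mult_right_mono[OF e3, of x] by linarith
  also have "\<dots> = exp (3 + ln x)" using assms by (simp add: exp_add)
  finally have "y \<le> 3 + ln x" by simp
  moreover have "exp (ln x) \<le> exp 3 * exp y"
    using assms mult_right_mono[OF e3, of "exp y"] exp_gt_zero[of y] unfolding exp_ln[OF assms(1)]
    by linarith
  then have "ln x \<le> 3 + y" by (simp add: exp_add[symmetric] del: exp_ln)
  ultimately show ?thesis by linarith
qed

lemma ln_le_half: "M > 0 \<Longrightarrow> ln M \<le> M / 2" for M :: real
proof -
  assume M: "M > 0"
  have "ln (M / 2) \<le> M / 2 - 1" using M by (intro ln_le_minus_one) auto
  moreover have "ln (2::real) \<le> 1" using ln_le_minus_one[of 2] by simp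
  ultimately show ?thesis using M by (simp add: ln_div)
qed

section \<open>The Newton map and the basin of the zeros\<close>

text \<open>Dividing \<open>h\<close> by the coefficient of the exponential does not change Newton's
  method, so this coefficient is 1 here.\<close>

locale newton_exp =
  fixes \<alpha> \<beta> :: real
  assumes beta_nonzero: "\<beta> \<noteq> 0"
begin

definition h :: "complex \<Rightarrow> complex" where "h z = exp z + of_real \<beta> * z + of_real \<alpha>"

definition dh :: "complex \<Rightarrow> complex" where "dh z = exp z + of_real \<beta>"

text \<open>Division by zero makes \<open>f\<close> total: it fixes the poles of the Newton map, so that no pole
  belongs to the basin below. At a double zero of \<open>h\<close> it takes the right value.\<close>

definition f :: "complex \<Rightarrow> complex" where "f z = z - h z / dh z"

text \<open>The finite asymptotic value of \<open>f\<close>, approached as \<open>Re z \<rightarrow> -\<infinity>\<close>.\<close>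

definition v :: complex where "v = of_real (- \<alpha> / \<beta>)"

definition basin :: "complex set" where
  "basin = {z. \<exists>p. h p = 0 \<and> (\<lambda>n. (f ^^ n) z) \<longlonglongrightarrow> p}"

lemma h_alt: "h z = exp z + of_real \<beta> * (z - v)"
  using beta_nonzero by (simp add: h_def v_def algebra_simps)

lemma norm_exp_at_zero: "h p = 0 \<Longrightarrow> norm (exp p) = \<bar>\<beta>\<bar> * norm (p - v)"
  using h_alt[of p] by (metis add_eq_0_iff norm_minus_cancel norm_mult norm_of_real)

text \<open>Clearing denominators isolates the exponential. In this form preimages can be located by
  \<open>exp_eq_solution_near\<close>, and \<open>v\<close> is seen to be exceptional: for w = v the
  only candidate is 1 + v.\<close>

lemma f_eq_iff:
  assumes "dh z \<noteq> 0"
  shows "f z = w \<longleftrightarrow> (z - 1 - w) * exp z = of_real \<beta> * (w - v)"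
proof -
  have "f z = w \<longleftrightarrow> (z - w) * dh z = h z"
    using assms by (auto simp: f_def field_simps)
  then show ?thesis by (simp add: dh_def h_alt) (auto simp: algebra_simps)
qed

text \<open>The factor exp z makes \<open>v\<close> the limit of \<open>f\<close> to the left, as
  long as |z| does not outgrow 1 / |exp z|.\<close>

lemma f_minus_v: "dh z \<noteq> 0 \<Longrightarrow> f z - v = exp z * (z - 1 - v) / dh z"
  by (simp add: f_def h_alt dh_def field_simps)

text \<open>To the right \<open>dh z\<close> is large, and \<open>f\<close> is close to the
  translation by -1 wherever |exp z| dominates |z|.\<close>

lemma f_minus_shift: "dh z \<noteq> 0 \<Longrightarrow> f z - (z - 1) = - of_real \<beta> * (z - 1 - v) / dh z"
  by (simp add: f_def h_alt dh_def field_simps)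

lemma f_fixed: "h p = 0 \<Longrightarrow> f p = p"
  by (simp add: f_def)

lemma f_funpow_fixed: "h p = 0 \<Longrightarrow> (f ^^ n) p = p"
  by (induction n) (auto simp: f_fixed)

lemma zero_in_basin: "h p = 0 \<Longrightarrow> p \<in> basin"
  by (auto simp: basin_def f_funpow_fixed)

lemma f_in_basin_iff: "f z \<in> basin \<longleftrightarrow> z \<in> basin"
proof -
  have "(\<lambda>n. (f ^^ n) (f z)) \<longlonglongrightarrow> p \<longleftrightarrow> (\<lambda>n. (f ^^ n) z) \<longlonglongrightarrow> p" for p
    using filterlim_sequentially_Suc[of "\<lambda>n. (f ^^ n) z" "nhds p"] by (simp add: funpow_swap1)
  then show ?thesis by (simp add: basin_def)
qed

lemma funpow_in_basin_iff: "(f ^^ n) z \<in> basin \<longleftrightarrow> z \<in> basin"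
  by (induction n) (auto simp: f_in_basin_iff)

lemma dh_zero_imp_not_in_basin:
  assumes "dh z = 0" "h z \<noteq> 0"
  shows "z \<notin> basin"
proof
  have "f z = z" using assms by (simp add: f_def)
  then have "(f ^^ n) z = z" for n by (induction n) auto
  moreover assume "z \<in> basin"
  ultimately obtain p where "h p = 0" "(\<lambda>n. z) \<longlonglongrightarrow> p" by (auto simp: basin_def)
  then show False using assms LIMSEQ_unique[OF tendsto_const, of z p] by simp
qed

text \<open>The cleared equation may also hold where \<open>dh\<close> vanishes. This happens only
  at 1 + v, which is then a double zero of \<open>h\<close> and itself in the basin.\<close>

lemma solution_in_basin:
  assumes "(z - 1 - w) * exp z = of_real \<beta> * (w - v)" "w \<in> basin"
  shows "z \<in> basin"
proof (cases "dh z = 0")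
  case True
  then have "exp z = - of_real \<beta>" by (simp add: dh_def add_eq_0_iff)
  then have "of_real \<beta> * (z - 1 - v) = 0" using assms(1) by (simp add: algebra_simps)
  then have "z = 1 + v" using beta_nonzero by (simp add: diff_eq_eq)
  then have "h z = 0" using True by (simp add: h_alt dh_def)
  then show ?thesis by (rule zero_in_basin)
next
  case False
  then show ?thesis using f_eq_iff[OF False] assms f_in_basin_iff by metis
qed

section \<open>Derivatives of \<open>h\<close> and \<open>f\<close>\<close>

lemma has_derivative_h: "(h has_field_derivative dh z) (at z)"
  unfolding h_def dh_def by (auto intro!: derivative_eq_intros)

lemma has_derivative_dh: "(dh has_field_derivative exp z) (at z)"
  unfolding dh_def by (auto intro!: derivative_eq_intros)

lemma has_derivative_f:
  assumes "dh z \<noteq> 0"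
  shows "(f has_field_derivative h z * exp z / (dh z)\<^sup>2) (at z)"
  unfolding f_def
  by (rule derivative_eq_intros has_derivative_h has_derivative_dh assms refl)+
    (use assms in \<open>simp add: field_simps power2_eq_square\<close>)

lemma deriv_f: "dh z \<noteq> 0 \<Longrightarrow> deriv f z = h z * exp z / (dh z)\<^sup>2"
  by (rule DERIV_imp_deriv[OF has_derivative_f])

lemma deriv_f_nonzero: "dh z \<noteq> 0 \<Longrightarrow> h z \<noteq> 0 \<Longrightarrow> deriv f z \<noteq> 0"
  by (simp add: deriv_f)

text \<open>Here exp z is eliminated in favour of f z. The identity shows that f' is close to f z -
  v when z is large and f z stays bounded.\<close>

lemma deriv_f_alt:
  assumes "dh z \<noteq> 0" "z - 1 - f z \<noteq> 0"
  shows "deriv f z * (z - 1 - v) = (z - f z) * (f z - v)"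
proof -
  have 1: "dh z * (z - 1 - f z) = of_real \<beta> * (z - 1 - v)"
    using assms by (simp add: f_def h_alt dh_def field_simps)
  have 2: "(z - f z) * dh z = h z" using assms by (simp add: f_def)
  have 3: "(f z - v) * dh z = exp z * (z - 1 - v)" using assms f_minus_v by simp
  have "(deriv f z * (z - 1 - v)) * (dh z)\<^sup>2 = h z * (exp z * (z - 1 - v))"
    using assms by (simp add: deriv_f)
  also have "\<dots> = ((z - f z) * (f z - v)) * (dh z)\<^sup>2"
    unfolding 2[symmetric] 3[symmetric] by (simp add: power2_eq_square)
  finally show ?thesis using assms by simp
qed

lemma open_dh_nonzero: "open {z. dh z \<noteq> 0}"
  unfolding dh_def by (intro open_Collect_neq continuous_intros)

lemma holomorphic_f: "f holomorphic_on {z. dh z \<noteq> 0}"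
  using open_dh_nonzero by (auto simp: holomorphic_on_open intro: has_derivative_f)

section \<open>Attraction to the zeros of \<open>h\<close> at a uniform rate and radius\<close>

lemma finite_zeros: "finite {p \<in> cball a R. h p = 0}"
proof (rule holomorphic_compact_finite_zeros)
  show "h holomorphic_on UNIV" unfolding h_def by (intro holomorphic_intros)
  have "h (2 * pi * \<i>) \<noteq> h 0" using beta_nonzero by (simp add: h_def)
  then show "\<not> h constant_on UNIV" by (metis UNIV_I constant_on_def)
qed auto

text \<open>A simple zero is superattracting: f (p + t) - p equals exp p * (t exp t - exp t + 1) /
  dh (p + t), which is of second order in t. Assumption \<open>s\<close> keeps |dh| above half its
  value at \<open>p\<close>. The factor 3/8 that results is relaxed to the 3/4 available at double
  zeros.\<close>

lemma f_contracts_near_zero: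
  assumes p: "h p = 0" and t: "norm t \<le> 1 / 2" and d: "dh p \<noteq> 0"
    and s: "8 * norm (exp p) * norm t \<le> norm (dh p)"
  shows "dh (p + t) \<noteq> 0 \<and> norm (f (p + t) - p) \<le> 3 / 4 * norm t"
proof -
  define \<phi> where "\<phi> = t * exp t - exp t + 1"
  have "norm \<phi> \<le> norm (\<phi> - t\<^sup>2 / 2) + norm (t\<^sup>2 / 2)"
    using norm_triangle_sub by (metis add.commute)
  also have "\<dots> \<le> 2 * norm t ^ 3 + norm t ^ 2 / 2"
    using norm_exp_second_difference_le[OF t] by (simp add: \<phi>_def norm_divide norm_power)
  also have "\<dots> \<le> (3/2) * norm t ^ 2"
  proof -
    have "norm t ^ 3 \<le> norm t ^ 2 * (1/2)"
      unfolding power3_eq_cube power2_eq_square using t by (intro mult_left_mono) auto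
    then show ?thesis by simp
  qed
  finally have \<phi>: "norm \<phi> \<le> 3 / 2 * norm t ^ 2" .
  have dh: "dh (p + t) = dh p + exp p * (exp t - 1)"
    by (simp add: dh_def exp_add algebra_simps)
  have "norm (exp p * (exp t - 1)) \<le> norm (exp p) * (2 * norm t)"
    unfolding norm_mult by (intro mult_left_mono norm_exp_minus_one_le t) auto
  then have "norm (exp p * (exp t - 1)) \<le> norm (dh p) / 4" using s by simp
  then have dh2: "norm (dh (p + t)) \<ge> norm (dh p) / 2"
    unfolding dh using norm_diff_ineq[of "dh p" "exp p * (exp t - 1)"]
      norm_ge_zero[of "dh p"] by linarith
  then have nz: "dh (p + t) \<noteq> 0" using d by auto
  have "h (p + t) = h p + (exp p * (exp t - 1) + of_real \<beta> * t)"
    by (simp add: h_def exp_add algebra_simps)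
  then have "(f (p + t) - p) * dh (p + t) = exp p * \<phi>"
  proof -
    have "(f (p + t) - p) * dh (p + t) = t * dh (p + t) - h (p + t)"
      using nz by (simp add: f_def field_simps)
    then show ?thesis using \<open>h (p + t) = _\<close> p by (simp add: dh_def exp_add \<phi>_def algebra_simps)
  qed
  then have "norm (f (p + t) - p) * norm (dh (p + t)) = norm (exp p) * norm \<phi>"
    by (metis norm_mult)
  also have "\<dots> \<le> norm (exp p) * (3 / 2 * norm t ^ 2)" using \<phi> by (intro mult_left_mono) auto
  also have "\<dots> = (8 * norm (exp p) * norm t) * (3 / 16 * norm t)" by (simp add: power2_eq_square)
  also have "\<dots> \<le> norm (dh p) * (3/16 * norm t)" using s by (intro mult_right_mono) auto
  also have "\<dots> \<le> norm (dh (p + t)) * (3/8 * norm t)"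
  proof -
    have "norm (dh p) * norm t \<le> 2 * norm (dh (p + t)) * norm t"
      using dh2 by (intro mult_right_mono) auto
    then show ?thesis by (simp add: algebra_simps)
  qed
  finally have "norm (f (p + t) - p) \<le> 3 / 8 * norm t" using nz by (simp add: mult.commute)
  then show ?thesis using nz norm_ge_zero[of t] by linarith
qed

text \<open>The multiplier at a double zero is 1/2: the error is \<phi>/\<psi> with \<phi> ~ t^2/2
  and \<psi> ~ t. The bounds with 9/16 and 3/4 for these two give the factor 3/4.\<close>

lemma f_contracts_near_double_zero:
  assumes p: "h p = 0" "dh p = 0" and t: "norm t \<le> 1 / 32"
  shows "norm (f (p + t) - p) \<le> 3 / 4 * norm t"
proof (cases "t = 0")
  case True
  then show ?thesis using p by (simp add: f_fixed)
next
  case False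
  define \<phi> where "\<phi> = t * exp t - exp t + 1"
  define \<psi> where "\<psi> = exp t - 1"
  have ep: "exp p = - of_real \<beta>" using p by (simp add: dh_def add_eq_0_iff)
  have "norm \<phi> \<le> norm (\<phi> - t\<^sup>2 / 2) + norm (t\<^sup>2 / 2)"
    using norm_triangle_sub by (metis add.commute)
  also have "\<dots> \<le> 2 * norm t ^ 3 + norm t ^ 2 / 2"
    using norm_exp_second_difference_le[of t] t by (simp add: \<phi>_def norm_divide norm_power)
  also have "\<dots> \<le> (9/16) * norm t ^ 2"
  proof -
    have "norm t ^ 3 \<le> norm t ^ 2 * (1/32)"
      unfolding power3_eq_cube power2_eq_square using t by (intro mult_left_mono) auto
    then show ?thesis by simp
  qed
  finally have \<phi>: "norm \<phi> \<le> 9 / 16 * norm t ^ 2" .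
  have "norm \<psi> \<ge> 3/4 * norm t"
  proof -
    have "norm (exp t - t - (exp 0 - 0)) \<le> 1/16 * norm (t - 0)"
    proof (rule field_differentiable_bound[of "cball 0 (1/32)" _ "\<lambda>s. exp s - 1"])
      fix z :: complex assume z: "z \<in> cball 0 (1/32)"
      show "norm (exp z - 1) \<le> 1/16" using norm_exp_minus_one_le[of z] z by auto
      show "((\<lambda>s. exp s - s) has_field_derivative exp z - 1) (at z within cball 0 (1/32))"
        by (auto intro!: derivative_eq_intros)
    qed (use t in auto)
    then have "norm (\<psi> - t) \<le> 1/16 * norm t" by (simp add: \<psi>_def algebra_simps)
    then show ?thesis
      using norm_triangle_ineq2[of t \<psi>] norm_ge_zero[of t] unfolding norm_minus_commute[of t] by linarith
  qed
  then have nz: "\<psi> \<noteq> 0" using False by auto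
  have dh: "dh (p + t) = exp p * \<psi>" by (simp add: dh_def exp_add ep \<psi>_def algebra_simps)
  have "h (p + t) = h p + (exp p * (exp t - 1) + of_real \<beta> * t)"
    by (simp add: h_def exp_add algebra_simps)
  then have hpt: "h (p + t) = exp p * (\<psi> - t)" using p by (simp add: \<psi>_def ep algebra_simps)
  have "f (p + t) - p = t - (\<psi> - t) / \<psi>" by (simp add: f_def dh hpt)
  then have "(f (p + t) - p) * \<psi> = \<phi>" using nz by (simp add: \<phi>_def \<psi>_def field_simps)
  then have "norm (f (p + t) - p) * norm \<psi> = norm \<phi>" by (metis norm_mult)
  moreover have "norm (f (p + t) - p) * (3/4 * norm t) \<le> norm (f (p + t) - p) * norm \<psi>"
    using \<open>norm \<psi> \<ge> 3/4 * norm t\<close> by (intro mult_left_mono) auto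
  ultimately have "norm (f (p + t) - p) * (3/4 * norm t) \<le> 9/16 * norm t ^ 2"
    using \<phi> by linarith
  then have "norm (f (p + t) - p) * norm t \<le> 3/4 * norm t ^ 2" by linarith
  then have "norm (f (p + t) - p) * norm t \<le> 3/4 * norm t * norm t" by (simp add: power2_eq_square)
  then show ?thesis using False by (metis mult_right_le_imp_le zero_less_norm_iff)
qed

text \<open>Only finitely many zeros lie within distance 4 of \<open>v\<close>. At the others |exp
  p| is at least 4 |\<beta>|, so |dh p| is at least 3/4 |exp p| and the radius 1/16 works for all of
  them.\<close>

lemma f_uniformly_contracts_near_zeros:
  "\<exists>\<delta>>0. \<forall>p z. h p = 0 \<longrightarrow> z \<in> ball p \<delta> \<longrightarrow> norm (f z - p) \<le> 3 / 4 * norm (z - p)"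
proof -
  define Z where "Z = {p \<in> cball v 4. h p = 0}"
  have finZ: "finite Z" unfolding Z_def by (rule finite_zeros)
  have ex: "\<exists>d>0. \<forall>z\<in>ball p d. norm (f z - p) \<le> 3/4 * norm (z - p)" if p: "h p = 0" for p
  proof (cases "dh p = 0")
    case True
    have "norm (f z - p) \<le> 3/4 * norm (z - p)" if "z \<in> ball p (1/32)" for z
      using f_contracts_near_double_zero[OF p True, of "z - p"] that
      by (auto simp: dist_norm norm_minus_commute)
    then show ?thesis by (intro exI[of _ "1/32"]) auto
  next
    case False
    let ?d = "min (1/2) (norm (dh p) / (8 * norm (exp p)))"
    have "norm (f z - p) \<le> 3/4 * norm (z - p)" if "z \<in> ball p ?d" for z
      using f_contracts_near_zero[OF p _ False, of "z - p"] that
      by (auto simp: dist_norm norm_minus_commute field_simps)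
    then show ?thesis using False by (intro exI[of _ ?d]) auto
  qed
  then obtain d where d: "\<And>p. h p = 0 \<Longrightarrow> d p > 0"
    "\<And>p z. h p = 0 \<Longrightarrow> z \<in> ball p (d p) \<Longrightarrow> norm (f z - p) \<le> 3/4 * norm (z - p)"
    by metis
  define \<delta> where "\<delta> = Min (insert (1/16) (d ` Z))"
  have "\<delta> > 0" using finZ d by (auto simp: \<delta>_def Z_def)
  moreover have "norm (f z - p) \<le> 3/4 * norm (z - p)" if p: "h p = 0" and z: "z \<in> ball p \<delta>" for p z
  proof (cases "p \<in> Z")
    case True
    then have "\<delta> \<le> d p" using finZ by (simp add: \<delta>_def)
    then show ?thesis using d(2)[OF p, of z] z by auto
  next
    case False
    have "4 \<le> norm (p - v)" using False p by (auto simp: Z_def dist_norm norm_minus_commute)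
    then have e: "4 * \<bar>\<beta>\<bar> \<le> norm (exp p)"
      using norm_exp_at_zero[OF p] mult_left_mono[of 4 "norm (p - v)" "\<bar>\<beta>\<bar>"] by simp
    have "norm (dh p) \<ge> norm (exp p) - \<bar>\<beta>\<bar>"
      unfolding dh_def using norm_diff_ineq[of "exp p" "of_real \<beta>"] by simp
    then have dp: "norm (dh p) \<ge> 3/4 * norm (exp p)" using e by simp
    then have "dh p \<noteq> 0" by auto
    have "\<delta> \<le> 1/16" using finZ unfolding \<delta>_def by (intro Min_le) auto
    then have zp: "norm (z - p) \<le> 1/16" using z by (simp add: dist_norm norm_minus_commute)
    then have "8 * norm (exp p) * norm (z - p) \<le> 8 * norm (exp p) * (1/16)"
      by (intro mult_left_mono) auto
    then have "8 * norm (exp p) * norm (z - p) \<le> norm (dh p)"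
      using dp norm_ge_zero[of "exp p"] by linarith
    then show ?thesis
      using f_contracts_near_zero[OF p _ \<open>dh p \<noteq> 0\<close>, of "z - p"] zp by simp
  qed
  ultimately show ?thesis by blast
qed

lemma contraction_imp_convergent:
  assumes con: "\<And>z. z \<in> ball p \<delta> \<Longrightarrow> norm (f z - p) \<le> 3 / 4 * norm (z - p)" and z: "z \<in> ball p \<delta>"
  shows "norm ((f ^^ n) z - p) \<le> (3/4) ^ n * norm (z - p)" and "(f ^^ n) z \<in> ball p \<delta>"
proof -
  have "norm ((f ^^ n) z - p) \<le> (3/4) ^ n * norm (z - p) \<and> (f ^^ n) z \<in> ball p \<delta>"
  proof (induction n)
    case (Suc n)
    then have 1: "norm (f ((f ^^ n) z) - p) \<le> 3/4 * norm ((f ^^ n) z - p)" using con by blast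
    then have "norm (f ((f ^^ n) z) - p) \<le> norm ((f ^^ n) z - p)"
      using norm_ge_zero[of "(f ^^ n) z - p"] by linarith
    then show ?case using 1 Suc by (auto simp: dist_norm norm_minus_commute)
  qed (use z in auto)
  then show "norm ((f ^^ n) z - p) \<le> (3/4) ^ n * norm (z - p)" and "(f ^^ n) z \<in> ball p \<delta>" by auto
qed

lemma ball_subset_basin:
  assumes p: "h p = 0" and con: "\<And>z. z \<in> ball p \<delta> \<Longrightarrow> norm (f z - p) \<le> 3 / 4 * norm (z - p)"
  shows "ball p \<delta> \<subseteq> basin"
proof
  fix z assume z: "z \<in> ball p \<delta>"
  have "(\<lambda>n. (f ^^ n) z - p) \<longlonglongrightarrow> 0"
  proof (rule Lim_null_comparison)
    show "\<forall>\<^sub>F n in sequentially. norm ((f ^^ n) z - p) \<le> (3/4) ^ n * norm (z - p)"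
      using contraction_imp_convergent(1)[OF con z] by simp
    show "(\<lambda>n. (3/4) ^ n * norm (z - p)) \<longlonglongrightarrow> 0"
      by (intro tendsto_mult_left_zero LIMSEQ_power_zero) auto
  qed
  then have "(\<lambda>n. (f ^^ n) z) \<longlonglongrightarrow> p" by (simp add: LIM_zero_iff)
  then show "z \<in> basin" using p by (auto simp: basin_def)
qed

text \<open>At a double zero of \<open>h\<close> the quotient has a vanishing denominator;
  continuity comes from the contraction estimate instead.\<close>

lemma isCont_f:
  assumes "dh z \<noteq> 0 \<or> h z = 0"
  shows "isCont f z"
proof (cases "dh z = 0")
  case False
  then show ?thesis by (rule DERIV_isCont[OF has_derivative_f])
next
  case True
  then have hz: "h z = 0" using assms by simp
  obtain \<delta> where \<delta>: "\<delta> > 0"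
    "\<forall>p z. h p = 0 \<longrightarrow> z \<in> ball p \<delta> \<longrightarrow> norm (f z - p) \<le> 3 / 4 * norm (z - p)"
    using f_uniformly_contracts_near_zeros by blast
  have "\<forall>\<^sub>F x in nhds z. x \<in> ball z \<delta>" using \<delta>(1) by (intro eventually_nhds_in_open) auto
  then have "\<forall>\<^sub>F x in nhds z. norm (f x - z) \<le> 3/4 * norm (x - z)"
    by (rule eventually_mono) (rule \<delta>(2)[rule_format, OF hz])
  then have "\<forall>\<^sub>F x in at z. norm (f x - z) \<le> 3/4 * norm (x - z)"
    by (simp add: eventually_nhds_conv_at)
  moreover have "((\<lambda>x. 3/4 * norm (x - z)) \<longlongrightarrow> 0) (at z)"
    by (intro tendsto_mult_right_zero tendsto_norm_zero LIM_zero tendsto_ident_at)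
  ultimately have "((\<lambda>x. f x - z) \<longlongrightarrow> 0) (at z)"
    by (rule Lim_null_comparison)
  then show ?thesis by (simp add: isCont_def LIM_zero_iff f_fixed[OF hz])
qed

lemma isCont_funpow:
  assumes "z \<in> basin"
  shows "isCont (f ^^ n) z"
proof (induction n)
  case (Suc n)
  have "(f ^^ n) z \<in> basin" using assms by (simp add: funpow_in_basin_iff)
  then have "isCont f ((f ^^ n) z)" using isCont_f dh_zero_imp_not_in_basin by blast
  then show ?case using continuous_at_compose[OF Suc, of f] by (simp add: o_def)
qed (simp add: id_def)

lemma open_basin: "open basin"
proof -
  obtain \<delta> where \<delta>: "\<delta> > 0"
    "\<forall>p z. h p = 0 \<longrightarrow> z \<in> ball p \<delta> \<longrightarrow> norm (f z - p) \<le> 3 / 4 * norm (z - p)"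
    using f_uniformly_contracts_near_zeros by blast
  have "\<exists>T. open T \<and> z \<in> T \<and> T \<subseteq> basin" if z: "z \<in> basin" for z
  proof -
    obtain p where p: "h p = 0" "(\<lambda>n. (f ^^ n) z) \<longlonglongrightarrow> p" using z by (auto simp: basin_def)
    have "\<forall>\<^sub>F n in sequentially. (f ^^ n) z \<in> ball p \<delta>"
      using p(2) \<delta>(1) by (intro topological_tendstoD) auto
    then obtain n where n: "(f ^^ n) z \<in> ball p \<delta>" by (auto simp: eventually_sequentially)
    have "\<forall>\<^sub>F x in nhds z. (f ^^ n) x \<in> ball p \<delta>"
      using isCont_funpow[OF z, of n] n unfolding isCont_def tendsto_at_iff_tendsto_nhds
      by (intro topological_tendstoD[OF _ open_ball])
    then have "\<forall>\<^sub>F x in nhds z. x \<in> basin"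
      by (rule eventually_mono) (use ball_subset_basin[OF p(1) \<delta>(2)[rule_format, OF p(1)]] funpow_in_basin_iff in blast)
    then show ?thesis by (auto simp: eventually_nhds)
  qed
  then show ?thesis by (subst open_subopen) blast
qed

lemma v_in_basin:
  assumes r: "h (of_real r) = 0"
  shows "v \<in> basin"
proof -
  define H where "H = (\<lambda>x::real. exp x + \<beta> * x + \<alpha>)"
  define dH where "dH = (\<lambda>x::real. exp x + \<beta>)"
  define N where "N = (\<lambda>x. x - H x / dH x)"
  define u where "u = - \<alpha> / \<beta>"
  have hH: "h (of_real x) = of_real (H x)" for x by (simp add: h_def H_def exp_of_real)
  have fN: "f (of_real x) = of_real (N x)" for x
    by (simp add: f_def N_def hH dh_def dH_def exp_of_real)
  have fNn: "(f ^^ n) (of_real x) = of_real ((N ^^ n) x)" for n x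
    by (induction n) (auto simp: fN)
  have Hr: "H r = 0" using r hH by simp
  have Hu: "H u > 0" using beta_nonzero by (simp add: H_def u_def)
  \<comment> \<open>Convexity: the graph lies above its tangents, so a Newton step does not
    overshoot the zero.\<close>
  have tangent: "H y \<ge> H x + dH x * (y - x)" for x y
  proof -
    have "exp x * exp (y - x) \<ge> exp x * (1 + (y - x))" by (intro mult_left_mono) auto
    then have "exp y \<ge> exp x * (1 + (y - x))" by (simp add: exp_add[symmetric])
    then show ?thesis by (simp add: H_def dH_def algebra_simps)
  qed
  \<comment> \<open>Newton's method moves monotonically from \<open>u\<close> towards the nearest real zero.\<close>
  have "\<exists>L. H L = 0 \<and> (\<lambda>n. (N ^^ n) u) \<longlonglongrightarrow> L"
  proof -
    \<comment> \<open>The limit is taken in H x = (x - N x) * dH x. Where \<open>dH\<close>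
      vanishes, \<open>N\<close> is the identity through division by zero, so the equation needs H x
      = 0 there; this is \<open>nz\<close>.\<close>
    have lim: "H L = 0" if L: "(\<lambda>n. (N ^^ n) u) \<longlonglongrightarrow> L"
      and nz: "\<And>n. dH ((N ^^ n) u) = 0 \<Longrightarrow> H ((N ^^ n) u) = 0" for L
    proof -
      have eq: "H ((N ^^ n) u) = ((N ^^ n) u - (N ^^ Suc n) u) * dH ((N ^^ n) u)" for n
        using nz[of n] by (cases "dH ((N ^^ n) u) = 0") (auto simp: N_def)
      have "(\<lambda>n. ((N ^^ n) u - (N ^^ Suc n) u) * dH ((N ^^ n) u)) \<longlonglongrightarrow> (L - L) * dH L"
        unfolding dH_def by (intro tendsto_intros L LIMSEQ_Suc[OF L])
      moreover have "(\<lambda>n. H ((N ^^ n) u)) \<longlonglongrightarrow> H L"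
        unfolding H_def by (intro tendsto_intros L)
      then have "(\<lambda>n. ((N ^^ n) u - (N ^^ Suc n) u) * dH ((N ^^ n) u)) \<longlonglongrightarrow> H L"
        by (simp only: eq)
      ultimately have "(L - L) * dH L = H L" by (rule LIMSEQ_unique)
      then show ?thesis by simp
    qed
    show ?thesis
    proof (cases "\<beta> > 0")
      case True
      then have pos: "dH x > 0" for x by (simp add: dH_def add_pos_pos)
      have mono: "H x \<le> H y" if "x \<le> y" for x y
        unfolding H_def using True that by (intro add_mono mult_left_mono) auto
      have "r \<le> u" using mono[of u r] Hr Hu by linarith
      have step: "r \<le> N x \<and> N x \<le> x" if "r \<le> x" for x
      proof -
        have "0 \<le> H x" using that mono[of r x] Hr by simp
        moreover have "H x \<le> dH x * (x - r)" using tangent[of x r] Hr by (simp add: algebra_simps)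
        ultimately show ?thesis using pos[of x] by (simp add: N_def field_simps)
      qed
      have inv: "r \<le> (N ^^ n) u" for n
      proof (induction n)
        case (Suc n)
        then show ?case using step[of "(N ^^ n) u"] by simp
      qed (use \<open>r \<le> u\<close> in simp)
      have "decseq (\<lambda>n. (N ^^ n) u)" by (rule decseq_SucI) (simp add: inv step)
      then obtain L where L: "(\<lambda>n. (N ^^ n) u) \<longlonglongrightarrow> L"
      proof (rule decseq_convergent)
        show "\<forall>n. r \<le> (N ^^ n) u" using inv by simp
      qed (use that in simp)
      then have "H L = 0" using lim[OF L] pos by (simp add: less_imp_neq[symmetric])
      then show ?thesis using L by blast
    next
      case False
      then have neg: "\<beta> < 0" using beta_nonzero by simp
      define l where "l = ln (- \<beta>)"
      have el: "exp l = - \<beta>" using neg by (simp add: l_def)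
      have dl: "dH x < 0" if "x < l" for x
        using that el exp_less_cancel_iff[of x l] by (simp add: dH_def)
      \<comment> \<open>The minimum of \<open>H\<close> is attained at \<open>l\<close>, so it is at
        most H r = 0. As H l = \<beta> (l - 1 - u), the starting point \<open>u\<close> lies to the
        left of \<open>l\<close>, on the decreasing branch, and \<open>s\<close> is the zero on this
        branch.\<close>
      have "H l \<le> 0" using tangent[of l r] Hr by (simp add: dH_def el)
      then have "\<beta> * (l - 1 - u) \<le> 0" using neg by (simp add: H_def el u_def algebra_simps)
      then have ul: "u < l" using neg by (simp add: mult_le_0_iff)
      obtain s where s: "u \<le> s" "s \<le> l" "H s = 0"
      proof -
        have "continuous_on {u..l} H" unfolding H_def by (intro continuous_intros)
        then show ?thesis using IVT2'[of H l 0 u] \<open>H l \<le> 0\<close> Hu ul that by auto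
      qed
      have step: "x \<le> N x \<and> N x \<le> s" if "x \<le> s" for x
      proof (cases "x < l")
        case True
        have "exp x \<le> exp l" "exp s \<le> exp l" using True s by auto
        have "0 \<le> H x"
        proof -
          have "dH s * (x - s) \<ge> 0"
            using \<open>exp s \<le> exp l\<close> that by (intro mult_nonpos_nonpos) (auto simp: dH_def el)
          then show ?thesis using tangent[of s x] s by simp
        qed
        moreover have "- H x \<ge> dH x * (s - x)" using tangent[of x s] s by simp
        ultimately show ?thesis using dl[OF True] by (simp add: N_def field_simps)
      next
        case False
        then have "x = s" using that s by simp
        then show ?thesis using s by (simp add: N_def)
      qed
      have inv: "(N ^^ n) u \<le> s" for n
      proof (induction n)
        case (Suc n)
        then show ?case using step[of "(N ^^ n) u"] by simp
      qed (use s in simp)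
      have "incseq (\<lambda>n. (N ^^ n) u)" by (rule incseq_SucI) (simp add: inv step)
      then obtain L where L: "(\<lambda>n. (N ^^ n) u) \<longlonglongrightarrow> L"
      proof (rule incseq_convergent)
        show "\<forall>n. (N ^^ n) u \<le> s" using inv by simp
      qed (use that in simp)
      have "H x = 0" if "x \<le> s" "dH x = 0" for x
        using dl[of x] that s by (cases "x = s") auto
      then have "H L = 0" using lim[OF L] inv by simp
      then show ?thesis using L by blast
    qed
  qed
  then obtain L where L: "H L = 0" "(\<lambda>n. (N ^^ n) u) \<longlonglongrightarrow> L" by blast
  have "(\<lambda>n. (f ^^ n) v) \<longlonglongrightarrow> of_real L"
    using tendsto_of_real[OF L(2), where 'a = complex] unfolding v_def u_def[symmetric] fNn by simp
  moreover have "h (of_real L) = 0" by (simp add: hH L)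
  ultimately show ?thesis unfolding basin_def by blast
qed

lemma f_open_at:
  assumes "open S" "z \<in> S" and nz: "\<And>x. x \<in> S \<Longrightarrow> dh x \<noteq> 0" and "h z \<noteq> 0"
  shows "f z \<in> interior (f ` S)"
proof -
  obtain e where e: "e > 0" "ball z e \<subseteq> S" using assms(1,2) by (auto simp: open_contains_ball)
  have hol: "f holomorphic_on ball z e"
    by (rule holomorphic_on_subset[OF holomorphic_f]) (use e nz in auto)
  have "\<not> f constant_on ball z e"
  proof
    assume "f constant_on ball z e"
    then obtain c where c: "\<And>x. x \<in> ball z e \<Longrightarrow> f x = c" by (auto simp: constant_on_def)
    have "((\<lambda>x. c) has_field_derivative 0) (at z)" by simp
    then have "(f has_field_derivative 0) (at z)"
      by (rule has_field_derivative_transform_within_open[of _ _ _ "ball z e"]) (use e c in auto)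
    then show False
      using DERIV_imp_deriv deriv_f_nonzero assms(2,4) nz by blast
  qed
  then have "open (f ` ball z e)"
    by (rule open_mapping_thm[OF hol open_ball connected_ball open_ball order_refl])
  then have "f ` ball z e \<subseteq> interior (f ` S)" using e(2) by (intro interior_maximal) auto
  then show ?thesis using e(1) by auto
qed

section \<open>The position of zeros, preimages of zeros, and poles\<close>

text \<open>The logarithmic derivative of -\<beta> (z - v) is 1/(z - v), at most 1/5 in modulus on
  the disc of radius 15. The factor 12 in the hypotheses is below e^3 and thus matches the tolerance
  3 for the logarithms.\<close>

lemma zero_near:
  assumes far: "20 \<le> norm (w - v)"
    and lo: "exp (Re w) \<le> 12 * (\<bar>\<beta>\<bar> * norm (w - v))" and hi: "\<bar>\<beta>\<bar> * norm (w - v) \<le> 12 * exp (Re w)"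
  obtains p where "p \<in> cball w 14" "h p = 0"
proof -
  let ?g = "\<lambda>z. - of_real \<beta> * (z - v)"
  have far': "norm (z - v) \<ge> 5" if "z \<in> ball w 15" for z
    using norm_triangle_ineq2[of "w - v" "w - z"] far that by (simp add: dist_norm)
  have dg: "deriv ?g z = - of_real \<beta>" for z
    by (rule DERIV_imp_deriv) (auto intro!: derivative_eq_intros)
  obtain p where p: "p \<in> cball w 14" "exp p = ?g p"
  proof (rule exp_eq_solution_near[of ?g w])
    show "?g holomorphic_on ball w 15" by (intro holomorphic_intros)
    show "?g z \<noteq> 0" if "z \<in> ball w 15" for z
      using far'[OF that] beta_nonzero by auto
    show "norm (deriv ?g z) \<le> norm (?g z) / 2" if "z \<in> ball w 15" for z
      using far'[OF that] mult_left_mono[of 2 "norm (z - v)" "\<bar>\<beta>\<bar>"] unfolding dg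
      by (simp add: norm_mult)
    show "\<bar>ln (norm (?g w)) - Re w\<bar> \<le> 3"
    proof (rule abs_ln_minus_le_3)
      have "w \<noteq> v" using far by auto
      then show "norm (?g w) > 0" using beta_nonzero by simp
    qed (use lo hi in \<open>auto simp: norm_mult\<close>)
  qed (rule that)
  then have "h p = 0" by (simp add: h_alt)
  then show ?thesis using that p by blast
qed

text \<open>The same argument for \<beta> (q - v) / (z - 1 - q), whose logarithmic derivative is
  -1/(z - 1 - q).\<close>

lemma preimage_near:
  assumes q: "q \<noteq> v" and far: "20 \<le> norm (w - 1 - q)"
    and lo: "exp (Re w) * norm (w - 1 - q) \<le> 12 * (\<bar>\<beta>\<bar> * norm (q - v))"
    and hi: "\<bar>\<beta>\<bar> * norm (q - v) \<le> 12 * (exp (Re w) * norm (w - 1 - q))"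
  obtains z where "z \<in> cball w 14" "(z - 1 - q) * exp z = of_real \<beta> * (q - v)"
proof -
  let ?c = "of_real \<beta> * (q - v)"
  let ?g = "\<lambda>z. ?c / (z - 1 - q)"
  have c: "?c \<noteq> 0" using q beta_nonzero by simp
  have far': "norm (z - 1 - q) \<ge> 5" if "z \<in> ball w 15" for z
    using norm_triangle_ineq2[of "w - 1 - q" "w - z"] far that by (simp add: dist_norm algebra_simps)
  have dg: "deriv ?g z = - ?g z / (z - 1 - q)" if "z - 1 - q \<noteq> 0" for z
    by (rule DERIV_imp_deriv) (use that in \<open>auto intro!: derivative_eq_intros simp: power2_eq_square\<close>)
  obtain z where z: "z \<in> cball w 14" "exp z = ?g z"
  proof (rule exp_eq_solution_near[of ?g w])
    show "?g holomorphic_on ball w 15" by (intro holomorphic_intros) (use far' in force)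
    show "?g z \<noteq> 0" if "z \<in> ball w 15" for z
      using far'[OF that] c by auto
    show "norm (deriv ?g z) \<le> norm (?g z) / 2" if "z \<in> ball w 15" for z
    proof -
      have "z - 1 - q \<noteq> 0" using far'[OF that] by auto
      then have "norm (deriv ?g z) = norm (- ?g z / (z - 1 - q))" by (simp only: dg not_False_eq_True)
      also have "\<dots> = norm (?g z) / norm (z - 1 - q)" by (simp only: norm_divide norm_minus_cancel)
      also have "\<dots> \<le> norm (?g z) / 2" using far'[OF that] by (intro divide_left_mono) auto
      finally show ?thesis .
    qed
    have pos: "norm (w - 1 - q) > 0" using far by linarith
    show "\<bar>ln (norm (?g w)) - Re w\<bar> \<le> 3"
    proof (rule abs_ln_minus_le_3)
      show "norm (?g w) > 0" using c pos by (simp add: norm_divide)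
      show "exp (Re w) \<le> 12 * norm (?g w)" "norm (?g w) \<le> 12 * exp (Re w)"
        using lo hi pos by (simp_all add: norm_divide norm_mult pos_le_divide_eq pos_divide_le_eq mult.assoc)
    qed
  qed (rule that)
  moreover have "z - 1 - q \<noteq> 0" using far'[of z] z by auto
  ultimately have "(z - 1 - q) * exp z = ?c" by simp
  then show ?thesis using that z by blast
qed

lemma zeros_of_every_large_size:
  obtains M\<^sub>0 where "M\<^sub>0 \<ge> 40" "\<forall>M\<ge>M\<^sub>0. \<exists>p. h p = 0 \<and> M / 2 \<le> norm (p - v) \<and> norm (p - v) \<le> 3 * M"
proof -
  define M\<^sub>0 where "M\<^sub>0 = max 40 (2 * (\<bar>ln \<bar>\<beta>\<bar>\<bar> + norm v))"
  have "\<exists>p. h p = 0 \<and> M / 2 \<le> norm (p - v) \<and> norm (p - v) \<le> 3 * M" if M: "M \<ge> M\<^sub>0" for M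
  proof -
    have M1: "M \<ge> 40" "\<bar>ln \<bar>\<beta>\<bar>\<bar> + norm v \<le> M / 2" using M by (auto simp: M\<^sub>0_def)
    \<comment> \<open>The real part gives |exp w| = |\<beta>| M, and the imaginary part makes |w -
      v| lie between M and 2 M, so the two sides of the zero equation are comparable at
      \<open>w\<close>.\<close>
    define w where "w = of_real (ln (\<bar>\<beta>\<bar> * M)) + \<i> * of_real M"
    have expw: "exp (Re w) = \<bar>\<beta>\<bar> * M" using M1 beta_nonzero by (simp add: w_def)
    have "norm (of_real (ln (\<bar>\<beta>\<bar> * M)) - v :: complex) \<le> \<bar>ln (\<bar>\<beta>\<bar> * M)\<bar> + norm v"
      by (metis norm_of_real norm_triangle_ineq4)
    also have "\<dots> \<le> \<bar>ln \<bar>\<beta>\<bar>\<bar> + \<bar>ln M\<bar> + norm v"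
    proof -
      have "ln (\<bar>\<beta>\<bar> * M) = ln \<bar>\<beta>\<bar> + ln M" using M1 beta_nonzero by (intro ln_mult_pos) auto
      then show ?thesis using abs_triangle_ineq[of "ln \<bar>\<beta>\<bar>" "ln M"] by simp
    qed
    also have "\<dots> \<le> M" using ln_le_half[of M] M1 by simp
    finally have 1: "norm (of_real (ln (\<bar>\<beta>\<bar> * M)) - v :: complex) \<le> M" .
    have "norm (w - v) \<le> norm (of_real (ln (\<bar>\<beta>\<bar> * M)) - v :: complex) + norm (\<i> * of_real M)"
      unfolding w_def using norm_triangle_ineq[of "of_real (ln (\<bar>\<beta>\<bar> * M)) - v" "\<i> * of_real M"]
      by (simp add: algebra_simps)
    then have up: "norm (w - v) \<le> 2 * M" using 1 M1 by (simp add: norm_mult)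
    have "\<bar>Im (w - v)\<bar> \<le> norm (w - v)" by (rule abs_Im_le_cmod)
    then have low: "M \<le> norm (w - v)" using M1 by (simp add: w_def v_def)
    obtain p where p: "p \<in> cball w 14" "h p = 0"
    proof (rule zero_near[of w])
      show "20 \<le> norm (w - v)" using low M1 by linarith
      show "exp (Re w) \<le> 12 * (\<bar>\<beta>\<bar> * norm (w - v))"
        unfolding expw using mult_left_mono[OF low, of "\<bar>\<beta>\<bar>"] mult_nonneg_nonneg[of "\<bar>\<beta>\<bar>" "norm (w - v)"]
          abs_ge_zero[of \<beta>] norm_ge_zero[of "w - v"] by linarith
      show "\<bar>\<beta>\<bar> * norm (w - v) \<le> 12 * exp (Re w)"
      proof -
        have "\<bar>\<beta>\<bar> * norm (w - v) \<le> \<bar>\<beta>\<bar> * (12 * M)" using up M1 by (intro mult_left_mono) auto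
        then show ?thesis unfolding expw by (simp only: mult.left_commute)
      qed
    qed (rule that)
    have d: "norm (p - w) \<le> 14" using p by (simp add: dist_norm norm_minus_commute)
    have "norm (p - v) \<le> norm (w - v) + norm (p - w)"
      using norm_triangle_ineq[of "w - v" "p - w"] by simp
    moreover have "norm (w - v) \<le> norm (p - v) + norm (p - w)"
      using norm_triangle_ineq4[of "p - v" "p - w"] by simp
    ultimately show ?thesis using d p(2) low up M1 by (intro exI[of _ p]) auto
  qed
  moreover have "M\<^sub>0 \<ge> 40" by (simp add: M\<^sub>0_def)
  ultimately show ?thesis using that by metis
qed

lemma solution_dh_zero:
  assumes "(z - 1 - q) * exp z = of_real \<beta> * (q - v)" "dh z = 0"
  shows "z = 1 + v"
proof -
  have "exp z = - of_real \<beta>" using assms by (simp add: dh_def add_eq_0_iff)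
  then have "of_real \<beta> * (z - 1 - v) = 0" using assms(1) by (simp add: algebra_simps)
  then show ?thesis using beta_nonzero by (simp add: diff_eq_eq)
qed

lemma f_surj:
  assumes "q \<noteq> v"
  obtains z where "dh z \<noteq> 0" "f z = q"
proof -
  define Q where "Q = \<bar>\<beta>\<bar> * norm (q - v)"
  have Q: "Q > 0" using assms beta_nonzero by (simp add: Q_def)
  define M where "M = max 40 (2 * (\<bar>ln Q\<bar> + 1 + norm q))"
  have M: "M \<ge> 40" "\<bar>ln Q\<bar> + 1 + norm q \<le> M / 2" by (auto simp: M_def)
  \<comment> \<open>With |exp w| = Q/M and |w - 1 - q| between M/2 and 2 M, the left side of the
    preimage equation has modulus comparable to \<open>Q\<close>, the modulus of its right
    side.\<close>
  define w where "w = of_real (ln (Q / M)) + \<i> * of_real M"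
  have expw: "exp (Re w) = Q / M" using M Q by (simp add: w_def)
  have "norm (w - 1 - q) \<ge> norm w - norm (1 + q)"
    using norm_triangle_ineq2[of w "1 + q"] by (simp add: algebra_simps)
  moreover have "norm (1 + q) \<le> 1 + norm q" using norm_triangle_ineq[of 1 q] by simp
  moreover have "norm w \<ge> M" using abs_Im_le_cmod[of w] M by (simp add: w_def)
  ultimately have low: "M / 2 \<le> norm (w - 1 - q)" using M by linarith
  have "norm w \<le> \<bar>ln (Q / M)\<bar> + M"
    using norm_triangle_ineq[of "of_real (ln (Q / M))" "\<i> * of_real M"] M by (simp add: w_def norm_mult)
  moreover have "\<bar>ln (Q / M)\<bar> \<le> \<bar>ln Q\<bar> + \<bar>ln M\<bar>"
  proof -
    have "ln (Q / M) = ln Q - ln M" using Q M by (intro ln_divide_pos) auto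
    then show ?thesis using abs_triangle_ineq4[of "ln Q" "ln M"] by simp
  qed
  moreover have "\<bar>ln M\<bar> \<le> M / 2" using ln_le_half[of M] M by simp
  moreover have "norm (w - 1 - q) \<le> norm w + norm (1 + q)"
    using norm_triangle_ineq4[of w "1 + q"] by (simp add: algebra_simps)
  ultimately have up: "norm (w - 1 - q) \<le> 2 * M"
    using \<open>norm (1 + q) \<le> 1 + norm q\<close> M by linarith
  obtain z where z: "z \<in> cball w 14" "(z - 1 - q) * exp z = of_real \<beta> * (q - v)"
  proof (rule preimage_near[OF assms, of w])
    show "20 \<le> norm (w - 1 - q)" using low M by linarith
    have "Q / M * norm (w - 1 - q) \<le> Q / M * (2 * M)"
      using up Q M by (intro mult_left_mono) auto
    then show "exp (Re w) * norm (w - 1 - q) \<le> 12 * (\<bar>\<beta>\<bar> * norm (q - v))"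
      unfolding expw Q_def[symmetric] using Q M by simp
    have "Q / M * (M / 2) \<le> Q / M * norm (w - 1 - q)"
      using low Q M by (intro mult_left_mono) auto
    then show "\<bar>\<beta>\<bar> * norm (q - v) \<le> 12 * (exp (Re w) * norm (w - 1 - q))"
      unfolding expw Q_def[symmetric] using Q M by simp
  qed (rule that)
  \<comment> \<open>A solution with dh z = 0 would be the real point 1 + v, but this one has
    imaginary part at least M - 14.\<close>
  have "\<bar>Im z - M\<bar> \<le> 14"
    using z(1) abs_Im_le_cmod[of "w - z"] by (simp add: dist_norm w_def abs_minus_commute)
  then have "z \<noteq> 1 + v" using M by (auto simp: v_def)
  then have "dh z \<noteq> 0" using solution_dh_zero[OF z(2)] by blast
  then show ?thesis using that z(2) f_eq_iff by blast
qed

section \<open>Discs along an orbit that avoid the basin and the poles\<close>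

lemma pole_near:
  assumes "\<bar>Re w - ln \<bar>\<beta>\<bar>\<bar> < R - 4"
  shows "\<exists>z\<in>ball w R. dh z = 0"
proof -
  define z\<^sub>0 where "z\<^sub>0 = Ln (- of_real \<beta>)"
  have e0: "exp z\<^sub>0 = - of_real \<beta>" using beta_nonzero by (simp add: z\<^sub>0_def)
  have Re0: "Re z\<^sub>0 = ln \<bar>\<beta>\<bar>" using beta_nonzero by (simp add: z\<^sub>0_def)
  \<comment> \<open>The zeros of \<open>dh\<close> lie on the line Re z = ln |\<beta>| with spacing
    2 pi; the one chosen has vertical distance at most pi < 4 from \<open>w\<close>.\<close>
  define k where "k = round ((Im w - Im z\<^sub>0) / (2 * pi))"
  define z where "z = z\<^sub>0 + 2 * of_int k * pi * \<i>"
  have "\<bar>of_int k - (Im w - Im z\<^sub>0) / (2 * pi)\<bar> \<le> 1 / 2"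
    unfolding k_def by (rule of_int_round_abs_le)
  then have "\<bar>2 * pi\<bar> * \<bar>of_int k - (Im w - Im z\<^sub>0) / (2 * pi)\<bar> \<le> 2 * pi * (1 / 2)"
    by (intro mult_mono) auto
  moreover have "Im z - Im w = 2 * pi * (of_int k - (Im w - Im z\<^sub>0) / (2 * pi))"
    by (simp add: z_def field_simps)
  ultimately have Im: "\<bar>Im z - Im w\<bar> \<le> pi"
    by (simp add: abs_mult)
  have "norm (z - w) \<le> \<bar>Re (z - w)\<bar> + \<bar>Im (z - w)\<bar>" by (rule cmod_le)
  also have "\<dots> < R"
    using assms Im pi_less_4 Re0 by (simp add: z_def abs_minus_commute)
  finally have "z \<in> ball w R" by (simp add: dist_norm norm_minus_commute)
  moreover have "exp z = exp z\<^sub>0" unfolding exp_eq by (auto simp: z_def intro!: exI[of _ k])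
  then have "dh z = 0" using e0 by (simp add: dh_def)
  ultimately show ?thesis by blast
qed

text \<open>If the disc misses the basin, then \<open>f (w - R / 2)\<close> is not near \<open>v\<close>, which forces \<open>w\<close> to
  be exponentially large. Then a zero of \<open>h\<close> of suitable size has a preimage near \<open>w\<close>.\<close>

lemma left_disc_meets_basin:
  assumes M0: "M\<^sub>0 \<ge> 40" "\<forall>M\<ge>M\<^sub>0. \<exists>p. h p = 0 \<and> M / 2 \<le> norm (p - v) \<and> norm (p - v) \<le> 3 * M"
    and \<delta>: "\<delta> > 0" "ball v \<delta> \<subseteq> basin"
    and R: "R \<ge> 160" "4 * (M\<^sub>0 + 1) \<le> \<delta> * R"
    and w: "Re w \<le> ln \<bar>\<beta>\<bar> - (R - 4)"
    and dhnz: "\<forall>z\<in>ball w R. dh z \<noteq> 0"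
  shows "ball w R \<inter> basin \<noteq> {}"
proof
  assume disj: "ball w R \<inter> basin = {}"
  let ?x = "Re w" and ?b = "\<bar>\<beta>\<bar>"
  have b: "?b > 0" using beta_nonzero by simp
  have "exp ?x \<le> exp (ln ?b - (R - 4))" using w by simp
  also have "\<dots> = exp (ln ?b) * exp (-(R - 4))" unfolding exp_add[symmetric] by simp
  finally have ex: "exp ?x \<le> ?b * exp (-(R - 4))" using b by (simp only: exp_ln)
  \<comment> \<open>Moving left by R/2 gains a factor exp (-R/2) in |exp z|. Since f z keeps the
    distance \<delta> from \<open>v\<close>, the size of \<open>w\<close> has to make up for this
    factor.\<close>
  define z where "z = w - of_real (R / 2)"
  have zR: "z \<in> ball w R" using R by (simp add: z_def dist_norm)
  then have "f z \<notin> basin" using disj f_in_basin_iff by blast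
  then have "f z \<notin> ball v \<delta>" using \<delta>(2) by blast
  then have fz: "norm (f z - v) \<ge> \<delta>" by (simp add: dist_norm norm_minus_commute)
  have nez: "norm (exp z) = exp ?x * exp (- (R / 2))" by (simp add: z_def exp_add[symmetric])
  have "exp (-(R - 4)) \<le> exp (0::real)" "exp (-(R/2)) \<le> 1/2"
  proof -
    have "1 + R / 2 \<le> exp (R / 2)" by simp
    then have "2 \<le> exp (R / 2)" using R by linarith
    then show "exp (-(R/2)) \<le> 1/2" by (simp add: exp_minus field_simps)
  qed (use R in auto)
  then have "norm (exp z) \<le> (?b * 1) * (1 / 2)"
    unfolding nez using ex b by (intro mult_mono order_trans[OF ex] mult_left_mono) auto
  then have dhz: "norm (dh z) \<ge> ?b / 2"
    unfolding dh_def using norm_diff_ineq[of "of_real \<beta>" "exp z"] by (simp add: add.commute)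
  have "\<delta> * (?b / 2) \<le> norm (f z - v) * norm (dh z)" using fz dhz \<delta> b by (intro mult_mono) auto
  also have "\<dots> = norm (exp z) * norm (z - 1 - v)"
    using f_minus_v[of z] dhnz zR by (simp add: norm_divide norm_mult)
  also have "\<dots> \<le> exp ?x * exp (- (R / 2)) * (norm (w - v) + (1 + R / 2))"
  proof -
    have "norm (z - 1 - v) = norm ((w - v) - of_real (1 + R/2))" by (simp add: z_def algebra_simps)
    also have "\<dots> \<le> norm (w - v) + norm (of_real (1 + R/2) :: complex)" by (rule norm_triangle_ineq4)
    finally have "norm (z - 1 - v) \<le> norm (w - v) + (1 + R / 2)" using R by (simp only: norm_of_real)
    then show ?thesis unfolding nez by (intro mult_left_mono) auto
  qed
  finally have main: "\<delta> * (?b / 2) \<le> exp ?x * exp (- (R / 2)) * (norm (w - v) + (1 + R / 2))" .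
  \<comment> \<open>If |w - 1 - p| is about |w - v|, a zero p has a preimage near \<open>w\<close>
    when |p - v| is about \<open>M\<close>. The estimate \<open>main\<close> forces M + 1 to be at
    least \<delta>/2 * exp (R/2), hence M to be at least \<open>M\<^sub>0\<close>.\<close>
  define M where "M = norm (w - v) * exp ?x / ?b"
  have Mb: "?b * M = norm (w - v) * exp ?x" using b by (simp add: M_def)
  have ee: "(1 + R / 2) * exp (-(R/2)) \<le> 1"
    using exp_ge_add_one_self[of "R/2"] by (simp add: exp_minus field_simps)
  have "exp ?x * (1 + R / 2) \<le> (?b * exp (-(R/2))) * (1 + R / 2)"
    using R b by (intro mult_right_mono order_trans[OF ex] mult_left_mono) auto
  also have "\<dots> \<le> ?b" using mult_left_mono[OF ee, of ?b] b by (simp add: algebra_simps)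
  finally have "exp ?x * norm (w - v) + exp ?x * (1 + R / 2) \<le> ?b * M + ?b"
    unfolding Mb by (simp add: algebra_simps)
  then have "exp (- (R / 2)) * (exp ?x * norm (w - v) + exp ?x * (1 + R / 2)) \<le> exp (-(R/2)) * (?b * M + ?b)"
    by (intro mult_left_mono) auto
  then have "?b * (\<delta> / 2) \<le> ?b * (exp (-(R/2)) * (M + 1))"
    using main by (simp add: algebra_simps)
  then have "\<delta> / 2 \<le> exp (-(R/2)) * (M + 1)" using b by (rule mult_left_le_imp_le)
  then have "\<delta> / 2 * exp (R / 2) \<le> M + 1" by (simp add: exp_minus field_simps)
  moreover have "\<delta> / 2 * (R / 2) \<le> \<delta> / 2 * exp (R / 2)"
    using exp_ge_add_one_self[of "R/2"] \<delta> by (intro mult_left_mono) (linarith, simp)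
  ultimately have M: "M \<ge> M\<^sub>0" using R by (simp add: algebra_simps)
  then obtain p where p: "h p = 0" "M / 2 \<le> norm (p - v)" "norm (p - v) \<le> 3 * M"
    using M0 by blast
  have M40: "M \<ge> 40" using M M0 by linarith
  have "exp (-(R - 4)) \<le> 1 / 12"
  proof -
    have "12 \<le> exp (R - 4)" using exp_ge_add_one_self[of "R - 4"] R by linarith
    then show ?thesis by (simp only: exp_minus) (simp add: field_simps)
  qed
  then have "exp ?x \<le> ?b * (1 / 12)" using b by (intro order_trans[OF ex] mult_left_mono) auto
  then have "?b * M \<le> norm (w - v) * (?b * (1 / 12))" unfolding Mb by (intro mult_left_mono) auto
  then have "?b * M \<le> ?b * (norm (w - v) / 12)" by (simp add: algebra_simps)
  then have Mw: "12 * M \<le> norm (w - v)" using b by simp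
  have low: "norm (w - v) / 2 \<le> norm (w - 1 - p)"
  proof -
    have "norm (w - v) \<le> norm (w - 1 - p) + norm (1 + (p - v))"
      using norm_triangle_ineq[of "w - 1 - p" "1 + (p - v)"] by simp
    moreover have "norm (1 + (p - v)) \<le> 1 + norm (p - v)"
      using norm_triangle_ineq[of 1 "p - v"] by simp
    ultimately show ?thesis using p Mw M40 by linarith
  qed
  have up: "norm (w - 1 - p) \<le> 2 * norm (w - v)"
  proof -
    have "norm (w - 1 - p) \<le> norm (w - v) + norm (1 + (p - v))"
      using norm_triangle_ineq4[of "w - v" "1 + (p - v)"] by (simp add: algebra_simps)
    moreover have "norm (1 + (p - v)) \<le> 1 + norm (p - v)"
      using norm_triangle_ineq[of 1 "p - v"] by simp
    ultimately show ?thesis using p Mw M40 by linarith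
  qed
  obtain u where u: "u \<in> cball w 14" "(u - 1 - p) * exp u = of_real \<beta> * (p - v)"
  proof (rule preimage_near[of p w])
    show "p \<noteq> v" using p(2) M40 by auto
    show "20 \<le> norm (w - 1 - p)" using low Mw M40 by linarith
    have "exp ?x * norm (w - 1 - p) \<le> exp ?x * (2 * norm (w - v))" using up by (intro mult_left_mono) auto
    also have "\<dots> = 2 * (?b * M)" by (simp add: Mb)
    also have "\<dots> \<le> 12 * (?b * norm (p - v))"
    proof -
      have "2 * M \<le> 12 * norm (p - v)" using p(2) M40 by linarith
      then show ?thesis using mult_left_mono[of "2 * M" "12 * norm (p - v)" ?b] b by simp
    qed
    finally show "exp ?x * norm (w - 1 - p) \<le> 12 * (?b * norm (p - v))" .
    have "?b * norm (p - v) \<le> 3 * (?b * M)" using mult_left_mono[OF p(3), of ?b] b by simp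
    also have "\<dots> = 6 * (exp ?x * (norm (w - v) / 2))" by (simp add: Mb)
    also have "\<dots> \<le> 12 * (exp ?x * norm (w - 1 - p))"
    proof -
      have "6 * (norm (w - v) / 2) \<le> 12 * norm (w - 1 - p)"
        using low norm_ge_zero[of "w - 1 - p"] by linarith
      then show ?thesis
        using mult_left_mono[of "6 * (norm (w - v) / 2)" "12 * norm (w - 1 - p)" "exp ?x"] by simp
    qed
    finally show "?b * norm (p - v) \<le> 12 * (exp ?x * norm (w - 1 - p))" .
  qed (rule that)
  have "u \<in> basin" by (rule solution_in_basin[OF u(2) zero_in_basin[OF p(1)]])
  moreover have "u \<in> ball w R" using u(1) R by auto
  ultimately show False using disj by blast
qed

text \<open>The zeros of \<open>h\<close> lie along the curve \<open>Re z = ln (\<bar>\<beta>\<bar> * norm (z - v))\<close>. If \<open>w\<close> is close to it, then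
  there is a zero in the disc. If \<open>w\<close> is far to its left, then \<open>f\<close> moves the points of the disc
  by about \<open>\<rho> = exp D\<close> in all directions, and thus onto a zero at this distance.\<close>

lemma right_disc_bound:
  assumes R: "R \<ge> 160" "2 * (norm v + 24 + \<bar>ln \<bar>\<beta>\<bar>\<bar>) \<le> R"
    and w: "Re w \<ge> ln \<bar>\<beta>\<bar> + (R - 4)"
    and disj: "ball w R \<inter> basin = {}"
  shows "\<bar>\<beta>\<bar> * norm (w - v) \<le> exp (Re w) * exp (- (R / 4))" and "norm (w - v) \<ge> R / 2"
    and "\<bar>\<beta>\<bar> * 12 \<le> exp (Re w)"
proof -
  let ?x = "Re w" and ?b = "\<bar>\<beta>\<bar>"
  have b: "?b > 0" using beta_nonzero by simp
  have "norm (w - v) \<ge> norm w - norm v" by (rule norm_triangle_ineq2)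
  moreover have "norm w \<ge> ?x" using complex_Re_le_cmod by blast
  ultimately have wv: "norm (w - v) \<ge> R / 2 + 20"
    using w R abs_ge_minus_self[of "ln \<bar>\<beta>\<bar>"] by argo
  then show "norm (w - v) \<ge> R / 2" by simp
  have "12 \<le> exp (R - 4)" using exp_ge_add_one_self[of "R - 4"] R by linarith
  moreover have "?b * exp (R - 4) \<le> exp ?x"
  proof -
    have "exp (ln ?b + (R - 4)) \<le> exp ?x" using w by simp
    then show ?thesis using b by (simp only: exp_add exp_ln)
  qed
  ultimately show xb: "?b * 12 \<le> exp ?x"
    using mult_left_mono[of 12 "exp (R - 4)" ?b] abs_ge_zero[of \<beta>] by linarith
  \<comment> \<open>The signed horizontal distance from \<open>w\<close> to the curve. The cases |D|
    <= R/4 and D > R/4 both produce a basin point in the disc; what remains is that \<open>w\<close>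
    lies far to the right of the curve.\<close>
  define D where "D = ln (?b * norm (w - v)) - ?x"
  have "?b * norm (w - v) > 0" using b wv R by (intro mult_pos_pos) linarith+
  then have eD: "exp (?x + D) = ?b * norm (w - v)" by (simp add: D_def)
  have "\<not> \<bar>D\<bar> \<le> R / 4"
  proof
    assume DR: "\<bar>D\<bar> \<le> R / 4"
    let ?w = "w + of_real D"
    have n: "norm (?w - v) \<ge> norm (w - v) - \<bar>D\<bar>" "norm (?w - v) \<le> norm (w - v) + \<bar>D\<bar>"
      using norm_diff_ineq[of "w - v" "of_real D"] norm_triangle_ineq[of "w - v" "of_real D"]
      by (simp_all add: algebra_simps)
    obtain p where p: "p \<in> cball ?w 14" "h p = 0"
    proof (rule zero_near[of ?w])
      show "20 \<le> norm (?w - v)" using n DR wv R by linarith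
      have e: "exp (Re ?w) = ?b * norm (w - v)" using eD by simp
      have "norm (w - v) \<le> 12 * norm (?w - v)" using n DR wv R by linarith
      then show "exp (Re ?w) \<le> 12 * (?b * norm (?w - v))"
        unfolding e using mult_left_mono[of "norm (w - v)" "12 * norm (?w - v)" ?b] b by simp
      have "norm (?w - v) \<le> 12 * norm (w - v)" using n DR wv R by linarith
      then show "?b * norm (?w - v) \<le> 12 * exp (Re ?w)"
        unfolding e using mult_left_mono[of "norm (?w - v)" "12 * norm (w - v)" ?b] b by simp
    qed (rule that)
    have "dist w p \<le> dist w ?w + dist ?w p" by (rule dist_triangle)
    also have "\<dots> < R" using p(1) DR R by (simp add: dist_norm)
    finally have "p \<in> ball w R" by simp
    then show False using zero_in_basin[OF p(2)] disj by blast
  qed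
  moreover have "\<not> D > R / 4"
  proof
    assume DR: "D > R / 4"
    define \<rho> where "\<rho> = exp D"
    have \<rho>D: "\<rho> \<ge> 1 + D" unfolding \<rho>_def by simp
    have e\<rho>: "exp ?x * \<rho> = ?b * norm (w - v)" using eD by (simp add: \<rho>_def exp_add)
    have "(?b * 12) * \<rho> \<le> exp ?x * \<rho>" using xb by (intro mult_right_mono) (auto simp: \<rho>_def)
    then have "?b * (12 * \<rho>) \<le> ?b * norm (w - v)" unfolding e\<rho> by simp
    then have \<rho>w: "12 * \<rho> \<le> norm (w - v)" using b by simp
    \<comment> \<open>The real part moves \<open>w\<close> to the curve up to a bounded factor,
      which gives a zero p near w + ?t. The imaginary part makes |w - 1 - p| comparable to \<rho>,
      so that exp (Re w) |w - 1 - p| is comparable to |\<beta>| |p - v| and p has a preimage near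
      \<open>w\<close>.\<close>
    let ?t = "of_real D + \<i> * of_real \<rho>"
    let ?w = "w + ?t"
    have "norm ?t \<le> norm (of_real D :: complex) + norm (\<i> * of_real \<rho>)" by (rule norm_triangle_ineq)
    then have t: "norm ?t \<le> D + \<rho>" using DR R by (simp add: norm_mult \<rho>_def)
    have t': "norm ?t \<ge> \<rho>" using abs_Im_le_cmod[of ?t] by (simp add: \<rho>_def)
    have n: "norm (?w - v) \<ge> norm (w - v) - norm ?t" "norm (?w - v) \<le> norm (w - v) + norm ?t"
      using norm_diff_ineq[of "w - v" ?t] norm_triangle_ineq[of "w - v" ?t]
      by (simp_all add: algebra_simps)
    obtain p where p: "p \<in> cball ?w 14" "h p = 0"
    proof (rule zero_near[of ?w])
      show "20 \<le> norm (?w - v)" using n t \<rho>D \<rho>w wv R by linarith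
      have e: "exp (Re ?w) = ?b * norm (w - v)" using eD by simp
      have "norm (w - v) \<le> 12 * norm (?w - v)" using n t \<rho>D \<rho>w wv R by linarith
      then show "exp (Re ?w) \<le> 12 * (?b * norm (?w - v))"
        unfolding e using mult_left_mono[of "norm (w - v)" "12 * norm (?w - v)" ?b] b by simp
      have "norm (?w - v) \<le> 12 * norm (w - v)" using n t \<rho>D \<rho>w wv R by linarith
      then show "?b * norm (?w - v) \<le> 12 * exp (Re ?w)"
        unfolding e using mult_left_mono[of "norm (?w - v)" "12 * norm (w - v)" ?b] b by simp
    qed (rule that)
    have pd: "norm (?w - p) \<le> 14" using p(1) by (simp add: dist_norm)
    have pv: "norm (p - v) \<ge> norm (?w - v) - norm (?w - p)" "norm (p - v) \<le> norm (?w - v) + norm (?w - p)"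
      using norm_triangle_ineq2[of "?w - v" "?w - p"] norm_triangle_ineq4[of "?w - v" "?w - p"]
      by (simp_all add: algebra_simps)
    have s: "norm (?w - p - 1) \<le> 15" using pd norm_triangle_ineq4[of "?w - p" 1] by simp
    have eq: "w - 1 - p = (?w - p - 1) - ?t" by simp
    have wp: "norm (w - 1 - p) \<ge> norm ?t - norm (?w - p - 1)" "norm (w - 1 - p) \<le> norm (?w - p - 1) + norm ?t"
      using norm_triangle_ineq2[of ?t "?w - p - 1"] norm_triangle_ineq4[of "?w - p - 1" ?t]
      unfolding eq by (simp_all only: norm_minus_commute)
    obtain u where u: "u \<in> cball w 14" "(u - 1 - p) * exp u = of_real \<beta> * (p - v)"
    proof (rule preimage_near[of p w])
      have pv0: "norm (p - v) > 0" using pv n t \<rho>D \<rho>w wv R pd by linarith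
      then show "p \<noteq> v" by auto
      show "20 \<le> norm (w - 1 - p)" using wp s t' \<rho>D DR R by linarith
      have "norm (w - 1 - p) \<le> 3 * \<rho>" using wp s t \<rho>D DR R by linarith
      then have "exp ?x * norm (w - 1 - p) \<le> 3 * (exp ?x * \<rho>)"
        using mult_left_mono[of "norm (w - 1 - p)" "3 * \<rho>" "exp ?x"] by simp
      also have "\<dots> = 3 * (?b * norm (w - v))" by (simp add: e\<rho>)
      also have "\<dots> \<le> 12 * (?b * norm (p - v))"
      proof -
        have "norm (w - v) \<le> 4 * norm (p - v)" using pv n t \<rho>D \<rho>w wv R pd by linarith
        then show ?thesis using mult_left_mono[of "norm (w - v)" "4 * norm (p - v)" ?b] b by simp
      qed
      finally show "exp ?x * norm (w - 1 - p) \<le> 12 * (?b * norm (p - v))" .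
      have "norm (p - v) \<le> 2 * norm (w - v)" using pv n t \<rho>D \<rho>w wv R pd by linarith
      then have "?b * norm (p - v) \<le> 2 * (?b * norm (w - v))"
        using mult_left_mono[of "norm (p - v)" "2 * norm (w - v)" ?b] b by simp
      also have "\<dots> = 2 * (exp ?x * \<rho>)" by (simp add: e\<rho>)
      also have "\<dots> \<le> 12 * (exp ?x * norm (w - 1 - p))"
      proof -
        have "\<rho> \<le> 6 * norm (w - 1 - p)" using wp s t' \<rho>D DR R by linarith
        then show ?thesis using mult_left_mono[of "\<rho>" "6 * norm (w - 1 - p)" "exp ?x"] by simp
      qed
      finally show "?b * norm (p - v) \<le> 12 * (exp ?x * norm (w - 1 - p))" .
    qed (rule that)
    have "u \<in> basin" by (rule solution_in_basin[OF u(2) zero_in_basin[OF p(2)]])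
    moreover have "u \<in> ball w R" using u(1) R by auto
    ultimately show False using disj by blast
  qed
  ultimately have "D \<le> - (R / 4)" by linarith
  then have "exp (?x + D) \<le> exp (?x + - (R / 4))" by simp
  then show "?b * norm (w - v) \<le> exp ?x * exp (- (R / 4))" unfolding eD by (simp only: exp_add)
qed

lemma right_disc_step:
  assumes R: "R \<ge> 160" "2 * (norm v + 24 + \<bar>ln \<bar>\<beta>\<bar>\<bar>) \<le> R"
    and w: "Re w \<ge> ln \<bar>\<beta>\<bar> + (R - 4)"
    and disj: "ball w R \<inter> basin = {}"
  shows "norm (f w - (w - 1)) \<le> 1 / 2"
proof -
  note bd = right_disc_bound[OF assms]
  have b: "\<bar>\<beta>\<bar> > 0" using beta_nonzero by simp
  have "norm (dh w) \<ge> exp (Re w) - \<bar>\<beta>\<bar>"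
    unfolding dh_def using norm_diff_ineq[of "exp w" "of_real \<beta>"] by simp
  then have dhw: "norm (dh w) \<ge> exp (Re w) / 2" using bd(3) b by linarith
  then have "dh w \<noteq> 0" using exp_gt_zero[of "Re w"] by auto
  then have "norm (f w - (w - 1)) = \<bar>\<beta>\<bar> * norm (w - 1 - v) / norm (dh w)"
    by (simp add: f_minus_shift norm_divide norm_mult)
  also have "\<dots> \<le> (exp (Re w) / 20) / (exp (Re w) / 2)"
  proof (rule frac_le)
    have "norm (w - 1 - v) \<le> norm (w - v) + 1"
      using norm_triangle_ineq4[of "w - v" 1] by (simp add: algebra_simps)
    then have "norm (w - 1 - v) \<le> 2 * norm (w - v)" using bd(2) R by linarith
    then have "\<bar>\<beta>\<bar> * norm (w - 1 - v) \<le> 2 * (\<bar>\<beta>\<bar> * norm (w - v))"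
      using mult_left_mono[of "norm (w - 1 - v)" "2 * norm (w - v)" "\<bar>\<beta>\<bar>"] b by simp
    also have "\<dots> \<le> 2 * (exp (Re w) * exp (- (R / 4)))" using bd(1) by simp
    also have "\<dots> \<le> 2 * (exp (Re w) * (1 / 40))"
    proof -
      have "40 \<le> exp (R / 4)" using exp_ge_add_one_self[of "R / 4"] R by linarith
      then have "exp (- (R / 4)) \<le> 1 / 40" by (simp add: exp_minus field_simps)
      then show ?thesis by simp
    qed
    finally show "\<bar>\<beta>\<bar> * norm (w - 1 - v) \<le> exp (Re w) / 20" by simp
  qed (use dhw in auto)
  also have "\<dots> \<le> 1 / 2" by simp
  finally show ?thesis .
qed

lemma large_discs_along_orbit_impossible:
  assumes "v \<in> basin"
  shows "\<exists>R. \<forall>w. (\<forall>n. w (Suc n) = f (w n)) \<longrightarrow>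
    \<not> (\<forall>n. ball (w n) R \<inter> basin = {} \<and> (\<forall>z\<in>ball (w n) R. dh z \<noteq> 0))"
proof -
  obtain \<delta> where \<delta>: "\<delta> > 0" "ball v \<delta> \<subseteq> basin"
    using assms open_basin by (auto simp: open_contains_ball)
  obtain M\<^sub>0 where M0: "M\<^sub>0 \<ge> 40" "\<forall>M\<ge>M\<^sub>0. \<exists>p. h p = 0 \<and> M / 2 \<le> norm (p - v) \<and> norm (p - v) \<le> 3 * M"
    by (rule zeros_of_every_large_size)
  define R where "R = max 160 (max (4 * (M\<^sub>0 + 1) / \<delta>) (2 * (norm v + 24 + \<bar>ln \<bar>\<beta>\<bar>\<bar>)))"
  have "4 * (M\<^sub>0 + 1) / \<delta> \<le> R" unfolding R_def by simp
  then have R: "4 * (M\<^sub>0 + 1) \<le> \<delta> * R" using \<delta> by (simp add: pos_divide_le_eq mult.commute)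
  have R': "R \<ge> 160" "2 * (norm v + 24 + \<bar>ln \<bar>\<beta>\<bar>\<bar>) \<le> R" unfolding R_def by linarith+
  have False if orb: "\<And>n. w (Suc n) = f (w n)"
    and disj: "\<And>n. ball (w n) R \<inter> basin = {}" and nz: "\<And>n. \<forall>z\<in>ball (w n) R. dh z \<noteq> 0" for w
  proof -
    have "\<bar>Re (w n) - ln \<bar>\<beta>\<bar>\<bar> \<ge> R - 4" for n using pole_near[of "w n" R] nz[of n] by fastforce
    moreover have "\<not> Re (w n) \<le> ln \<bar>\<beta>\<bar> - (R - 4)" for n
      using left_disc_meets_basin[OF M0 \<delta> R'(1) R _ nz] disj by blast
    ultimately have right: "Re (w n) \<ge> ln \<bar>\<beta>\<bar> + (R - 4)" for n by (smt (verit))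
    have step: "Re (w (Suc n)) \<le> Re (w n) - 1 / 2" for n
    proof -
      have "norm (w (Suc n) - (w n - 1)) \<le> 1 / 2"
        using right_disc_step[OF R' right disj] by (simp add: orb)
      then show ?thesis using abs_Re_le_cmod[of "w (Suc n) - (w n - 1)"] by simp
    qed
    have "Re (w n) \<le> Re (w 0) - n / 2" for n
    proof (induction n)
      case (Suc n)
      then show ?case using step[of n] by (simp add: field_simps)
    qed simp
    moreover obtain n :: nat where "real n > 2 * (Re (w 0) - ln \<bar>\<beta>\<bar> - (R - 4))"
      using reals_Archimedean2 by blast
    ultimately show False using right[of n] by (smt (verit) field_sum_of_halves)
  qed
  then show ?thesis by blast
qed

text \<open>Near a pole, 1/f extends to an open map that vanishes at the pole, so \<open>f\<close>
  takes all large values there, among them zeros of \<open>h\<close>. The extension is written as dh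
  / num, which is defined at the pole itself.\<close>

lemma pole_in_closure_basin:
  assumes z: "dh z = 0"
  shows "z \<in> closure basin"
proof (cases "h z = 0")
  case True
  then show ?thesis using zero_in_basin closure_subset by blast
next
  case False
  define num where "num = (\<lambda>x. x * dh x - h x)"
  define k where "k = (\<lambda>x. dh x / num x)"
  have num_z: "num z \<noteq> 0" using z False by (simp add: num_def)
  have opn: "open {x. num x \<noteq> 0}" unfolding num_def dh_def h_def by (intro open_Collect_neq continuous_intros)
  have "\<exists>y\<in>basin. dist y z < e" if "e > 0" for e
  proof -
    obtain e' where e': "e' > 0" "ball z e' \<subseteq> {x. num x \<noteq> 0}"
      using opn num_z by (auto simp: open_contains_ball)
    define d where "d = min e e'"
    have d: "d > 0" "ball z d \<subseteq> {x. num x \<noteq> 0}" "d \<le> e" using e' that by (auto simp: d_def)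
    have hol: "k holomorphic_on ball z d"
      unfolding k_def num_def dh_def h_def
      by (intro holomorphic_intros) (use d(2) in \<open>auto simp: num_def dh_def h_def\<close>)
    have "\<not> k constant_on ball z d"
    proof
      assume "k constant_on ball z d"
      then obtain c where c: "\<And>x. x \<in> ball z d \<Longrightarrow> k x = c" by (auto simp: constant_on_def)
      have "c = 0" using c[of z] d(1) z by (simp add: k_def)
      then have dh0: "dh x = 0" if "x \<in> ball z d" for x using c[OF that] d(2) that by (auto simp: k_def)
      have "((\<lambda>x. 0) has_field_derivative exp z) (at z)"
      proof (rule has_field_derivative_transform_within_open[OF has_derivative_dh open_ball])
        show "z \<in> ball z d" using d(1) by simp
      qed (rule dh0)
      then have "exp z = 0" using DERIV_unique[OF _ DERIV_const] by blast
      then show False by simp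
    qed
    then have "open (k ` ball z d)"
      by (rule open_mapping_thm[OF hol open_ball connected_ball open_ball order_refl])
    moreover have "0 \<in> k ` ball z d" using d(1) z by (intro image_eqI[of _ _ z]) (auto simp: k_def)
    ultimately obtain s where s: "s > 0" "ball 0 s \<subseteq> k ` ball z d" by (auto simp: open_contains_ball)
    obtain M\<^sub>0 where M0: "M\<^sub>0 \<ge> 40" "\<forall>M\<ge>M\<^sub>0. \<exists>p. h p = 0 \<and> M / 2 \<le> norm (p - v) \<and> norm (p - v) \<le> 3 * M"
      by (rule zeros_of_every_large_size)
    define M where "M = max M\<^sub>0 (2 * (norm v + 2 / s))"
    have "M\<^sub>0 \<le> M" by (simp add: M_def)
    then obtain p where p: "h p = 0" "M / 2 \<le> norm (p - v)" using M0(2)[rule_format, OF \<open>M\<^sub>0 \<le> M\<close>] by blast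
    have "norm v + 2 / s \<le> M / 2" by (simp add: M_def)
    then have "norm p \<ge> 2 / s" using p(2) norm_triangle_ineq4[of p v] by linarith
    then have pp: "norm p > 1 / s" "norm p > 0" using s(1) by (auto simp: field_simps intro: less_le_trans)
    then have "1 / p \<in> ball 0 s" using s(1) by (simp add: norm_divide field_simps)
    then obtain x where x: "x \<in> ball z d" "k x = 1 / p" using s(2) by force
    have "dh x \<noteq> 0" using x(2) pp by (auto simp: k_def)
    moreover have "num x \<noteq> 0" using x(1) d(2) by auto
    ultimately have "f x = p" using x(2) pp by (simp add: k_def num_def f_def field_simps)
    then have "x \<in> basin" using p(1) zero_in_basin f_in_basin_iff by metis
    then show ?thesis using x(1) d(3) by (intro bexI[of _ x]) (auto simp: dist_commute)
  qed
  then show ?thesis by (simp add: closure_approachable)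
qed

end

section \<open>The covering over the complement of the postsingular set\<close>

text \<open>A real zero of \<open>h\<close> enters the dynamics only through the fate of the
  asymptotic value.\<close>

locale newton_exp_asymptotic = newton_exp +
  assumes v_basin: "v \<in> basin"
begin

text \<open>All critical points of \<open>f\<close> are zeros of \<open>h\<close>, and these are fixed; so \<open>P\<close> contains the
  postsingular set.\<close>

definition P :: "complex set" where "P = {p. h p = 0} \<union> range (\<lambda>n. (f ^^ n) v)"

definition A :: "complex set" where "A = {z. dh z \<noteq> 0 \<and> f z \<notin> P}"

lemma f_in_P: "p \<in> P \<Longrightarrow> f p \<in> P"
proof -
  have "f ((f ^^ n) v) \<in> P" for n
    unfolding P_def using rangeI[of "\<lambda>n. (f ^^ n) v" "Suc n"] by simp
  then show "p \<in> P \<Longrightarrow> f p \<in> P" by (auto simp: P_def f_fixed)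
qed

lemma v_in_P: "v \<in> P"
  unfolding P_def using rangeI[of "\<lambda>n. (f ^^ n) v" 0] by simp

text \<open>Forward invariance of \<open>P\<close>. It allows lifts to be iterated: a lift into
  \<open>A\<close> avoids \<open>P\<close> and can be lifted again.\<close>

lemma A_subset: "A \<subseteq> - P"
  using f_in_P by (auto simp: A_def)

lemma P_subset_basin: "P \<subseteq> basin"
  by (auto simp: P_def funpow_in_basin_iff v_basin zero_in_basin)

text \<open>The orbit of \<open>v\<close> becomes compact when its limit, a zero of
  \<open>h\<close>, is added. So \<open>P\<close> is unbounded only through the zeros of
  \<open>h\<close>, around which the uniform contraction radius is available.\<close>

lemma P_decomposition:
  obtains L where "h L = 0" "compact (insert L (range (\<lambda>n. (f ^^ n) v)))"
proof -
  obtain L where L: "h L = 0" "(\<lambda>n. (f ^^ n) v) \<longlonglongrightarrow> L" using v_basin by (auto simp: basin_def)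
  then show ?thesis using that[OF L(1) compact_sequence_with_limit[OF L(2)]] by simp
qed

lemma closed_P: "closed P"
proof -
  obtain L where L: "h L = 0" "compact (insert L (range (\<lambda>n. (f ^^ n) v)))" by (rule P_decomposition)
  have "closed {p. h p = 0}" unfolding h_def by (intro closed_Collect_eq continuous_intros)
  then have "closed ({p. h p = 0} \<union> insert L (range (\<lambda>n. (f ^^ n) v)))"
    using L(2) compact_imp_closed by blast
  moreover have "{p. h p = 0} \<union> insert L (range (\<lambda>n. (f ^^ n) v)) = P" using L(1) by (auto simp: P_def)
  ultimately show ?thesis by simp
qed

lemma uniform_ball_around_P:
  obtains \<delta> where "\<delta> > 0" "\<forall>p\<in>P. ball p \<delta> \<subseteq> basin"
proof -
  obtain L where L: "h L = 0" "compact (insert L (range (\<lambda>n. (f ^^ n) v)))" by (rule P_decomposition)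
  have "insert L (range (\<lambda>n. (f ^^ n) v)) \<subseteq> P" using L(1) by (auto simp: P_def)
  then have sub: "insert L (range (\<lambda>n. (f ^^ n) v)) \<subseteq> basin" using P_subset_basin by (rule order_trans)
  obtain e where e: "e > 0" "(\<Union>x\<in>insert L (range (\<lambda>n. (f ^^ n) v)). ball x e) \<subseteq> basin"
    by (rule compact_subset_open_imp_ball_epsilon_subset[OF L(2) open_basin sub])
  obtain d where d: "d > 0"
    "\<forall>p z. h p = 0 \<longrightarrow> z \<in> ball p d \<longrightarrow> norm (f z - p) \<le> 3 / 4 * norm (z - p)"
    using f_uniformly_contracts_near_zeros by blast
  have near_zero: "ball p d \<subseteq> basin" if "h p = 0" for p
    by (rule ball_subset_basin[OF that]) (use d(2) that in blast)
  have "ball p (min d e) \<subseteq> basin" if "p \<in> P" for p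
  proof (cases "h p = 0")
    case False
    then have "p \<in> insert L (range (\<lambda>n. (f ^^ n) v))" using \<open>p \<in> P\<close> by (auto simp: P_def)
    then have "ball p e \<subseteq> basin" using e(2) by blast
    then show ?thesis by auto
  next
    case True
    then show ?thesis using near_zero[OF True] by auto
  qed
  then show ?thesis using that[of "min d e"] d e by auto
qed

lemma open_A: "open A"
proof -
  have "A = {z. dh z \<noteq> 0} \<inter> f -` (- P)" by (auto simp: A_def)
  moreover have "open ({z. dh z \<noteq> 0} \<inter> f -` (- P))"
    by (rule continuous_open_preimage[OF holomorphic_on_imp_continuous_on[OF holomorphic_f] open_dh_nonzero])
      (use closed_P in \<open>simp add: open_Compl\<close>)
  ultimately show ?thesis by simp
qed

lemma holomorphic_on_A: "f holomorphic_on A"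
  by (rule holomorphic_on_subset[OF holomorphic_f]) (auto simp: A_def)

lemma f_image_A: "f ` A = - P"
proof (intro equalityI subsetI)
  fix q assume q: "q \<in> - P"
  then have "q \<noteq> v" using v_in_P by blast
  then obtain z where "dh z \<noteq> 0" "f z = q" by (rule f_surj)
  then show "q \<in> f ` A" using q by (auto simp: A_def)
qed (auto simp: A_def)

lemma deriv_f_nonzero_on_A:
  assumes "z \<in> A"
  shows "deriv f z \<noteq> 0"
proof -
  have "h z \<noteq> 0"
  proof
    assume "h z = 0"
    then have "f z \<in> P" using f_fixed[of z] by (simp add: P_def)
    then show False using assms by (simp add: A_def)
  qed
  then show ?thesis using assms by (simp add: deriv_f_nonzero A_def)
qed

text \<open>If z is large and f z is bounded, \<open>f_eq_iff\<close> makes |exp z| at most of order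
  1/|z|, and \<open>deriv_f_alt\<close> makes f' comparable to f z - v. On a unit disc |exp| grows
  by a factor of at most 3, so \<open>dh\<close> stays away from 0 and \<open>f\<close> stays
  bounded.\<close>

lemma f_near_infinity_bounds:
  assumes r: "r > 0" and a: "norm v \<le> a"
  obtains L C where "L > 0" "C > 0"
    "\<forall>z. L \<le> norm z \<longrightarrow> dh z \<noteq> 0 \<longrightarrow> norm (f z) \<le> a \<longrightarrow> r \<le> norm (f z - v) \<longrightarrow>
        r / 4 \<le> norm (deriv f z) \<and> (\<forall>x\<in>ball z 1. dh x \<noteq> 0 \<and> norm (f x) \<le> C)"
proof -
  define L where "L = 2 + 20 * a + 2 * r"
  define C where "C = 97 * a + 1"
  have a0: "a \<ge> 0" using a norm_ge_zero order_trans by blast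
  have b: "\<bar>\<beta>\<bar> > 0" using beta_nonzero by simp
  have main: "r / 4 \<le> norm (deriv f z) \<and> (\<forall>x\<in>ball z 1. dh x \<noteq> 0 \<and> norm (f x) \<le> C)"
    if z: "L \<le> norm z" and dhz: "dh z \<noteq> 0" and u: "norm (f z) \<le> a" "r \<le> norm (f z - v)" for z
  proof -
    let ?u = "f z"
    have eq: "(z - 1 - ?u) * exp z = of_real \<beta> * (?u - v)" using f_eq_iff[OF dhz, of ?u] by simp
    have uv: "norm (?u - v) \<le> 2 * a" using norm_triangle_ineq4[of ?u v] u a by linarith
    have zu: "norm (z - ?u) \<ge> norm z - a" using norm_triangle_ineq2[of z ?u] u by linarith
    have z1u: "norm (z - 1 - ?u) \<ge> norm z - 1 - a"
      using norm_triangle_ineq2[of "z - ?u" 1] zu by (simp add: algebra_simps)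
    have z1u2: "norm (z - 1 - ?u) \<ge> norm z / 2" using z1u z a0 r unfolding L_def by linarith
    have z1v: "norm (z - 1 - v) \<le> norm z + 1 + a"
      using norm_triangle_ineq4[of z "1 + v"] norm_triangle_ineq[of 1 v] a by (simp add: algebra_simps)
    have eqn: "norm (z - 1 - ?u) * norm (exp z) = \<bar>\<beta>\<bar> * norm (?u - v)"
      using arg_cong[OF eq, of norm] by (simp add: norm_mult)
    have 1: "norm z * norm (exp z) \<le> \<bar>\<beta>\<bar> * (4 * a)"
    proof -
      have "norm z / 2 * norm (exp z) \<le> norm (z - 1 - ?u) * norm (exp z)"
        using z1u2 by (intro mult_right_mono) auto
      also have "\<dots> \<le> \<bar>\<beta>\<bar> * (2 * a)" unfolding eqn using uv by (intro mult_left_mono) auto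
      finally show ?thesis by simp
    qed
    have e8: "norm (exp z) \<le> \<bar>\<beta>\<bar> / 5"
    proof -
      have "(20 * a + 1) * norm (exp z) \<le> norm z * norm (exp z)"
        using z a0 r by (intro mult_right_mono) (auto simp: L_def)
      then have "(20 * a + 1) * norm (exp z) \<le> (20 * a + 1) * (\<bar>\<beta>\<bar> / 5)"
        using 1 b a0 by (simp add: algebra_simps)
      then show ?thesis by (rule mult_left_le_imp_le) (use a0 in linarith)
    qed
    have ne: "z - 1 - v \<noteq> 0"
    proof
      assume "z - 1 - v = 0"
      then have "z = 1 + v" by (simp add: diff_eq_eq add.commute)
      then have "norm z \<le> 1 + a" using norm_triangle_ineq[of 1 v] a by simp
      then show False using z a0 r by (simp add: L_def)
    qed
    have "z - 1 - ?u \<noteq> 0"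
    proof
      assume "z - 1 - ?u = 0"
      then have "norm z \<le> 0" using z1u2 by simp
      then show False using z a0 r by (simp add: L_def)
    qed
    then have d: "norm (deriv f z) * norm (z - 1 - v) = norm (z - ?u) * norm (?u - v)"
      using arg_cong[OF deriv_f_alt[OF dhz], of norm] by (simp add: norm_mult)
    have "norm z / 2 * r \<le> norm (z - ?u) * norm (?u - v)"
      using zu z a0 r u by (intro mult_mono) (auto simp: L_def)
    also have "\<dots> \<le> norm (deriv f z) * (2 * norm z)"
      unfolding d[symmetric] using z1v z a0 r by (intro mult_left_mono) (auto simp: L_def)
    finally have "norm z * (r / 4) \<le> norm z * norm (deriv f z)" by (simp add: algebra_simps)
    then have "r / 4 \<le> norm (deriv f z)"
      by (rule mult_left_le_imp_le) (use z a0 r in \<open>auto simp: L_def\<close>)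
    moreover have "dh x \<noteq> 0 \<and> norm (f x) \<le> C" if x: "x \<in> ball z 1" for x
    proof -
      have "Re (x - z) \<le> 1" using complex_Re_le_cmod[of "x - z"] x by (simp add: dist_norm norm_minus_commute)
      then have "exp (Re x) \<le> exp (Re z) * exp 1" unfolding exp_add[symmetric] by simp
      also have "\<dots> \<le> exp (Re z) * 3" using exp_le by (intro mult_left_mono) auto
      finally have ex: "norm (exp x) \<le> 3 * norm (exp z)" by simp
      have "norm (dh x) \<ge> \<bar>\<beta>\<bar> - norm (exp x)"
        unfolding dh_def using norm_diff_ineq[of "of_real \<beta>" "exp x"] by (simp add: add.commute)
      then have dhx: "norm (dh x) \<ge> \<bar>\<beta>\<bar> / 4" using ex e8 b by linarith
      then have nz: "dh x \<noteq> 0" using b by auto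
      have xv: "norm (x - 1 - v) \<le> 2 * norm z"
      proof -
        have "norm (x - 1 - v) \<le> norm (z - 1 - v) + norm (x - z)"
          using norm_triangle_ineq[of "z - 1 - v" "x - z"] by (simp add: algebra_simps)
        then show ?thesis using z1v x z a0 r by (simp add: dist_norm norm_minus_commute L_def)
      qed
      have "norm (exp x) * norm (x - 1 - v) \<le> (3 * norm (exp z)) * (2 * norm z)"
        using ex xv by (intro mult_mono) auto
      also have "\<dots> \<le> 6 * (\<bar>\<beta>\<bar> * (4 * a))" using 1 by (simp add: algebra_simps)
      finally have "norm (exp x) * norm (x - 1 - v) \<le> 24 * a * \<bar>\<beta>\<bar>" by (simp add: algebra_simps)
      then have "norm (f x - v) \<le> (24 * a * \<bar>\<beta>\<bar>) / (\<bar>\<beta>\<bar> / 4)"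
        unfolding f_minus_v[OF nz] norm_divide norm_mult using dhx b a0 by (intro frac_le) auto
      also have "\<dots> = 96 * a" using b by simp
      finally have "norm (f x) \<le> 96 * a + a"
        using norm_triangle_ineq[of "f x - v" v] a by simp
      then show ?thesis using nz by (simp add: C_def)
    qed
    ultimately show ?thesis by blast
  qed
  have "L > 0" "C > 0" using a0 r by (auto simp: L_def C_def)
  then show ?thesis by (rule that) (use main in simp)
qed

text \<open>The danger is a limit point where \<open>dh\<close> vanishes. If it is a zero of
  \<open>h\<close>, it is fixed and belongs to \<open>P\<close>, which the disc avoids. Otherwise h
  = (x - f x) * dh x with bounded first factor would tend to 0 although \<open>h\<close> does not
  vanish there.\<close>

lemma compact_bounded_preimage:
  assumes "cball w r \<subseteq> - P"
  shows "compact {z \<in> cball 0 L. dh z \<noteq> 0 \<and> f z \<in> cball w r}" (is "compact ?K")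
proof -
  have "closed ?K"
    unfolding closed_sequential_limits
  proof (intro allI impI, elim conjE)
    fix x l assume x: "\<forall>n. x n \<in> ?K" and l: "x \<longlonglongrightarrow> l"
    have lL: "l \<in> cball 0 L"
      using closed_sequentially[OF closed_cball[of 0 L], of x l] x l by auto
    have fl: "f l \<in> cball w r" if "isCont f l"
    proof (rule closed_sequentially[OF closed_cball])
      show "(\<lambda>n. f (x n)) \<longlonglongrightarrow> f l" using isCont_tendsto_compose[OF that l] .
    qed (use x in auto)
    have "dh l \<noteq> 0"
    proof
      assume dl: "dh l = 0"
      show False
      proof (cases "h l = 0")
        case True
        then have "f l \<in> cball w r" using fl isCont_f by blast
        moreover have "f l \<in> P" using f_fixed[OF True] True by (simp add: P_def)
        ultimately show False using assms by blast
      next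
        case False
        have bd: "norm (x n - f (x n)) \<le> L + (norm w + r)" for n
        proof -
          have "norm (f (x n)) \<le> norm w + r"
            using x norm_triangle_ineq4[of w "w - f (x n)"] by (auto simp: dist_norm intro: order_trans)
          moreover have "norm (x n) \<le> L" using x by auto
          ultimately show ?thesis using norm_triangle_ineq4[of "x n" "f (x n)"] by linarith
        qed
        have hx: "h (x n) = (x n - f (x n)) * dh (x n)" for n
          using x by (simp add: f_def)
        have "(\<lambda>n. dh (x n)) \<longlonglongrightarrow> dh l"
          unfolding dh_def by (intro tendsto_intros l)
        then have "(\<lambda>n. (L + (norm w + r)) * norm (dh (x n))) \<longlonglongrightarrow> 0"
          using dl by (intro tendsto_mult_right_zero tendsto_norm_zero) simp
        moreover have "\<forall>\<^sub>F n in sequentially. norm (h (x n)) \<le> (L + (norm w + r)) * norm (dh (x n))"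
          unfolding hx norm_mult using bd by (intro always_eventually allI mult_right_mono) auto
        ultimately have "(\<lambda>n. h (x n)) \<longlonglongrightarrow> 0" by (rule Lim_null_comparison[rotated])
        moreover have "(\<lambda>n. h (x n)) \<longlonglongrightarrow> h l"
          unfolding h_def by (intro tendsto_intros l)
        ultimately show False using False LIMSEQ_unique by blast
      qed
    qed
    then show "l \<in> ?K" using lL fl isCont_f by blast
  qed
  then have "compact (cball 0 L \<inter> ?K)" by (rule compact_Int_closed[OF compact_cball])
  moreover have "cball 0 L \<inter> ?K = ?K" by blast
  ultimately show ?thesis by (simp only:)
qed

lemma f_uniform_bounds_over_disc:
  assumes r: "r > 0" and sub: "cball w (2 * r) \<subseteq> - P"
  obtains \<kappa> C m where "\<kappa> > 0" "C > 0" "m > 0"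
    "\<forall>z. dh z \<noteq> 0 \<longrightarrow> f z \<in> cball w r \<longrightarrow>
       m \<le> norm (deriv f z) \<and> (\<forall>x\<in>ball z \<kappa>. dh x \<noteq> 0 \<and> norm (f x) \<le> C)"
proof -
  define a where "a = norm w + r + norm v"
  have av: "norm v \<le> a" using r by (simp add: a_def)
  obtain L C\<^sub>1 where LC: "L > 0" "C\<^sub>1 > 0"
    "\<forall>z. L \<le> norm z \<longrightarrow> dh z \<noteq> 0 \<longrightarrow> norm (f z) \<le> a \<longrightarrow> r \<le> norm (f z - v) \<longrightarrow>
        r / 4 \<le> norm (deriv f z) \<and> (\<forall>x\<in>ball z 1. dh x \<noteq> 0 \<and> norm (f x) \<le> C\<^sub>1)"
    by (rule f_near_infinity_bounds[OF r av])
  define K where "K = {z \<in> cball 0 L. dh z \<noteq> 0 \<and> f z \<in> cball w r}"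
  have "cball w r \<subseteq> cball w (2 * r)" using r by auto
  then have rsub: "cball w r \<subseteq> - P" using sub by blast
  have K: "compact K" unfolding K_def by (rule compact_bounded_preimage[OF rsub])
  have KA: "K \<subseteq> A" using rsub by (auto simp: K_def A_def)
  have Ksub: "K \<subseteq> {z. dh z \<noteq> 0}" by (auto simp: K_def)
  obtain e where e: "e > 0" "(\<Union>x\<in>K. ball x e) \<subseteq> {z. dh z \<noteq> 0}"
    by (rule compact_subset_open_imp_ball_epsilon_subset[OF K open_dh_nonzero Ksub])
  \<comment> \<open>The closed e/2-neighbourhood of \<open>K\<close>. It is compact and free of
    zeros of \<open>dh\<close>, so it bounds \<open>f\<close> on discs about all points of
    \<open>K\<close>.\<close>
  define K' where "K' = {x + y | x y. x \<in> K \<and> y \<in> cball 0 (e/2)}"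
  have K'_sub: "K' \<subseteq> {z. dh z \<noteq> 0}"
  proof
    fix u assume "u \<in> K'"
    then obtain x y where "u = x + y" "x \<in> K" "norm y \<le> e/2" by (auto simp: K'_def)
    then have "u \<in> (\<Union>x\<in>K. ball x e)" using e(1) by (intro UN_I[of x]) (auto simp: dist_norm)
    then show "u \<in> {z. dh z \<noteq> 0}" using e(2) by blast
  qed
  have "compact (f ` K')"
    unfolding K'_def by (intro compact_continuous_image compact_sums K compact_cball)
      (use K'_sub holomorphic_on_imp_continuous_on[OF holomorphic_f] in \<open>auto simp: K'_def intro: continuous_on_subset\<close>)
  then obtain C\<^sub>2 where C2: "C\<^sub>2 > 0" "\<forall>y\<in>f ` K'. norm y \<le> C\<^sub>2"
    using compact_imp_bounded bounded_pos by metis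
  have "\<exists>m>0. \<forall>z\<in>K. m \<le> norm (deriv f z)"
  proof (cases "K = {}")
    case False
    have "continuous_on A (deriv f)"
      by (intro holomorphic_on_imp_continuous_on holomorphic_deriv holomorphic_on_A open_A)
    then have "continuous_on K (\<lambda>z. norm (deriv f z))"
      using KA continuous_on_subset continuous_on_norm by blast
    then obtain z where "z \<in> K" "\<forall>y\<in>K. norm (deriv f z) \<le> norm (deriv f y)"
      using continuous_attains_inf[OF K False] by blast
    then show ?thesis using deriv_f_nonzero_on_A KA by (intro exI[of _ "norm (deriv f z)"]) auto
  qed (auto intro: exI[of _ 1])
  then obtain m where m: "m > 0" "\<forall>z\<in>K. m \<le> norm (deriv f z)" by blast
  define \<kappa> where "\<kappa> = min 1 (e/2)"
  have main: "min m (r/4) \<le> norm (deriv f z) \<and> (\<forall>x\<in>ball z \<kappa>. dh x \<noteq> 0 \<and> norm (f x) \<le> max C\<^sub>1 C\<^sub>2)"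
    if dhz: "dh z \<noteq> 0" and fz: "f z \<in> cball w r" for z
  proof (cases "norm z \<le> L")
    case True
    then have zK: "z \<in> K" using dhz fz by (auto simp: K_def)
    have "x \<in> K'" if "x \<in> ball z \<kappa>" for x
      unfolding K'_def
      by (rule CollectI, rule exI[of _ z], rule exI[of _ "x - z"])
        (use zK that in \<open>auto simp: \<kappa>_def dist_norm norm_minus_commute\<close>)
    then have "dh x \<noteq> 0 \<and> norm (f x) \<le> max C\<^sub>1 C\<^sub>2" if "x \<in> ball z \<kappa>" for x
      using that C2(2) K'_sub by (auto simp: le_max_iff_disj)
    then show ?thesis using m(2) zK by (auto simp: min_le_iff_disj)
  next
    case False
    have "norm (f z) \<le> norm w + norm (f z - w)" using norm_triangle_ineq[of w "f z - w"] by simp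
    also have "\<dots> \<le> a"
      using fz norm_ge_zero[of v] unfolding a_def mem_cball dist_norm norm_minus_commute[of w] by linarith
    finally have 1: "norm (f z) \<le> a" .
    \<comment> \<open>The radius 2 r in the hypothesis leaves a margin r between f z and
      \<open>v\<close>, on which the lower bound for f' near infinity depends.\<close>
    have "v \<notin> cball w (2 * r)" using sub v_in_P by blast
    then have "2 * r < dist w v" by simp
    also have "\<dots> \<le> dist w (f z) + dist (f z) v" by (rule dist_triangle)
    finally have 2: "r \<le> norm (f z - v)" using fz by (simp add: dist_norm)
    have "r / 4 \<le> norm (deriv f z) \<and> (\<forall>x\<in>ball z 1. dh x \<noteq> 0 \<and> norm (f x) \<le> C\<^sub>1)"
    proof -
      have "L \<le> norm z" using False by simp
      then show ?thesis using LC(3) dhz 1 2 by blast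
    qed
    then show ?thesis by (auto simp: \<kappa>_def min_le_iff_disj le_max_iff_disj)
  qed
  have "\<kappa> > 0" "max C\<^sub>1 C\<^sub>2 > 0" "min m (r/4) > 0"
    using e(1) LC C2 m r by (auto simp: \<kappa>_def)
  then show ?thesis by (rule that) (use main in simp)
qed

text \<open>The uniform bounds over a disc give local inverses of one common width at all preimages,
  bounded or not; their values lie in \<open>A\<close> because the disc avoids
  \<open>P\<close>.\<close>

lemma covering_f: "covering_space A f (- P)"
proof (rule covering_space_if_local_sections[OF holomorphic_on_imp_continuous_on[OF holomorphic_on_A] f_image_A])
  fix w assume "w \<in> - P"
  then obtain e where e: "e > 0" "cball w e \<subseteq> - P"
    using open_contains_cball[of "- P"] closed_P by (auto simp: open_Compl)
  define r where "r = e / 2"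
  have r: "r > 0" "cball w (2 * r) \<subseteq> - P" using e by (simp_all add: r_def)
  obtain \<kappa> C m where k: "\<kappa> > 0" "C > 0" "m > 0"
    "\<forall>z. dh z \<noteq> 0 \<longrightarrow> f z \<in> cball w r \<longrightarrow>
       m \<le> norm (deriv f z) \<and> (\<forall>x\<in>ball z \<kappa>. dh x \<noteq> 0 \<and> norm (f x) \<le> C)"
    by (rule f_uniform_bounds_over_disc[OF r])
  obtain \<eta> where \<eta>: "\<eta> > 0" and inv:
    "\<forall>F z. F holomorphic_on ball z \<kappa> \<longrightarrow> (\<forall>x\<in>ball z \<kappa>. norm (F x) \<le> C) \<longrightarrow>
      m \<le> norm (deriv F z) \<longrightarrow>
      (\<exists>q. continuous_on (ball (F z) \<eta>) q \<and> q ` ball (F z) \<eta> \<subseteq> ball z \<kappa> \<and> q (F z) = z \<and>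
           (\<forall>y\<in>ball (F z) \<eta>. F (q y) = y))"
    using holomorphic_uniform_local_inverse[OF k(1-3)] by blast
  \<comment> \<open>Half of \<open>\<eta>\<close>, so that the disc about \<open>w\<close> fits into
    the disc of radius \<open>\<eta>\<close> about any of its points f z.\<close>
  let ?r = "min r (\<eta> / 2)"
  have rP: "ball w ?r \<subseteq> - P"
  proof -
    have "ball w ?r \<subseteq> cball w (2 * r)" using r by auto
    then show ?thesis using r(2) by blast
  qed
  show "\<exists>r>0. ball w r \<subseteq> - P \<and> (\<forall>z\<in>A. f z \<in> ball w r \<longrightarrow>
        (\<exists>q. continuous_on (ball w r) q \<and> q ` ball w r \<subseteq> A \<and> (\<forall>y\<in>ball w r. f (q y) = y) \<and> q (f z) = z))"
  proof (intro exI[of _ ?r] conjI ballI impI)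
    show "?r > 0" using r \<eta> by simp
    fix z assume z: "z \<in> A" "f z \<in> ball w ?r"
    have "f z \<in> cball w r" using z(2) by auto
    then have b: "m \<le> norm (deriv f z)" "\<forall>x\<in>ball z \<kappa>. dh x \<noteq> 0 \<and> norm (f x) \<le> C"
      using k(4) z(1) by (auto simp: A_def)
    have "f holomorphic_on ball z \<kappa>" by (rule holomorphic_on_subset[OF holomorphic_f]) (use b in auto)
    then obtain q where q: "continuous_on (ball (f z) \<eta>) q" "q ` ball (f z) \<eta> \<subseteq> ball z \<kappa>" "q (f z) = z"
      "\<forall>y\<in>ball (f z) \<eta>. f (q y) = y"
      using inv[rule_format, of f z] b by blast
    have sub: "ball w ?r \<subseteq> ball (f z) \<eta>"
    proof
      fix y assume "y \<in> ball w ?r"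
      then show "y \<in> ball (f z) \<eta>" using z(2) dist_triangle[of "f z" y w] by (simp add: dist_commute)
    qed
    show "\<exists>q. continuous_on (ball w ?r) q \<and> q ` ball w ?r \<subseteq> A \<and> (\<forall>y\<in>ball w ?r. f (q y) = y) \<and> q (f z) = z"
    proof (intro exI[of _ q] conjI)
      show "continuous_on (ball w ?r) q" using q(1) sub continuous_on_subset by blast
      show "\<forall>y\<in>ball w ?r. f (q y) = y" using q(4) sub by blast
      show "q ` ball w ?r \<subseteq> A"
      proof clarify
        fix y assume y: "y \<in> ball w ?r"
        then have "q y \<in> ball z \<kappa>" "f (q y) = y" using q sub by blast+
        then show "q y \<in> A" using b(2) rP y by (auto simp: A_def)
      qed
    qed (rule q(3))
  qed (rule rP)
qed

text \<open>The last application of \<open>f\<close> is lifted first; the lift maps into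
  \<open>A\<close>, so the induction hypothesis applies to it. The base point selects the branch
  that leads back to \<open>z\<close> along its own orbit.\<close>

lemma inverse_branch:
  assumes D: "open D" "convex D" "y\<^sub>0 \<in> D"
    and G: "G holomorphic_on D" "G ` D \<subseteq> - P"
    and orb: "\<And>k. (f ^^ k) z \<in> A" and base: "G y\<^sub>0 = (f ^^ n) z"
  shows "\<exists>g. g holomorphic_on D \<and> g ` D \<subseteq> - P \<and> g y\<^sub>0 = z \<and> (\<forall>y\<in>D. (f ^^ n) (g y) = G y)"
  using G base
proof (induction n arbitrary: G)
  case 0
  then show ?case by (intro exI[of _ G]) auto
next
  case (Suc n)
  have "simply_connected D" by (rule convex_imp_simply_connected[OF D(2)])
  moreover have "locally path_connected D" by (rule open_imp_locally_path_connected[OF D(1)])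
  moreover have "G y\<^sub>0 = f ((f ^^ n) z)" using Suc.prems by simp
  ultimately obtain g where g: "continuous_on D g" "g \<in> D \<rightarrow> A" "g y\<^sub>0 = (f ^^ n) z"
    "\<And>y. y \<in> D \<Longrightarrow> f (g y) = G y"
    using covering_space_lift_strong[OF covering_f orb[of n] D(3), of G]
      holomorphic_on_imp_continuous_on[OF Suc.prems(1)] Suc.prems(2) by (metis image_subset_iff_funcset)
  have gA: "g ` D \<subseteq> A" using g(2) by auto
  have "g holomorphic_on D"
    by (rule holomorphic_on_if_lift[OF holomorphic_on_A open_A deriv_f_nonzero_on_A Suc.prems(1) D(1) g(1) gA g(4)])
  then obtain g' where g': "g' holomorphic_on D" "g' ` D \<subseteq> - P" "g' y\<^sub>0 = z" "\<forall>y\<in>D. (f ^^ n) (g' y) = g y"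
    using Suc.IH[of g] gA A_subset g(3) by blast
  then show ?case using g(4) by (intro exI[of _ g']) auto
qed

section \<open>Density of the basin\<close>

text \<open>Poles lie in the closure and critical points in the basin, so \<open>f\<close> is open
  at \<open>z\<close> and maps a basin-free neighbourhood onto a neighbourhood of f z that is
  basin-free too.\<close>

lemma outside_closure_basin:
  assumes "z \<notin> closure basin"
  shows "z \<in> A" "f z \<notin> closure basin"
proof -
  have nb: "f z \<notin> basin" using assms closure_subset f_in_basin_iff by blast
  have dz: "dh x \<noteq> 0" if "x \<in> - closure basin" for x using that pole_in_closure_basin by blast
  show "z \<in> A" using nb P_subset_basin dz assms by (auto simp: A_def)
  have hz: "h z \<noteq> 0" using assms closure_subset zero_in_basin by blast
  have "f z \<in> interior (f ` (- closure basin))"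
    by (rule f_open_at[OF _ _ dz hz]) (use assms in auto)
  moreover have "f ` (- closure basin) \<subseteq> - basin" using closure_subset f_in_basin_iff by blast
  ultimately have "f z \<in> interior (- basin)" using interior_mono by blast
  then show "f z \<notin> closure basin" by (simp add: interior_complement)
qed

lemma orbit_outside_closure_basin:
  assumes "z \<notin> closure basin"
  shows "(f ^^ n) z \<notin> closure basin" "(f ^^ n) z \<in> A"
proof -
  show 1: "(f ^^ n) z \<notin> closure basin"
    by (induction n) (use assms outside_closure_basin in auto)
  then show "(f ^^ n) z \<in> A" by (rule outside_closure_basin)
qed

text \<open>From each point of \<open>P\<close> the basin extends by \<delta> towards
  \<open>w\<close>, so \<open>w\<close> is closer to the basin than to \<open>P\<close> by at least
  \<delta>.\<close>

lemma P_far_from_complement_of_basin: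
  assumes \<delta>: "\<delta> > 0" "\<forall>p\<in>P. ball p \<delta> \<subseteq> basin" and w: "w \<notin> basin"
  shows "ball w (infdist w basin + \<delta>) \<inter> P = {}"
proof -
  have False if p: "p \<in> P" "dist w p < infdist w basin + \<delta>" for p
  proof -
    let ?d = "infdist w basin"
    \<comment> \<open>The midpoint of dist w p - ?d and \<delta>: small enough for x to stay in the
      ball about p, and large enough for x to be nearer to \<open>w\<close> than ?d.\<close>
    define s where "s = (dist w p - ?d + \<delta>) / 2"
    have le: "?d \<le> dist w x" if "x \<in> basin" for x using that by (rule infdist_le)
    have d0: "?d \<le> dist w p" using p(1) P_subset_basin le by blast
    have s: "s > 0" "s < \<delta>" "dist w p - s < ?d" using p(2) d0 \<delta>(1) by (auto simp: s_def field_simps)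
    have wp: "dist w p \<ge> \<delta>" using \<delta>(2) p(1) w by (metis dist_commute mem_ball not_le subsetD)
    have "w \<noteq> p" using wp \<delta>(1) by auto
    define x where "x = p + of_real (s / dist w p) * (w - p)"
    have "dist p x = s" using s \<open>w \<noteq> p\<close> by (simp add: x_def dist_norm norm_mult norm_divide)
    then have "x \<in> ball p \<delta>" using s by simp
    then have "x \<in> basin" using \<delta>(2) p(1) by blast
    moreover have "dist w x = dist w p - s"
    proof -
      have "w - x = of_real (1 - s / dist w p) * (w - p)" by (simp add: x_def algebra_simps)
      then have "dist w x = \<bar>1 - s / dist w p\<bar> * dist w p" by (simp only: dist_norm norm_mult norm_of_real)
      also have "\<dots> = dist w p - s" using s wp \<open>w \<noteq> p\<close> by (simp add: field_simps)
      finally show ?thesis .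
    qed
    ultimately show False using le s by fastforce
  qed
  then show ?thesis by auto
qed

text \<open>Inverse branches of the iterates on translates of a fixed disc are normal since they omit
  \<open>P\<close>. A constant limit would make \<open>z\<close> a limit point of the basin. A nonconstant one
  makes the iterates map a fixed open set meeting the basin into a region away from \<open>P\<close>.\<close>

lemma no_inverse_branches_along_orbit:
  assumes z: "z \<notin> closure basin" and r: "\<And>j. j \<le> r j"
    and y: "\<And>j. y j \<in> ball 0 \<rho>" "y \<longlonglongrightarrow> y'" "y' \<in> ball 0 \<rho>"
    and yb: "\<And>j. (f ^^ r j) z + y j \<in> basin"
    and \<epsilon>: "\<epsilon> > 0" "\<And>j. ball ((f ^^ r j) z) (\<rho> + \<epsilon>) \<inter> P = {}"
  shows False
proof -
  let ?D = "ball (0::complex) \<rho>"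
  have D0: "0 \<in> ?D" using y(1)[of 0] by (auto intro: le_less_trans[OF norm_ge_zero])
  have "\<exists>g. g holomorphic_on ?D \<and> g ` ?D \<subseteq> - P \<and> g 0 = z \<and>
      (\<forall>y\<in>?D. (f ^^ r j) (g y) = (f ^^ r j) z + y)" for j
  proof (rule inverse_branch[OF open_ball convex_ball D0])
    show "(\<lambda>y. (f ^^ r j) z + y) holomorphic_on ?D" by (intro holomorphic_intros)
    show "(\<lambda>y. (f ^^ r j) z + y) ` ?D \<subseteq> - P"
    proof clarify
      fix u assume "u \<in> ?D" "(f ^^ r j) z + u \<in> P"
      then have "(f ^^ r j) z + u \<in> ball ((f ^^ r j) z) (\<rho> + \<epsilon>) \<inter> P" using \<epsilon>(1) by (simp add: dist_norm)
      then show False using \<epsilon>(2) by blast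
    qed
  qed (use orbit_outside_closure_basin[OF z] in auto)
  then obtain g where g: "\<And>j. g j holomorphic_on ?D" "\<And>j. g j ` ?D \<subseteq> - P" "\<And>j. g j 0 = z"
    "\<And>j u. u \<in> ?D \<Longrightarrow> (f ^^ r j) (g j u) = (f ^^ r j) z + u"
    by metis
  obtain M\<^sub>0 where M0: "M\<^sub>0 \<ge> 40" "\<forall>M\<ge>M\<^sub>0. \<exists>p. h p = 0 \<and> M / 2 \<le> norm (p - v) \<and> norm (p - v) \<le> 3 * M"
    by (rule zeros_of_every_large_size)
  then obtain p1 where p1: "h p1 = 0" by blast
  \<comment> \<open>Two zeros of \<open>h\<close> serve as omitted values, and \<open>k\<close>
    normalises them to 0 and 1. Taking \<open>p2\<close> far away gives |k j 0| <= 1, as the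
    Schottky-type bound requires.\<close>
  define M where "M = max M\<^sub>0 (2 * (norm (z - p1) + norm (p1 - v) + 1))"
  have "M\<^sub>0 \<le> M" by (simp add: M_def)
  then obtain p2 where p2: "h p2 = 0" "M / 2 \<le> norm (p2 - v)" using M0(2)[rule_format, OF \<open>M\<^sub>0 \<le> M\<close>] by blast
  have "norm (z - p1) + norm (p1 - v) + 1 \<le> M / 2" by (simp add: M_def)
  then have pp: "norm (z - p1) + 1 \<le> norm (p2 - p1)"
    using p2(2) norm_triangle_ineq[of "p2 - p1" "p1 - v"] by simp
  have ne: "p2 - p1 \<noteq> 0"
  proof
    assume "p2 - p1 = 0"
    then show False using pp norm_ge_zero[of "z - p1"] by simp
  qed
  define k where "k = (\<lambda>j u. (g j u - p1) / (p2 - p1))"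
  have bound: "\<exists>B. \<forall>h\<in>range g. \<forall>u\<in>K. norm (h u) \<le> B" if K: "compact K" "K \<subseteq> ?D" for K
  proof -
    have "\<exists>B. \<forall>k'\<in>range k. \<forall>u\<in>K. norm (k' u) \<le> B"
    proof (rule GPicard3[OF open_ball connected_ball D0 order_refl, of "range k" K])
      show "k' holomorphic_on ?D" if "k' \<in> range k" for k'
        using that g(1) ne by (auto simp: k_def intro!: holomorphic_intros)
      show "k' u \<noteq> 0 \<and> k' u \<noteq> 1" if "k' \<in> range k" "u \<in> ?D" for k' u
      proof -
        have "g j u \<notin> P" for j using g(2) that(2) by blast
        then have "g j u \<noteq> p1" "g j u \<noteq> p2" for j using p1 p2 by (auto simp: P_def)
        then show ?thesis using ne that(1) by (auto simp: k_def)
      qed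
      show "norm (k' 0) \<le> 1" if "k' \<in> range k" for k'
        using that pp ne by (auto simp: k_def g(3) norm_divide)
      show "\<exists>B. \<forall>k'\<in>range k. \<forall>u\<in>K. norm (k' u) \<le> B"
        if "\<And>k' u. k' \<in> range k \<Longrightarrow> u \<in> K \<Longrightarrow> norm (k' u) \<le> B" for B
        using that by blast
    qed (rule K)+
    then obtain B where B: "\<forall>k'\<in>range k. \<forall>u\<in>K. norm (k' u) \<le> B" ..
    have "norm (g j u) \<le> norm p1 + norm (p2 - p1) * B" if "u \<in> K" for j u
    proof -
      have "g j u = p1 + (p2 - p1) * k j u" using ne by (simp add: k_def)
      then have "norm (g j u) \<le> norm p1 + norm (p2 - p1) * norm (k j u)"
        by (metis norm_mult norm_triangle_ineq)
      also have "\<dots> \<le> norm p1 + norm (p2 - p1) * B"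
        using B that by (intro add_left_mono mult_left_mono) auto
      finally show ?thesis .
    qed
    then show ?thesis by (intro exI[of _ "norm p1 + norm (p2 - p1) * B"]) auto
  qed
  obtain G t where G: "G holomorphic_on ?D" "strict_mono (t :: nat \<Rightarrow> nat)"
    "\<And>u. u \<in> ?D \<Longrightarrow> (\<lambda>n. g (t n) u) \<longlonglongrightarrow> G u"
    "\<And>K. \<lbrakk>compact K; K \<subseteq> ?D\<rbrakk> \<Longrightarrow> uniform_limit K (g \<circ> t) G sequentially"
  proof (rule Montel[OF open_ball _ bound order_refl])
    show "h holomorphic_on ?D" if "h \<in> range g" for h using that g(1) by auto
  qed (assumption | rule that)+
  have "(\<lambda>n. z) \<longlonglongrightarrow> G 0" using G(3)[OF D0] by (simp add: g(3))
  then have G0: "G 0 = z" using LIMSEQ_unique tendsto_const by blast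
  \<comment> \<open>The branches are evaluated at moving points, so pointwise convergence is not
    enough: the points together with their limit form a compact set on which convergence is
    uniform.\<close>
  have limit: "(\<lambda>j. g (t j) (y (t j))) \<longlonglongrightarrow> G y'"
  proof -
    have yt: "(\<lambda>j. y (t j)) \<longlonglongrightarrow> y'" using LIMSEQ_subseq_LIMSEQ[OF y(2) G(2)] by (simp add: o_def)
    let ?K = "insert y' (range (\<lambda>j. y (t j)))"
    have K: "compact ?K" "?K \<subseteq> ?D" using compact_sequence_with_limit[OF yt] y by auto
    have "uniform_limit ?K (g \<circ> t) G sequentially" by (rule G(4)[OF K])
    then have "(\<lambda>j. g (t j) (y (t j)) - G (y (t j))) \<longlonglongrightarrow> 0"
      by (intro tendstoI) (auto simp: uniform_limit_iff dist_norm elim!: eventually_mono)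
    moreover have "isCont G y'"
      using holomorphic_on_imp_continuous_on[OF G(1)] y(3) continuous_on_eq_continuous_at[OF open_ball] by blast
    then have "(\<lambda>j. G (y (t j))) \<longlonglongrightarrow> G y'" using yt by (rule isCont_tendsto_compose)
    ultimately show ?thesis using tendsto_add by fastforce
  qed
  have cl: "G y' \<in> closure basin"
  proof (rule closed_sequentially[OF closed_closure _ limit])
    fix j
    have "(f ^^ r (t j)) (g (t j) (y (t j))) \<in> basin" using g(4)[OF y(1)] yb by simp
    then show "g (t j) (y (t j)) \<in> closure basin" using funpow_in_basin_iff closure_subset by blast
  qed
  have nonconst: "\<not> G constant_on ?D"
  proof
    assume "G constant_on ?D"
    then have "G y' = G 0" using y(3) D0 by (metis constant_on_def)
    then show False using cl G0 z by simp
  qed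
  have "open (G ` ?D)"
    by (rule open_mapping_thm[OF G(1) open_ball connected_ball open_ball order_refl nonconst])
  moreover have "G y' \<in> G ` ?D" using y(3) by blast
  ultimately have "G ` ?D \<inter> basin \<noteq> {}"
    using cl by (metis disjoint_iff open_Int_closure_eq_empty)
  then obtain t0 where t0: "t0 \<in> ?D" "G t0 \<in> basin" by blast
  then obtain p where p: "h p = 0" "(\<lambda>n. (f ^^ n) (G t0)) \<longlonglongrightarrow> p" by (auto simp: basin_def)
  then obtain N where N: "\<And>n. n \<ge> N \<Longrightarrow> dist ((f ^^ n) (G t0)) p < \<epsilon>"
    using \<epsilon>(1) by (meson LIMSEQ_def)
  \<comment> \<open>Hurwitz: the limit takes the value G t0, hence so does one of the branches. The
    shift by N keeps the number of iterates at least N.\<close>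
  have "\<exists>j. \<exists>u\<in>?D. g (t (j + N)) u - G t0 = 0"
  proof (rule ccontr)
    assume no: "\<not> ?thesis"
    have "G t0 - G t0 \<noteq> 0"
    proof (rule Hurwitz_no_zeros[of ?D "\<lambda>j u. g (t (j + N)) u - G t0" "\<lambda>u. G u - G t0"])
      show "(\<lambda>u. g (t (n + N)) u - G t0) holomorphic_on ?D" for n
        by (intro holomorphic_intros g(1))
      show "(\<lambda>u. G u - G t0) holomorphic_on ?D" by (intro holomorphic_intros G(1))
      show "uniform_limit K (\<lambda>j u. g (t (j + N)) u - G t0) (\<lambda>u. G u - G t0) sequentially"
        if "compact K" "K \<subseteq> ?D" for K
      proof (rule uniform_limit_intros)
        have "filterlim (\<lambda>j. j + N) sequentially sequentially" by (rule filterlim_add_const_nat_at_top)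
        then show "uniform_limit K (\<lambda>j u. g (t (j + N)) u) G sequentially"
          using filterlim_compose[OF G(4)[OF that]] by (simp add: o_def)
      qed (rule uniform_limit_const)
      show "\<not> (\<lambda>u. G u - G t0) constant_on ?D"
        using nonconst unfolding constant_on_def by (metis diff_add_cancel)
    qed (use no t0 in auto)
    then show False by simp
  qed
  then obtain j u where u: "u \<in> ?D" "g (t (j + N)) u = G t0" by auto
  let ?n = "r (t (j + N))"
  have "N \<le> t (j + N)" using seq_suble[OF G(2), of "j + N"] by linarith
  also have "\<dots> \<le> ?n" by (rule r)
  finally have "dist ((f ^^ ?n) (G t0)) p < \<epsilon>" by (rule N)
  \<comment> \<open>The iterate undoes the branch, so it sends G t0 into the disc about (f ^^ ?n) z.
    It also sends it within \<epsilon> of the zero p, which therefore comes too close to this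
    centre.\<close>
  then have "dist ((f ^^ ?n) z + u) p < \<epsilon>" using g(4)[OF u(1), of "t (j + N)"] u(2) by simp
  then have "dist ((f ^^ ?n) z) p < \<rho> + \<epsilon>"
    using dist_triangle[of "(f ^^ ?n) z" p "(f ^^ ?n) z + u"] u(1) by (simp add: dist_norm)
  then have "p \<in> ball ((f ^^ ?n) z) (\<rho> + \<epsilon>) \<inter> P" using p(1) by (auto simp: P_def)
  then show False using \<epsilon>(2) by blast
qed

lemma basin_dense: "closure basin = UNIV"
proof (rule ccontr)
  assume "closure basin \<noteq> UNIV"
  then obtain z where z: "z \<notin> closure basin" by blast
  define w where "w = (\<lambda>n. (f ^^ n) z)"
  define d where "d = (\<lambda>n. infdist (w n) basin)"
  have wcl: "w n \<notin> closure basin" for n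
    unfolding w_def by (rule orbit_outside_closure_basin[OF z])
  then have wb: "w n \<notin> basin" for n using closure_subset by blast
  have d0: "d n \<ge> 0" for n by (simp add: d_def infdist_nonneg)
  have bne: "basin \<noteq> {}" using v_basin by blast
  obtain \<delta> where \<delta>: "\<delta> > 0" "\<forall>p\<in>P. ball p \<delta> \<subseteq> basin" by (rule uniform_ball_around_P)
  obtain R where R: "\<forall>w. (\<forall>n. w (Suc n) = f (w n)) \<longrightarrow>
    \<not> (\<forall>n. ball (w n) R \<inter> basin = {} \<and> (\<forall>z\<in>ball (w n) R. dh z \<noteq> 0))"
    using large_discs_along_orbit_impossible[OF v_basin] by blast
  have "\<exists>n\<ge>N. d n \<le> R" for N
  proof -
    \<comment> \<open>Every tail of the orbit is again an orbit. A disc containing a pole meets the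
      basin as well, since poles lie in its closure.\<close>
    have "\<forall>n. w (Suc n + N) = f (w (n + N))" by (simp add: w_def)
    then have "\<exists>n. ball (w (n + N)) R \<inter> basin \<noteq> {} \<or> (\<exists>z\<in>ball (w (n + N)) R. dh z = 0)"
      using R[rule_format, of "\<lambda>n. w (n + N)"] by auto
    then obtain n where "ball (w (n + N)) R \<inter> closure basin \<noteq> {}"
      using pole_in_closure_basin closure_subset by blast
    then have "ball (w (n + N)) R \<inter> basin \<noteq> {}"
      by (simp add: open_Int_closure_eq_empty)
    then obtain x where x: "x \<in> basin" "dist (w (n + N)) x < R" by auto
    have "d (n + N) \<le> R" using infdist_le[OF x(1), of "w (n + N)"] x(2) by (simp add: d_def)
    then show ?thesis by (intro exI[of _ "n + N"]) auto
  qed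
  then have "infinite {n. d n \<le> R}" by (auto simp: infinite_nat_iff_unbounded_le)
  then obtain s :: "nat \<Rightarrow> nat" where s: "strict_mono s" "\<And>j. d (s j) \<le> R"
    using infinite_enumerate by blast
  have "\<exists>q\<in>basin. dist (w n) q < d n + \<delta> / 4" for n
  proof -
    have "(INF a\<in>basin. dist (w n) a) < d n + \<delta> / 4"
      using \<delta>(1) infdist_notempty[OF bne, of "w n"] by (simp add: d_def)
    then show ?thesis using cINF_less_iff[OF bne, of "dist (w n)"] by (auto intro: bdd_belowI2[of _ 0])
  qed
  then obtain q where q: "\<And>n. q n \<in> basin" "\<And>n. dist (w n) (q n) < d n + \<delta> / 4" by metis
  \<comment> \<open>Pairing distances with displacements yields one subsequence along which both
    converge.\<close>
  define x where "x = (\<lambda>j. (d (s j), q (s j) - w (s j)))"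
  have "compact ({0..R} \<times> cball (0::complex) (R + \<delta>))" by (intro compact_Times compact_cball compact_Icc)
  moreover have "\<forall>j. x j \<in> {0..R} \<times> cball 0 (R + \<delta>)"
  proof
    fix j
    have "norm (q (s j) - w (s j)) \<le> R + \<delta>"
      using q(2)[of "s j"] s(2)[of j] \<delta>(1) by (simp add: dist_norm norm_minus_commute)
    then show "x j \<in> {0..R} \<times> cball 0 (R + \<delta>)" using d0 s(2) by (simp add: x_def)
  qed
  ultimately obtain l a where a: "strict_mono (a :: nat \<Rightarrow> nat)" "(x \<circ> a) \<longlonglongrightarrow> l"
    unfolding compact_def by metis
  define d' where "d' = fst l"
  define y' where "y' = snd l"
  have dl: "(\<lambda>j. d (s (a j))) \<longlonglongrightarrow> d'"
    using tendsto_fst[OF a(2)] by (simp add: x_def o_def d'_def)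
  have yl: "(\<lambda>j. q (s (a j)) - w (s (a j))) \<longlonglongrightarrow> y'"
    using tendsto_snd[OF a(2)] by (simp add: x_def o_def y'_def)
  obtain N where N: "\<And>j. j \<ge> N \<Longrightarrow> \<bar>d (s (a j)) - d'\<bar> < \<delta> / 8"
    using dl \<delta>(1) unfolding LIMSEQ_def dist_real_def by (meson divide_pos_pos zero_less_numeral)
  define r where "r = (\<lambda>j. s (a (j + N)))"
  define y where "y = (\<lambda>j. q (r j) - w (r j))"
  have dr: "\<bar>d (r j) - d'\<bar> < \<delta> / 8" for j using N[of "j + N"] by (simp add: r_def)
  have yn: "norm (y j) \<le> d' + 3 * \<delta> / 8" for j
    using q(2)[of "r j"] dr[of j] unfolding y_def dist_norm norm_minus_commute[of "w (r j)"] by linarith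
  have ylim: "y \<longlonglongrightarrow> y'"
    unfolding y_def r_def using LIMSEQ_ignore_initial_segment[OF yl, of N] .
  have y'n: "norm y' \<le> d' + 3 * \<delta> / 8"
    by (rule LIMSEQ_le_const2[OF tendsto_norm[OF ylim]]) (use yn in auto)
  show False
  \<comment> \<open>The radius d' + \<delta>/2 exceeds the bound d' + 3 \<delta>/8 for the
    displacements. With the margin \<delta>/4 it is still below d (r j) + 7 \<delta>/8, so
    \<open>P\<close> is avoided.\<close>
  proof (rule no_inverse_branches_along_orbit[OF z, of r y "d' + \<delta> / 2" y' "\<delta> / 4"])
    show "j \<le> r j" for j
    proof -
      have "j \<le> j + N" by simp
      also have "\<dots> \<le> a (j + N)" by (rule seq_suble[OF a(1)])
      also have "\<dots> \<le> s (a (j + N))" by (rule seq_suble[OF s(1)])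
      finally show ?thesis by (simp add: r_def)
    qed
    show "y j \<in> ball 0 (d' + \<delta> / 2)" for j using yn[of j] \<delta>(1) by simp
    show "y' \<in> ball 0 (d' + \<delta> / 2)" using y'n \<delta>(1) by simp
    show "(f ^^ r j) z + y j \<in> basin" for j using q(1) by (simp add: y_def w_def)
    show "ball ((f ^^ r j) z) (d' + \<delta> / 2 + \<delta> / 4) \<inter> P = {}" for j
    proof -
      have "ball (w (r j)) (d' + \<delta> / 2 + \<delta> / 4) \<subseteq> ball (w (r j)) (d (r j) + \<delta>)"
        using dr[of j] by (intro subset_ball) linarith
      moreover have "ball (w (r j)) (d (r j) + \<delta>) \<inter> P = {}"
        unfolding d_def by (rule P_far_from_complement_of_basin[OF \<delta> wb])
      ultimately show ?thesis unfolding w_def by blast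
    qed
  qed (use ylim \<delta>(1) in auto)
qed

end

section \<open>Fatou components\<close>

lemma iterate_shift: "F x = Cpx y \<Longrightarrow> iterate F n y = iterate F (Suc n) x"
  by (induction n) auto

lemma isCont_Cpx: "isCont Cpx z"
proof -
  have pos: "(norm x)\<^sup>2 + 1 \<noteq> 0" for x :: complex
    using add_nonneg_pos[OF zero_le_power2[of "norm x"] zero_less_one] by simp
  have "isCont (\<lambda>x. stereographic (Cpx x)) z"
    unfolding stereographic.simps by (intro continuous_intros pos)
  then show ?thesis
    unfolding isCont_def tendsto_iff dist_riemann_sphere_def .
qed

lemma fatou_set_defined:
  assumes "z \<in> fatou_set F"
  shows "iterate F n z \<noteq> Infty"
  using assms by (auto simp: fatou_set_def iterate_defined_def)

lemma open_fatou_set: "open (fatou_set F)"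
proof -
  have "\<exists>T. open T \<and> z \<in> T \<and> T \<subseteq> fatou_set F" if z: "z \<in> fatou_set F" for z
  proof -
    obtain V where "open V" "z \<in> V" "\<forall>n>0. \<forall>w\<in>V. iterate_defined F n w"
      "normal_family V {iterate F n |n. n > 0}"
      using z by (auto simp: fatou_set_def)
    then show ?thesis by (intro exI[of _ V]) (auto simp: fatou_set_def)
  qed
  then show ?thesis by (subst open_subopen) blast
qed

section \<open>The Newton map as a map into the sphere\<close>

context newton_exp
begin

abbreviation N :: "complex \<Rightarrow> riemann_sphere" where "N \<equiv> meromorphic_map f"

lemma is_pole_f:
  assumes "dh z = 0" "h z \<noteq> 0"
  shows "is_pole f z"
proof -
  define num where "num = (\<lambda>x. x * dh x - h x)"
  have "((\<lambda>x. (dh x - dh z) / (x - z)) \<longlongrightarrow> exp z) (at z)"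
    using has_derivative_dh[of z] by (simp add: has_field_derivative_iff)
  then have "\<forall>\<^sub>F x in at z. (dh x - dh z) / (x - z) \<noteq> 0"
    by (rule tendsto_imp_eventually_ne) simp
  then have nz: "\<forall>\<^sub>F x in at z. dh x \<noteq> 0"
    by (rule eventually_mono) (use assms(1) in auto)
  have "is_pole (\<lambda>x. num x / dh x) z"
  proof (rule is_pole_divide)
    show "isCont num z" unfolding num_def dh_def h_def by (intro continuous_intros)
    show "num z \<noteq> 0" using assms by (simp add: num_def)
    have "isCont dh z" unfolding dh_def by (intro continuous_intros)
    then have "(dh \<longlongrightarrow> 0) (at z)" using assms(1) unfolding isCont_def by simp
    then show "filterlim dh (at 0) (at z)" using nz by (rule filterlim_atI)
  qed
  moreover have "\<forall>\<^sub>F x in at z. num x / dh x = f x"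
    using nz by (rule eventually_mono) (simp add: num_def f_def diff_divide_distrib)
  ultimately show ?thesis using is_pole_cong[OF _ refl] by metis
qed

text \<open>A double zero of \<open>h\<close> is a removable singularity at which \<open>f\<close>
  already has the limit value, so the two maps differ exactly at the poles.\<close>

lemma N_eq: "N z = (if dh z \<noteq> 0 \<or> h z = 0 then Cpx (f z) else Infty)"
proof (cases "dh z \<noteq> 0 \<or> h z = 0")
  case True
  then have lim: "f \<midarrow>z\<rightarrow> f z" using isCont_f isContD by blast
  then have "\<not> is_pole f z"
    unfolding is_pole_def by (metis not_tendsto_and_filterlim_at_infinity trivial_limit_at)
  then show ?thesis using True remove_sings_eqI[OF lim] by (simp add: meromorphic_map_def)
next
  case False
  then show ?thesis using is_pole_f by (simp add: meromorphic_map_def)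
qed

lemma iterate_N:
  assumes "\<And>n. iterate N n z \<noteq> Infty"
  shows "iterate N n z = Cpx ((f ^^ n) z)" "dh ((f ^^ n) z) \<noteq> 0 \<or> h ((f ^^ n) z) = 0"
proof -
  have good: "dh ((f ^^ n) z) \<noteq> 0 \<or> h ((f ^^ n) z) = 0" if "iterate N n z = Cpx ((f ^^ n) z)" for n
    using assms[of "Suc n"] that by (auto simp: N_eq split: if_splits)
  show *: "iterate N n z = Cpx ((f ^^ n) z)" for n
  proof (induction n)
    case (Suc n)
    then show ?case using good[OF Suc] by (auto simp: N_eq)
  qed simp
  show "dh ((f ^^ n) z) \<noteq> 0 \<or> h ((f ^^ n) z) = 0" by (rule good[OF *])
qed

lemma iterate_N_basin:
  assumes "z \<in> basin"
  shows "iterate N n z = Cpx ((f ^^ n) z)"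
proof (induction n)
  case (Suc n)
  have "(f ^^ n) z \<in> basin" using assms by (simp add: funpow_in_basin_iff)
  then show ?case using Suc dh_zero_imp_not_in_basin[of "(f ^^ n) z"] by (auto simp: N_eq)
qed simp

lemma isCont_f_fatou:
  assumes "z \<in> fatou_set N"
  shows "isCont f z"
  using iterate_N(2)[of z 0] fatou_set_defined[OF assms] isCont_f by simp

text \<open>Iterates of order n near f z are iterates of order n + 1 near z, read through preimages
  under \<open>f\<close>. This works where \<open>f\<close> is open; at a zero of \<open>h\<close>
  the point is fixed.\<close>

lemma f_in_fatou_set:
  assumes z: "z \<in> fatou_set N"
  shows "f z \<in> fatou_set N"
proof (cases "h z = 0")
  case True
  then show ?thesis using z by (simp add: f_fixed)
next
  case False
  obtain V where V: "open V" "z \<in> V" "\<forall>n>0. \<forall>w\<in>V. iterate_defined N n w"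
    "normal_family V {iterate N n |n. n > 0}"
    using z by (auto simp: fatou_set_def)
  have Vdef: "iterate N n w \<noteq> Infty" if "w \<in> V" for n w
    using V(3) that by (auto simp: iterate_defined_def)
  have NV: "N w = Cpx (f w)" if "w \<in> V" for w
    using iterate_N(1)[of w 1] Vdef[OF that] by simp
  have dz: "dh z \<noteq> 0" using iterate_N(2)[of z 0] Vdef[OF V(2)] False by simp
  have "open (V \<inter> {z. dh z \<noteq> 0})" "z \<in> V \<inter> {z. dh z \<noteq> 0}"
    using V(1,2) open_dh_nonzero dz by auto
  then obtain e where e: "e > 0" "cball z e \<subseteq> V \<inter> {z. dh z \<noteq> 0}"
    unfolding open_contains_cball by blast
  define V' where "V' = interior (f ` ball z e)"
  \<comment> \<open>An arbitrary choice of preimages in the disc is enough: uniform convergence on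
    the compact \<open>cball z e\<close> carries over to all of \<open>V'\<close> at once, with
    limit g (pre w).\<close>
  define pre where "pre = (\<lambda>w. SOME x. x \<in> ball z e \<and> f x = w)"
  have pre: "pre w \<in> ball z e \<and> f (pre w) = w" if "w \<in> V'" for w
  proof -
    have "w \<in> f ` ball z e" using that interior_subset unfolding V'_def by blast
    then have "\<exists>x. x \<in> ball z e \<and> f x = w" by blast
    then show ?thesis unfolding pre_def by (rule someI_ex)
  qed
  have shift: "iterate N n w = iterate N (Suc n) (pre w)" if "w \<in> V'" for n w
  proof -
    have "pre w \<in> V" using pre[OF that] e(2) by auto
    then show ?thesis using iterate_shift[of N "pre w" w n] NV[of "pre w"] pre[OF that] by simp
  qed
  have "open V'" by (simp add: V'_def)
  moreover have "f z \<in> V'"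
    unfolding V'_def
  proof (rule f_open_at)
    show "dh x \<noteq> 0" if "x \<in> ball z e" for x
    proof -
      have "x \<in> cball z e" using that by simp
      then show ?thesis using e(2) by blast
    qed
  qed (use e(1) False in auto)
  moreover have "iterate_defined N n w" if "w \<in> V'" for n w
  proof -
    have "pre w \<in> V" using pre[OF that] e(2) by auto
    then show ?thesis unfolding iterate_defined_def shift[OF that] using Vdef by blast
  qed
  moreover have "normal_family V' {iterate N n |n. n > 0}"
    unfolding normal_family_def
  proof (intro allI impI)
    fix \<phi> :: "nat \<Rightarrow> complex \<Rightarrow> riemann_sphere"
    assume "range \<phi> \<subseteq> {iterate N n |n. n > 0}"
    then have "\<forall>k. \<exists>n. \<phi> k = iterate N n" by blast
    then obtain n where n: "\<And>k. \<phi> k = iterate N (n k)" by metis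
    have "range (\<lambda>k. iterate N (Suc (n k))) \<subseteq> {iterate N n |n. n > 0}" by blast
    then obtain r g where r: "strict_mono r"
      "\<forall>K. compact K \<and> K \<subseteq> V \<longrightarrow> uniform_limit K (\<lambda>k. iterate N (Suc (n (r k)))) g sequentially"
      using V(4) unfolding normal_family_def by blast
    have "compact (cball z e)" "cball z e \<subseteq> V" using e(2) by auto
    then have lim: "uniform_limit (cball z e) (\<lambda>k. iterate N (Suc (n (r k)))) g sequentially"
      using r(2) by blast
    have "uniform_limit K (\<lambda>k. \<phi> (r k)) (\<lambda>w. g (pre w)) sequentially" if "K \<subseteq> V'" for K
    proof (rule uniform_limitI)
      fix \<epsilon> :: real assume "\<epsilon> > 0"
      then have "\<forall>\<^sub>F k in sequentially. \<forall>x\<in>cball z e. dist (iterate N (Suc (n (r k))) x) (g x) < \<epsilon>"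
        by (rule uniform_limitD[OF lim])
      then show "\<forall>\<^sub>F k in sequentially. \<forall>w\<in>K. dist (\<phi> (r k) w) (g (pre w)) < \<epsilon>"
      proof (rule eventually_mono, intro ballI)
        fix k w assume k: "\<forall>x\<in>cball z e. dist (iterate N (Suc (n (r k))) x) (g x) < \<epsilon>" and "w \<in> K"
        then have w: "w \<in> V'" using \<open>K \<subseteq> V'\<close> by blast
        then have "pre w \<in> cball z e" using pre[OF w] by auto
        then show "dist (\<phi> (r k) w) (g (pre w)) < \<epsilon>" unfolding n shift[OF w] using k by blast
      qed
    qed
    then show "\<exists>r g. strict_mono r \<and>
        (\<forall>K. compact K \<and> K \<subseteq> V' \<longrightarrow> uniform_limit K (\<lambda>n. \<phi> (r n)) g sequentially)"
      using r(1) by blast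
  qed
  ultimately show ?thesis unfolding fatou_set_def by blast
qed

lemma funpow_fatou_set:
  "continuous_on (fatou_set N) (f ^^ n)" "(f ^^ n) ` fatou_set N \<subseteq> fatou_set N"
proof -
  have "continuous_on (fatou_set N) (f ^^ n) \<and> (f ^^ n) ` fatou_set N \<subseteq> fatou_set N"
  proof (induction n)
    case (Suc n)
      have "continuous_on (fatou_set N) f"
      by (intro continuous_at_imp_continuous_on ballI isCont_f_fatou)
    then have "continuous_on (fatou_set N) (f \<circ> (f ^^ n))"
      using Suc by (intro continuous_on_compose) (auto intro: continuous_on_subset)
    then show ?case using Suc f_in_fatou_set by auto
  qed (simp add: id_def)
  then show "continuous_on (fatou_set N) (f ^^ n)" "(f ^^ n) ` fatou_set N \<subseteq> fatou_set N" by auto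
qed

lemma ball_subset_fatou_set:
  assumes p: "h p = 0" and con: "\<And>z. z \<in> ball p \<delta> \<Longrightarrow> norm (f z - p) \<le> 3 / 4 * norm (z - p)"
  shows "ball p \<delta> \<subseteq> fatou_set N"
proof
  fix z\<^sub>0 assume z0: "z\<^sub>0 \<in> ball p \<delta>"
  have it: "iterate N n z = Cpx ((f ^^ n) z)" if "z \<in> ball p \<delta>" for n z
    using ball_subset_basin[OF p con] that iterate_N_basin by blast
  have "normal_family (ball p \<delta>) {iterate N n |n. n > 0}"
    unfolding normal_family_def
  proof (intro allI impI)
    fix \<phi> :: "nat \<Rightarrow> complex \<Rightarrow> riemann_sphere"
    assume "range \<phi> \<subseteq> {iterate N n |n. n > 0}"
    then have "\<forall>k. \<exists>n. \<phi> k = iterate N n" by blast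
    then obtain n where n: "\<And>k. \<phi> k = iterate N (n k)" by metis
    show "\<exists>r g. strict_mono r \<and>
        (\<forall>K. compact K \<and> K \<subseteq> ball p \<delta> \<longrightarrow> uniform_limit K (\<lambda>n. \<phi> (r n)) g sequentially)"
    \<comment> \<open>Either one exponent occurs infinitely often, giving a constant subsequence, or
      the exponents tend to infinity and the whole sequence tends to \<open>p\<close> uniformly on
      the ball.\<close>
    proof (cases "\<exists>m. infinite {k. n k = m}")
      case True
      then obtain m where "infinite {k. n k = m}" by blast
      then obtain r :: "nat \<Rightarrow> nat" where r: "strict_mono r" "\<And>k. n (r k) = m"
        using infinite_enumerate[of "{k. n k = m}"] by auto
      have "uniform_limit K (\<lambda>k. \<phi> (r k)) (iterate N m) sequentially" for K
        unfolding n r(2) by (rule uniform_limit_const)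
      then show ?thesis using r(1) by blast
    next
      case False
      have large: "\<forall>\<^sub>F k in sequentially. M \<le> n k" for M
      proof -
        have "{k. n k < M} = (\<Union>m<M. {k. n k = m})" by auto
        then have "finite {k. n k < M}" using False by simp
        then show ?thesis
          by (simp add: cofinite_eq_sequentially[symmetric] eventually_cofinite not_le)
      qed
      have "uniform_limit (ball p \<delta>) \<phi> (\<lambda>z. Cpx p) sequentially"
      proof (rule uniform_limitI)
        fix \<epsilon> :: real assume "\<epsilon> > 0"
        then obtain d where d: "d > 0" "\<forall>x. dist x p < d \<longrightarrow> dist (Cpx x) (Cpx p) < \<epsilon>"
          using isCont_Cpx[of p] unfolding continuous_at_eps_delta by blast
        have "(\<lambda>m. (3/4) ^ m * \<delta>) \<longlonglongrightarrow> 0" by (intro tendsto_mult_left_zero LIMSEQ_power_zero) auto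
        then have "\<forall>\<^sub>F m in sequentially. (3/4) ^ m * \<delta> < d" using d(1) by (rule order_tendstoD(2))
        then obtain M where M: "\<forall>m\<ge>M. (3/4) ^ m * \<delta> < d" unfolding eventually_sequentially by blast
        show "\<forall>\<^sub>F k in sequentially. \<forall>z\<in>ball p \<delta>. dist (\<phi> k z) (Cpx p) < \<epsilon>"
        proof (rule eventually_mono[OF large[of M]], intro ballI)
          fix k z assume k: "M \<le> n k" and z: "z \<in> ball p \<delta>"
          have "norm ((f ^^ n k) z - p) \<le> (3/4) ^ n k * norm (z - p)"
            by (rule contraction_imp_convergent(1)[OF con z])
          also have "\<dots> \<le> (3/4) ^ n k * \<delta>"
            using z by (intro mult_left_mono) (auto simp: dist_norm norm_minus_commute)
          also have "\<dots> < d" using M k by blast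
          finally show "dist (\<phi> k z) (Cpx p) < \<epsilon>" unfolding n it[OF z] using d(2) by (simp add: dist_norm)
        qed
      qed
      then have "uniform_limit K \<phi> (\<lambda>z. Cpx p) sequentially" if "K \<subseteq> ball p \<delta>" for K
        using uniform_limit_on_subset that by blast
      then show ?thesis
        by (intro exI[of _ "\<lambda>k. k"] exI[of _ "\<lambda>z. Cpx p"]) (auto simp: strict_mono_def)
    qed
  qed
  moreover have "\<forall>n>0. \<forall>w\<in>ball p \<delta>. iterate_defined N n w"
    using it by (auto simp: iterate_defined_def)
  ultimately show "z\<^sub>0 \<in> fatou_set N" using z0 open_ball unfolding fatou_set_def by blast
qed

lemma not_wandering_if_meets_basin:
  assumes U: "fatou_component N U" and y: "y \<in> U" "y \<in> basin"
  shows "\<not> wandering_domain N U"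
proof
  assume W: "wandering_domain N U"
  have U': "U \<in> components (fatou_set N)" using U by (simp add: fatou_component_def)
  have Usub: "U \<subseteq> fatou_set N" "connected U"
    using in_components_subset[OF U'] in_components_connected[OF U'] by auto
  obtain \<delta> where \<delta>: "\<delta> > 0"
    "\<forall>p z. h p = 0 \<longrightarrow> z \<in> ball p \<delta> \<longrightarrow> norm (f z - p) \<le> 3 / 4 * norm (z - p)"
    using f_uniformly_contracts_near_zeros by blast
  obtain p where p: "h p = 0" "(\<lambda>n. (f ^^ n) y) \<longlonglongrightarrow> p" using y(2) by (auto simp: basin_def)
  have con: "norm (f z - p) \<le> 3 / 4 * norm (z - p)" if "z \<in> ball p \<delta>" for z using \<delta>(2) p(1) that by blast
  have sub: "ball p \<delta> \<subseteq> fatou_set N" by (rule ball_subset_fatou_set[OF p(1) con])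
  have "\<forall>\<^sub>F n in sequentially. (f ^^ n) y \<in> ball p \<delta>"
    using p(2) \<delta>(1) by (intro topological_tendstoD) auto
  \<comment> \<open>The orbit stays in the disc from time m on, so the indices m and m + 1 lead to
    the same component.\<close>
  then obtain m where m: "\<forall>n\<ge>m. (f ^^ n) y \<in> ball p \<delta>" unfolding eventually_sequentially by blast
  define C where "C = connected_component_set (fatou_set N) p"
  have "p \<in> fatou_set N" using sub \<delta>(1) by auto
  then have C: "C \<in> components (fatou_set N)" unfolding C_def by (simp add: componentsI)
  have ballC: "ball p \<delta> \<subseteq> C"
    unfolding C_def by (rule connected_component_maximal[OF _ connected_ball sub]) (use \<delta>(1) in simp)
  have img: "component_image N U n C" if "n \<ge> m" for n
  proof -
    have "(f ^^ n) ` U \<subseteq> C"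
    proof (rule components_maximal[OF C])
      show "connected ((f ^^ n) ` U)"
        by (rule connected_continuous_image[OF continuous_on_subset[OF funpow_fatou_set(1) Usub(1)] Usub(2)])
      show "(f ^^ n) ` U \<subseteq> fatou_set N" using Usub(1) funpow_fatou_set(2) by blast
      show "C \<inter> (f ^^ n) ` U \<noteq> {}" using m that ballC y(1) by blast
    qed
    moreover have "iterate N n z = Cpx ((f ^^ n) z)" if "z \<in> U" for z
    proof -
      have "z \<in> fatou_set N" using that Usub(1) by blast
      then show ?thesis using fatou_set_defined by (intro iterate_N(1)) blast
    qed
    ultimately show ?thesis using C by (auto simp: component_image_def fatou_component_def)
  qed
  have "component_image N U m C" "component_image N U (Suc m) C" using img by auto
  moreover have "m \<noteq> Suc m" by simp
  ultimately show False using W unfolding wandering_domain_def by blast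
qed

end

lemma (in newton_exp_asymptotic) no_wandering_domain: "\<not> wandering_domain N U"
proof
  assume W: "wandering_domain N U"
  then have U: "fatou_component N U" by (simp add: wandering_domain_def)
  then have U': "U \<in> components (fatou_set N)" by (simp add: fatou_component_def)
  have "open U" "U \<noteq> {}"
    using open_components[OF open_fatou_set U'] in_components_nonempty[OF U'] by auto
  then have "U \<inter> basin \<noteq> {}" using basin_dense open_Int_closure_eq_empty[of U basin] by auto
  then obtain y where "y \<in> U" "y \<in> basin" by blast
  then show False using not_wandering_if_meets_basin[OF U] W by blast
qed

section \<open>Existence of a real zero and the conclusion\<close>

lemma exp_plus_linear_has_zero_iff:
  fixes \<alpha> \<beta> :: real
  assumes "\<beta> \<noteq> 0"
  shows "(\<exists>x. exp x + \<beta> * x + \<alpha> = 0) \<longleftrightarrow> \<beta> > 0 \<or> (\<beta> < 0 \<and> \<alpha> \<le> \<beta> * (1 - ln (- \<beta>)))"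
proof -
  define H where "H = (\<lambda>x. exp x + \<beta> * x + \<alpha>)"
  have cont: "continuous_on S H" for S unfolding H_def by (intro continuous_intros)
  have between: "\<exists>x. H x = 0" if "H x \<le> 0" "0 \<le> H y" for x y
    using that IVT'[of H x 0 y] IVT2'[of H x 0 y] cont by (cases "x \<le> y") (auto simp: less_imp_le not_le)
  show ?thesis
  proof (cases "\<beta> > 0")
    case True
    \<comment> \<open>At this negative argument the exponential is at most 1 and the affine part at
      most -1.\<close>
    have "H (- (\<bar>\<alpha>\<bar> + 1) / \<beta>) \<le> 0"
    proof -
      have "- (\<bar>\<alpha>\<bar> + 1) / \<beta> \<le> 0" using True by (intro divide_nonpos_pos) auto
      then have "exp (- (\<bar>\<alpha>\<bar> + 1) / \<beta>) \<le> 1" by simp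
      moreover have "\<beta> * (- (\<bar>\<alpha>\<bar> + 1) / \<beta>) = - (\<bar>\<alpha>\<bar> + 1)" using True by simp
      ultimately show ?thesis unfolding H_def by linarith
    qed
    moreover have "0 \<le> H (\<bar>\<alpha>\<bar> / \<beta>)"
    proof -
      have "\<beta> * (\<bar>\<alpha>\<bar> / \<beta>) = \<bar>\<alpha>\<bar>" using True by simp
      then have "H (\<bar>\<alpha>\<bar> / \<beta>) = exp (\<bar>\<alpha>\<bar> / \<beta>) + (\<bar>\<alpha>\<bar> + \<alpha>)" by (simp only: H_def add.assoc)
      moreover have "0 \<le> \<bar>\<alpha>\<bar> + \<alpha>" by linarith
      ultimately show ?thesis by (simp add: add_nonneg_nonneg)
    qed
    ultimately show ?thesis using between True unfolding H_def by blast
  next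
    case False
    then have neg: "\<beta> < 0" using assms by simp
    define l where "l = ln (- \<beta>)"
    have el: "exp l = - \<beta>" using neg by (simp add: l_def)
    \<comment> \<open>At \<open>l\<close> the derivative vanishes, so convexity makes H l = \<alpha>
      - \<beta> (1 - l) the minimum, and its sign decides.\<close>
    have min: "H l \<le> H x" for x
    proof -
      have "exp l * (1 + (x - l)) \<le> exp l * exp (x - l)" by (intro mult_left_mono) auto
      also have "\<dots> = exp x" by (simp flip: exp_add)
      finally show ?thesis by (simp add: H_def el algebra_simps)
    qed
    have "H l \<le> 0 \<longleftrightarrow> \<alpha> \<le> \<beta> * (1 - l)" by (simp add: H_def el algebra_simps)
    moreover have "0 \<le> H (- \<alpha> / \<beta>)" using neg by (simp add: H_def)
    moreover have "(\<exists>x. H x = 0) \<longleftrightarrow> H l \<le> 0" using between[of l "- \<alpha> / \<beta>"] min \<open>0 \<le> H (- \<alpha> / \<beta>)\<close> by metis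
    ultimately have "(\<exists>x. H x = 0) \<longleftrightarrow> \<alpha> \<le> \<beta> * (1 - l)" by simp
    then show ?thesis using neg by (simp add: H_def l_def)
  qed
qed

theorem corollaryE:
  fixes a b c \<alpha> \<beta> :: real and h :: "complex \<Rightarrow> complex"
  assumes "a \<noteq> 0" and "b \<noteq> 0"
    and "h = (\<lambda>z. of_real a * exp z + of_real b * z + of_real c)"
    and "\<alpha> = c / a" and "\<beta> = b / a"
  shows "((\<exists>x::real. h (of_real x) = 0) \<longrightarrow> \<not> (\<exists>U. wandering_domain (newton_map h) U)) \<and>
    ((\<exists>x::real. h (of_real x) = 0) \<longleftrightarrow>
       a * b > 0 \<or> (a * b < 0 \<and> c / b \<ge> 1 - ln (- b / a))) \<and>
    ((\<exists>x::real. h (of_real x) = 0) \<longleftrightarrow>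
       \<beta> > 0 \<or> (\<beta> < 0 \<and> \<alpha> \<le> \<beta> * (1 - ln (- \<beta>))))"
proof -
  interpret E: newton_exp \<alpha> \<beta> by unfold_locales (use assms in simp)
  have "of_real b = (of_real a * of_real \<beta> :: complex)" "of_real c = (of_real a * of_real \<alpha> :: complex)"
    unfolding of_real_mult[symmetric] using assms by simp_all
  then have h: "h z = of_real a * E.h z" for z
    by (simp add: assms(3) E.h_def algebra_simps)
  have "(h has_field_derivative of_real a * E.dh z) (at z)" for z
    unfolding h by (intro DERIV_cmult E.has_derivative_h)
  then have dh: "deriv h z = of_real a * E.dh z" for z by (rule DERIV_imp_deriv)
  \<comment> \<open>The factor \<open>a\<close> cancels in the quotient. At zeros of the derivative
    both sides are z by division by zero, so the total functions agree everywhere.\<close>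
  have newton: "newton_map h = meromorphic_map E.f"
  proof -
    have "z - h z / deriv h z = E.f z" for z using assms(1) by (simp add: h dh E.f_def)
    then show ?thesis unfolding newton_map_def by simp
  qed
  have zero: "h (of_real x) = 0 \<longleftrightarrow> exp x + \<beta> * x + \<alpha> = 0" for x
  proof -
    have "h (of_real x) = of_real a * of_real (exp x + \<beta> * x + \<alpha>)"
      by (simp add: h E.h_def exp_of_real)
    then show ?thesis using assms(1) by (metis mult_eq_0_iff of_real_eq_0_iff)
  qed
  have "\<not> wandering_domain (newton_map h) U" if x: "h (of_real x) = 0" for x U
  proof -
    have "E.v \<in> E.basin" by (rule E.v_in_basin[of x]) (use x h[of "of_real x"] assms(1) in simp)
    then interpret A: newton_exp_asymptotic \<alpha> \<beta> by unfold_locales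
    show ?thesis unfolding newton by (rule A.no_wandering_domain)
  qed
  moreover have iff: "(\<exists>x::real. h (of_real x) = 0) \<longleftrightarrow>
       \<beta> > 0 \<or> (\<beta> < 0 \<and> \<alpha> \<le> \<beta> * (1 - ln (- \<beta>)))"
    unfolding zero by (rule exp_plus_linear_has_zero_iff) (rule E.beta_nonzero)
  moreover have "a * b > 0 \<longleftrightarrow> \<beta> > 0" "a * b < 0 \<longleftrightarrow> \<beta> < 0"
    by (auto simp: assms(5) zero_less_mult_iff zero_less_divide_iff mult_less_0_iff divide_less_0_iff)
  \<comment> \<open>The quotient c/b is \<alpha>/\<beta>, and multiplication by the negative \<beta>
    reverses the inequality.\<close>
  moreover have "c / b \<ge> 1 - ln (- b / a) \<longleftrightarrow> \<alpha> \<le> \<beta> * (1 - ln (- \<beta>))" if "\<beta> < 0"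
  proof -
    have "c / b = \<alpha> / \<beta>" "- b / a = - \<beta>" using assms by simp_all
    then show ?thesis using neg_le_divide_eq[OF that, of "1 - ln (- \<beta>)" \<alpha>] by (simp add: mult.commute)
  qed
  ultimately show ?thesis by blast
qed

end
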